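(* Suppose $w \in S_\infty$ and $\mu$ is a strict partition. Then $\kappa^{\mathsf P}_{w,\mu}$ and $\kappa^{\mathsf Q}_{w,\mu}$ are nonzero linear combinations of key polynomials $\kappa_\alpha$ ($\alpha$ a weak composition) with nonnegative integer coefficients. Similarly, $\overline\kappa^{\mathsf P}_{w,\mu}$ and $\overline\kappa^{\mathsf Q}_{w,\mu}$ are linear combinations of atom polynomials $\overline\kappa_\alpha$ with nonnegative integer coefficients.
   Context: Let $\mathbb N=\{0,1,2,\dots\}$, $\mathbb P=\{1,2,3,\dots\}$. $S_\infty$ is the group of permutations of $\mathbb P$ generated by $s_i=(i\;\,i+1)$, $i\in\mathbb P$; it acts on $\mathbb Z[x_1,x_2,\dots]$ by permuting variables. Define $\pi_i f=(x_if-x_{i+1}s_if)/(x_i-x_{i+1})$ and $\overline\pi_i=\pi_i-1$. These satisfy the braid relations, so for $w\in S_\infty$ one sets $\pi_w=\pi_{i_1}\cdots\pi_{i_l}$ and $\overline\pi_w=\overline\pi_{i_1}\cdots\overline\pi_{i_l}$ for any reduced word $i_1\cdots i_l$ of $w$. A weak composition is a sequence $\alpha=(\alpha_1,\alpha_2,\dots)$ of nonnegative integers with finite sum; $x^\alpha=\prod_i x_i^{\alpha_i}$. A partition is a weakly decreasing weak composition; it is strict if its nonzero parts are distinct. $S_\infty$ acts on weak compositions by $w\alpha=(\alpha_{w^{-1}(1)},\alpha_{w^{-1}(2)},\dots)$. Let $\lambda(\alpha)$ be the partition obtained by sorting $\alpha$ and $u(\alpha)\in S_\infty$ the unique minimal-length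 permutation with $\alpha=u(\alpha)\lambda(\alpha)$. The key polynomial is $\kappa_\alpha=\pi_{u(\alpha)}x^{\lambda(\alpha)}$ and the atom polynomial is $\overline\kappa_\alpha=\overline\pi_{u(\alpha)}x^{\lambda(\alpha)}$. The Young diagram of a partition $\mu$ is $\mathsf D_\mu=\{(i,j)\in\mathbb P\times\mathbb P: 1\le j\le\mu_i\}$. For $w\in S_\infty$ and a strict partition $\mu$, put $$\kappa^{\mathsf P}_{w,\mu}=\pi_w\Big(\prod_{(i,j)\in\mathsf D_\mu}(x_i+x_{i+j})\Big),\quad \kappa^{\mathsf Q}_{w,\mu}=\pi_w\Big(\prod_{(i,j)\in\mathsf D_\mu}(x_i+x_{i+j-1})\Big),$$ $$\overline\kappa^{\mathsf P}_{w,\mu}=\overline\pi_w\Big(\prod_{(i,j)\in\mathsf D_\mu}(x_i+x_{i+j})\Big),\quad \overline\kappa^{\mathsf Q}_{w,\mu}=\overline\pi_w\Big(\prod_{(i,j)\in\mathsf D_\mu}(x_i+x_{i+j-1})\Big).$$ *)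

theory Defs
  imports "HOL-Library.Poly_Mapping" "HOL-Combinatorics.Transposition"
begin

text \<open>
  The index set of the positive integers is relabelled by the naturals: the index \<open>i\<close> stands
  for \<open>i + 1\<close>. So \<open>var i\<close> is the variable usually written \<open>x\<close> with subscript \<open>i + 1\<close>,
  \<open>lookup \<alpha> i\<close> is the part of \<open>\<alpha>\<close> in position \<open>i + 1\<close>, and \<open>S_inf\<close> permutes \<open>nat\<close>.
  With this, the types below are exactly the weak compositions and the polynomial ring over the
  integers in countably many variables.
\<close>

type_synonym wcomp = "nat \<Rightarrow>\<^sub>0 nat"
type_synonym ipoly = "wcomp \<Rightarrow>\<^sub>0 int"

definition mon :: "wcomp \<Rightarrow> ipoly" where
  "mon \<alpha> = Poly_Mapping.single \<alpha> 1"

definition var :: "nat \<Rightarrow> ipoly" where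
  "var i = mon (Poly_Mapping.single i 1)"


definition simple_refl :: "nat \<Rightarrow> nat \<Rightarrow> nat" where
  "simple_refl i = transpose i (Suc i)"

definition word_perm :: "nat list \<Rightarrow> nat \<Rightarrow> nat" where
  "word_perm is = foldr (\<lambda>i v. simple_refl i \<circ> v) is id"

text \<open>The generators are involutions, so the group they generate consists of the products of words.\<close>

definition S_inf :: "(nat \<Rightarrow> nat) set" where
  "S_inf = {w. \<exists>is. w = word_perm is}"

definition perm_length :: "(nat \<Rightarrow> nat) \<Rightarrow> nat" where
  "perm_length w = (LEAST n. \<exists>is. word_perm is = w \<and> length is = n)"

definition reduced_word :: "(nat \<Rightarrow> nat) \<Rightarrow> nat list \<Rightarrow> bool" where
  "reduced_word w is \<longleftrightarrow> word_perm is = w \<and> length is = perm_length w"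


text \<open>Left action on weak compositions: part \<open>i\<close> of \<open>w \<alpha>\<close> is part \<open>inv w i\<close> of \<open>\<alpha>\<close>.\<close>

definition perm_comp :: "(nat \<Rightarrow> nat) \<Rightarrow> wcomp \<Rightarrow> wcomp" where
  "perm_comp w \<alpha> = Poly_Mapping.map_key (inv w) \<alpha>"

text \<open>
  Left action on polynomials by \<open>var i \<mapsto> var (w i)\<close>: the coefficient of the monomial \<open>\<beta>\<close> in
  \<open>w f\<close> is the coefficient of \<open>inv w \<beta>\<close> in \<open>f\<close>. See \<open>perm_poly_mon\<close> and \<open>perm_poly_var\<close>.
\<close>

definition perm_poly :: "(nat \<Rightarrow> nat) \<Rightarrow> ipoly \<Rightarrow> ipoly" where
  "perm_poly w f = Poly_Mapping.map_key (perm_comp (inv w)) f"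

lemma lookup_perm_comp:
  assumes "bij w"
  shows "Poly_Mapping.lookup (perm_comp w \<alpha>) i = Poly_Mapping.lookup \<alpha> (inv w i)"
  unfolding perm_comp_def using assms
  by (simp add: Poly_Mapping.map_key.rep_eq bij_is_inj bij_imp_bij_inv)

lemma perm_comp_inverse:
  assumes "bij w"
  shows "perm_comp (inv w) (perm_comp w \<alpha>) = \<alpha>" "perm_comp w (perm_comp (inv w) \<alpha>) = \<alpha>"
  using assms
  by (auto intro!: poly_mapping_eqI simp: lookup_perm_comp bij_imp_bij_inv inv_inv_eq
      bij_is_inj surj_f_inv_f bij_is_surj)

lemma inj_perm_comp: "bij w \<Longrightarrow> inj (perm_comp w)"
  by (metis injI perm_comp_inverse(1))

lemma perm_poly_single:
  assumes "bij w"
  shows "perm_poly w (Poly_Mapping.single \<alpha> c) = Poly_Mapping.single (perm_comp w \<alpha>) c"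
proof -
  have inj: "inj (perm_comp (inv w))"
    using assms by (simp add: bij_imp_bij_inv inj_perm_comp)
  have "Poly_Mapping.map_key (perm_comp (inv w))
          (Poly_Mapping.single (perm_comp (inv w) (perm_comp w \<alpha>)) c)
        = Poly_Mapping.single (perm_comp w \<alpha>) c"
    by (rule map_key_single[OF inj])
  then show ?thesis
    unfolding perm_poly_def using perm_comp_inverse[OF assms] by simp
qed

lemma perm_poly_mon: "bij w \<Longrightarrow> perm_poly w (mon \<alpha>) = mon (perm_comp w \<alpha>)"
  by (simp add: mon_def perm_poly_single)

lemma perm_poly_var: "bij w \<Longrightarrow> perm_poly w (var i) = var (w i)"
proof -
  assume w: "bij w"
  have "perm_comp w (Poly_Mapping.single i 1) = Poly_Mapping.single (w i) 1"
    using w by (intro poly_mapping_eqI)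
      (auto simp: lookup_perm_comp lookup_single when_def bij_is_inj surj_f_inv_f bij_is_surj)
  then show ?thesis
    by (simp add: var_def perm_poly_mon[OF w])
qed

lemma perm_poly_add:
  "bij w \<Longrightarrow> perm_poly w (f + g) = perm_poly w f + perm_poly w g"
  unfolding perm_poly_def by (simp add: map_key_plus bij_imp_bij_inv inj_perm_comp)


text \<open>
  The quotient defining the Demazure operator is the polynomial \<open>g\<close> with
  \<open>(var i - var (i + 1)) * g\<close> equal to the numerator; \<open>demazure_eq\<close> shows that it exists.
\<close>

definition demazure :: "nat \<Rightarrow> ipoly \<Rightarrow> ipoly" where
  "demazure i f = (THE g. (var i - var (Suc i)) * g
     = var i * f - var (Suc i) * perm_poly (simple_refl i) f)"

definition demazure_bar :: "nat \<Rightarrow> ipoly \<Rightarrow> ipoly" where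
  "demazure_bar i f = demazure i f - f"

lemma bij_simple_refl: "bij (simple_refl i)"
  by (simp add: simple_refl_def)

lemma inv_simple_refl: "inv (simple_refl i) = simple_refl i"
  by (simp add: simple_refl_def)

lemma var_diff_nonzero: "var i - var (Suc i) \<noteq> 0"
proof
  assume "var i - var (Suc i) = 0"
  then have "var i = var (Suc i)" by simp
  then have "Poly_Mapping.lookup (var i) (Poly_Mapping.single i 1)
    = Poly_Mapping.lookup (var (Suc i)) (Poly_Mapping.single i 1)" by simp
  moreover have "Poly_Mapping.single i (1::nat) \<noteq> Poly_Mapping.single (Suc i) 1"
    by (metis lookup_single_eq lookup_single_not_eq n_not_Suc_n one_neq_zero)
  ultimately show False
    by (simp add: var_def mon_def lookup_single when_def split: if_splits)
qed

lemma var_power: "var i ^ n = mon (Poly_Mapping.single i n)"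
  by (induction n)
    (auto simp: var_def mon_def mult_single single_add[symmetric] simp flip: single_one)

lemma diff_dvd_power_diff: "(x - y :: 'a::comm_ring_1) dvd x ^ k - y ^ k"
  unfolding power_diff_sumr2 by (rule dvd_triv_left)

lemma diff_dvd_powers:
  fixes x y :: "'a::comm_ring_1"
  shows "x - y dvd x ^ m * y ^ n - y ^ m * x ^ n"
proof (cases "n \<le> m")
  case True
  then obtain k where "m = n + k" using le_Suc_ex by blast
  then have "x ^ m * y ^ n - y ^ m * x ^ n = x ^ n * y ^ n * (x ^ k - y ^ k)"
    by (simp add: power_add algebra_simps)
  then show ?thesis by (simp only: dvd_mult diff_dvd_power_diff)
next
  case False
  then obtain k where "n = m + k" using le_Suc_ex nat_le_linear by blast
  then have "x ^ m * y ^ n - y ^ m * x ^ n = - (x ^ m * y ^ m) * (x ^ k - y ^ k)"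
    by (simp add: power_add algebra_simps)
  then show ?thesis by (simp only: dvd_mult diff_dvd_power_diff)
qed

lemma demazure_dvd_single:
  "var i - var (Suc i) dvd var i * Poly_Mapping.single \<alpha> c
     - var (Suc i) * perm_poly (simple_refl i) (Poly_Mapping.single \<alpha> c)"
proof -
  define a b where "a = Poly_Mapping.lookup \<alpha> i" and "b = Poly_Mapping.lookup \<alpha> (Suc i)"
  define \<gamma> where "\<gamma> = Poly_Mapping.update i 0 (Poly_Mapping.update (Suc i) 0 \<alpha>)"
  have g: "Poly_Mapping.single \<alpha> c = Poly_Mapping.single \<gamma> c * var i ^ a * var (Suc i) ^ b"
  proof -
    have "\<alpha> = \<gamma> + Poly_Mapping.single i a + Poly_Mapping.single (Suc i) b"
      by (rule poly_mapping_eqI)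
        (auto simp: lookup_add \<gamma>_def lookup_single when_def lookup_update a_def b_def)
    then show ?thesis by (simp add: var_power mon_def mult_single)
  qed
  have "perm_comp (simple_refl i) \<alpha>
      = \<gamma> + Poly_Mapping.single (Suc i) a + Poly_Mapping.single i b"
    by (rule poly_mapping_eqI)
      (auto simp: lookup_perm_comp[OF bij_simple_refl] inv_simple_refl lookup_add \<gamma>_def
        lookup_single when_def lookup_update a_def b_def,
       auto simp: simple_refl_def transpose_def)
  then have "perm_poly (simple_refl i) (Poly_Mapping.single \<alpha> c)
      = Poly_Mapping.single \<gamma> c * var (Suc i) ^ a * var i ^ b"
    by (simp add: perm_poly_single[OF bij_simple_refl] var_power mon_def mult_single)
  with g have "var i * Poly_Mapping.single \<alpha> c
        - var (Suc i) * perm_poly (simple_refl i) (Poly_Mapping.single \<alpha> c)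
      = Poly_Mapping.single \<gamma> c
        * (var i ^ Suc a * var (Suc i) ^ b - var (Suc i) ^ Suc a * var i ^ b)"
    by (simp add: algebra_simps)
  then show ?thesis by (simp only: dvd_mult diff_dvd_powers)
qed

lemma demazure_dvd:
  "var i - var (Suc i) dvd var i * f - var (Suc i) * perm_poly (simple_refl i) f"
proof (induction f rule: update_induct)
  case const
  then show ?case using demazure_dvd_single[of i 0 0] by simp
next
  case (update f \<alpha> c)
  let ?m = "Poly_Mapping.single \<alpha> c"
  have split: "Poly_Mapping.update \<alpha> c f = ?m + f"
    using update.hyps(1) by (intro poly_mapping_eqI)
      (auto simp: lookup_update lookup_add lookup_single when_def in_keys_iff)
  have "var i * (?m + f) - var (Suc i) * perm_poly (simple_refl i) (?m + f)
    = (var i * ?m - var (Suc i) * perm_poly (simple_refl i) ?m)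
      + (var i * f - var (Suc i) * perm_poly (simple_refl i) f)"
    by (simp add: perm_poly_add[OF bij_simple_refl] algebra_simps)
  then show ?case unfolding split
    using dvd_add[OF demazure_dvd_single update.IH] by (simp only:)
qed

lemma demazure_eq:
  "(var i - var (Suc i)) * demazure i f = var i * f - var (Suc i) * perm_poly (simple_refl i) f"
proof -
  obtain g where
    g: "var i * f - var (Suc i) * perm_poly (simple_refl i) f = (var i - var (Suc i)) * g"
    using demazure_dvd[of i f] by (rule dvdE)
  then have
    "\<exists>!g. (var i - var (Suc i)) * g = var i * f - var (Suc i) * perm_poly (simple_refl i) f"
    using mult_left_cancel[OF var_diff_nonzero[of i]] by (intro ex1I[of _ g]) simp_all
  then show ?thesis unfolding demazure_def by (rule theI')
qed

text \<open>
  Both families of operators satisfy the braid relations, so the choice of the reduced word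
  is immaterial; every \<open>w \<in> S_inf\<close> has one.
\<close>

definition demazure_perm :: "(nat \<Rightarrow> nat) \<Rightarrow> ipoly \<Rightarrow> ipoly" where
  "demazure_perm w f = foldr demazure (SOME is. reduced_word w is) f"

definition demazure_bar_perm :: "(nat \<Rightarrow> nat) \<Rightarrow> ipoly \<Rightarrow> ipoly" where
  "demazure_bar_perm w f = foldr demazure_bar (SOME is. reduced_word w is) f"

lemma reduced_word_exists: "w \<in> S_inf \<Longrightarrow> \<exists>is. reduced_word w is"
  unfolding S_inf_def reduced_word_def perm_length_def by (rule LeastI_ex) auto


definition is_partition :: "wcomp \<Rightarrow> bool" where
  "is_partition \<mu> \<longleftrightarrow> (\<forall>i j. i \<le> j \<longrightarrow> Poly_Mapping.lookup \<mu> j \<le> Poly_Mapping.lookup \<mu> i)"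

definition is_strict_partition :: "wcomp \<Rightarrow> bool" where
  "is_strict_partition \<mu> \<longleftrightarrow> is_partition \<mu> \<and>
     (\<forall>i j. i \<noteq> j \<and> Poly_Mapping.lookup \<mu> i \<noteq> 0 \<and> Poly_Mapping.lookup \<mu> j \<noteq> 0
        \<longrightarrow> Poly_Mapping.lookup \<mu> i \<noteq> Poly_Mapping.lookup \<mu> j)"

definition sort_comp :: "wcomp \<Rightarrow> wcomp" where
  "sort_comp \<alpha> = (THE \<mu>. is_partition \<mu> \<and> (\<exists>w\<in>S_inf. \<alpha> = perm_comp w \<mu>))"

definition sort_perm :: "wcomp \<Rightarrow> nat \<Rightarrow> nat" where
  "sort_perm \<alpha> = (ARG_MIN perm_length w. w \<in> S_inf \<and> \<alpha> = perm_comp w (sort_comp \<alpha>))"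

definition key_poly :: "wcomp \<Rightarrow> ipoly" where
  "key_poly \<alpha> = demazure_perm (sort_perm \<alpha>) (mon (sort_comp \<alpha>))"

definition atom_poly :: "wcomp \<Rightarrow> ipoly" where
  "atom_poly \<alpha> = demazure_bar_perm (sort_perm \<alpha>) (mon (sort_comp \<alpha>))"


text \<open>
  Rows are relabelled by the naturals, columns are not: a cell \<open>(i, j)\<close> has \<open>j \<ge> 1\<close>, and so
  the index expressions \<open>i + j\<close> and \<open>i + j - 1\<close> keep their usual form.
\<close>

definition young_diagram :: "wcomp \<Rightarrow> (nat \<times> nat) set" where
  "young_diagram \<mu> = {(i, j). 1 \<le> j \<and> j \<le> Poly_Mapping.lookup \<mu> i}"

lemma finite_young_diagram: "finite (young_diagram \<mu>)"
proof (rule finite_subset)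
  show "young_diagram \<mu> \<subseteq> (SIGMA i:Poly_Mapping.keys \<mu>. {..Poly_Mapping.lookup \<mu> i})"
    by (auto simp: young_diagram_def in_keys_iff)
qed auto

definition key_P :: "(nat \<Rightarrow> nat) \<Rightarrow> wcomp \<Rightarrow> ipoly" where
  "key_P w \<mu> = demazure_perm w (\<Prod>(i, j)\<in>young_diagram \<mu>. var i + var (i + j))"

definition key_Q :: "(nat \<Rightarrow> nat) \<Rightarrow> wcomp \<Rightarrow> ipoly" where
  "key_Q w \<mu> = demazure_perm w (\<Prod>(i, j)\<in>young_diagram \<mu>. var i + var (i + j - 1))"

definition atom_P :: "(nat \<Rightarrow> nat) \<Rightarrow> wcomp \<Rightarrow> ipoly" where
  "atom_P w \<mu> = demazure_bar_perm w (\<Prod>(i, j)\<in>young_diagram \<mu>. var i + var (i + j))"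

definition atom_Q :: "(nat \<Rightarrow> nat) \<Rightarrow> wcomp \<Rightarrow> ipoly" where
  "atom_Q w \<mu> = demazure_bar_perm w (\<Prod>(i, j)\<in>young_diagram \<mu>. var i + var (i + j - 1))"


definition nonneg_combination :: "(wcomp \<Rightarrow> ipoly) \<Rightarrow> ipoly \<Rightarrow> bool" where
  "nonneg_combination B f \<longleftrightarrow>
     (\<exists>A (c :: wcomp \<Rightarrow> nat). finite A \<and> f = (\<Sum>\<alpha>\<in>A. of_nat (c \<alpha>) * B \<alpha>))"

end

theory Submission
  imports Defs "HOL-Combinatorics.Permutations"
begin

text \<open>
  It suffices to treat \<open>w = 1\<close>. A Demazure operator maps a key polynomial to a key polynomial. A
  barred operator \<open>demazure_bar_perm w\<close> composed with \<open>demazure i\<close> on the right is either zero or a sum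
  of one or two barred operators, which gives atom positivity.

  The product \<open>F\<close> for the shifted staircase \<open>(2M - 2, 2M - 4, \<dots>, 2)\<close> satisfies
  \<open>ddiff i F = ddiff (2M - 2 - i) F\<close> and \<open>ddiff (M - 1) F = 0\<close>. Hence all its divided differences of degree
  zero lie in \<open>{0, 1}\<close>, so \<open>F\<close> is a sum of distinct Schubert polynomials. Removing cells one by one, from the
  bottom row upwards, is the effect of divided differences, so the product for every strict partition is
  a sum of Schubert polynomials, times a power of 2 and a dominant monomial in type Q.
  Schubert polynomials are key positive by Magyar's orthodontia, given that multiplication by
  \<open>vars {..<k}\<close> preserves key positivity.
\<close>

text \<open>Why the values are 0 or 1: list a permutation of \<open>{..<2 * M}\<close> as pairs of
  values in mirrored positions. The symmetry of \<open>F\<close> exchanges neighbouring pairs, or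
  gives zero. A nonzero value forces increasing pairs without a forbidden nesting, and then the
  length \<open>M * (M - 1)\<close>, the degree of \<open>F\<close>, is reached only by pairwise
  disjoint intervals. These can be sorted into (0, 1), (2, 3), ..., so all nonzero values agree;
  emptying the diagram shows the common value to be 1. The obstacle throughout is sign: neither
  products nor divided differences preserve key positivity in general. Demazure operators do.
  Multiplication by \<open>vars {..<k}\<close> does as well, because the negative terms that arise
  when it passes a Demazure operator cancel in pairs. Nonvanishing: among the key polynomials of a
  sum, take one whose dominant monomial has the largest norm. Every summand has coefficient 0 or 1
  at this monomial, so nothing cancels, and a Demazure operator turns each summand into a key
  polynomial again.\<close>

abbreviation (input) "lookup \<equiv> Poly_Mapping.lookup"
abbreviation (input) "keys \<equiv> Poly_Mapping.keys"
abbreviation (input) "single \<equiv> Poly_Mapping.single"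
abbreviation (input) "update \<equiv> Poly_Mapping.update"
abbreviation (input) "key_positive \<equiv> nonneg_combination key_poly"

section \<open>Permutations and reduced words\<close>

lemma simple_refl_simps [simp]:
  "simple_refl i i = Suc i" "simple_refl i (Suc i) = i"
  "simple_refl i (simple_refl i j) = j"
  by (auto simp: simple_refl_def)

lemma simple_refl_other: "j \<noteq> i \<Longrightarrow> j \<noteq> Suc i \<Longrightarrow> simple_refl i j = j"
  by (simp add: simple_refl_def)

lemma simple_refl_eq: "simple_refl i j = (if j = i then Suc i else if j = Suc i then i else j)"
  by (simp add: simple_refl_def transpose_def)

lemma simple_refl_comp_cancel [simp]:
  "simple_refl i \<circ> (simple_refl i \<circ> w) = w" "w \<circ> simple_refl i \<circ> simple_refl i = w"
  by (auto simp: fun_eq_iff)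

lemma simple_refl_commute: "Suc i < j \<Longrightarrow> simple_refl i (simple_refl j k) = simple_refl j (simple_refl i k)"
  by (auto simp: simple_refl_eq)

lemma simple_refl_braid:
  "simple_refl i (simple_refl (Suc i) (simple_refl i k))
   = simple_refl (Suc i) (simple_refl i (simple_refl (Suc i) k))"
  by (auto simp: simple_refl_eq)

lemma word_perm_Nil [simp]: "word_perm [] = id"
  and word_perm_Cons [simp]: "word_perm (i # is) = simple_refl i \<circ> word_perm is"
  by (simp_all add: word_perm_def)

lemma word_perm_append: "word_perm (is @ js) = word_perm is \<circ> word_perm js"
  by (induction "is") (auto simp: fun_eq_iff)

lemma bij_word_perm: "bij (word_perm is)"
  by (induction "is") (simp_all only: word_perm_Nil word_perm_Cons bij_id bij_comp bij_simple_refl)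

lemma inv_word_perm: "inv (word_perm is) = word_perm (rev is)"
proof (induction "is")
  case (Cons i "is")
  then show ?case
    by (simp only: rev.simps word_perm_append word_perm_Cons word_perm_Nil o_inv_distrib bij_word_perm
        bij_simple_refl inv_simple_refl comp_id)
qed (simp only: rev.simps word_perm_Nil inv_id)

lemma S_inf_bij: "w \<in> S_inf \<Longrightarrow> bij w"
  using bij_word_perm by (auto simp: S_inf_def)

lemma word_perm_S_inf [simp]: "word_perm is \<in> S_inf"
  by (auto simp: S_inf_def)

lemma id_S_inf [simp]: "id \<in> S_inf"
  using word_perm_S_inf[of "[]"] by simp

lemma S_inf_left [simp]:
  assumes "w \<in> S_inf" shows "simple_refl i \<circ> w \<in> S_inf"
proof -
  obtain "is" where "w = word_perm is" using assms by (auto simp: S_inf_def)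
  then have "simple_refl i \<circ> w = word_perm (i # is)" by (simp only: word_perm_Cons)
  then show ?thesis by (simp only: word_perm_S_inf)
qed

lemma S_inf_right [simp]:
  assumes "w \<in> S_inf" shows "w \<circ> simple_refl i \<in> S_inf"
proof -
  obtain "is" where "w = word_perm is" using assms by (auto simp: S_inf_def)
  then have "w \<circ> simple_refl i = word_perm (is @ [i])"
    by (simp only: word_perm_append word_perm_Cons word_perm_Nil comp_id)
  then show ?thesis by (simp only: word_perm_S_inf)
qed

lemma S_inf_inv: "w \<in> S_inf \<Longrightarrow> inv w \<in> S_inf"
  unfolding S_inf_def using inv_word_perm by force

section \<open>Length as the number of inversions\<close>

definition inversions :: "(nat \<Rightarrow> nat) \<Rightarrow> (nat \<times> nat) set" where
  "inversions w = {(i, j). i < j \<and> w j < w i}"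

lemma inversions_id [simp]: "inversions id = {}" "inversions (\<lambda>i. i) = {}"
  by (auto simp: inversions_def)

lemma simple_refl_less:
  "i < j \<Longrightarrow> (i, j) \<noteq> (k, Suc k) \<Longrightarrow> simple_refl k i < simple_refl k j"
  by (auto simp: simple_refl_eq)

text \<open>Apart from \<open>(k, Suc k)\<close>, the reflection preserves the order of two
  positions, so it carries inversions to inversions; the exceptional pair is the one gained.\<close>

lemma inversions_step:
  assumes "w k < w (Suc k)"
  shows "inversions (w \<circ> simple_refl k)
    = insert (k, Suc k) (map_prod (simple_refl k) (simple_refl k) ` inversions w)" (is "?L = ?R")
proof (intro equalityI subsetI)
  fix x assume x: "x \<in> ?L"
  obtain i j where ij: "x = (i, j)" "i < j" "w (simple_refl k j) < w (simple_refl k i)"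
    using x by (auto simp: inversions_def)
  show "x \<in> ?R"
  proof (cases "x = (k, Suc k)")
    case False
    then have "(simple_refl k i, simple_refl k j) \<in> inversions w"
      using ij simple_refl_less by (auto simp: inversions_def)
    then show ?thesis using ij(1)
      by (auto intro!: image_eqI[of _ _ "(simple_refl k i, simple_refl k j)"])
  qed auto
next
  fix x assume x: "x \<in> ?R"
  show "x \<in> ?L"
  proof (cases "x = (k, Suc k)")
    case True
    then show ?thesis using assms by (simp add: inversions_def)
  next
    case False
    then obtain i j where ij: "x = (simple_refl k i, simple_refl k j)" "i < j" "w j < w i"
      using x by (auto simp: inversions_def)
    then have "(i, j) \<noteq> (k, Suc k)" using assms by auto
    then show ?thesis using ij simple_refl_less by (auto simp: inversions_def)
  qed
qed

lemma card_inversions_step: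
  assumes "w k < w (Suc k)" "finite (inversions w)"
  shows "finite (inversions (w \<circ> simple_refl k))"
    "card (inversions (w \<circ> simple_refl k)) = Suc (card (inversions w))"
proof -
  show "finite (inversions (w \<circ> simple_refl k))"
    using assms by (simp add: inversions_step)
  have inj: "inj (map_prod (simple_refl k) (simple_refl k))"
    by (intro prod.inj_map bij_is_inj bij_simple_refl)
  \<comment> \<open>Its preimage would be \<open>(Suc k, k)\<close>, which is not
    increasing.\<close>
  have "(k, Suc k) \<notin> map_prod (simple_refl k) (simple_refl k) ` inversions w"
  proof
    assume "(k, Suc k) \<in> map_prod (simple_refl k) (simple_refl k) ` inversions w"
    then show False by (auto simp: inversions_def simple_refl_eq split: if_splits)
  qed
  then show "card (inversions (w \<circ> simple_refl k)) = Suc (card (inversions w))"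
    using assms inj by (simp add: inversions_step card_image inj_on_subset)
qed

lemma card_inversions_step_down:
  assumes "w (Suc k) < w k" "finite (inversions w)"
  shows "finite (inversions (w \<circ> simple_refl k))"
    "card (inversions w) = Suc (card (inversions (w \<circ> simple_refl k)))"
proof -
  have "inversions (w \<circ> simple_refl k) \<subseteq> map_prod (simple_refl k) (simple_refl k) ` inversions w"
  proof
    fix x assume "x \<in> inversions (w \<circ> simple_refl k)"
    then obtain i j where ij: "x = (i, j)" "i < j" "w (simple_refl k j) < w (simple_refl k i)"
      by (auto simp: inversions_def)
    then have "(i, j) \<noteq> (k, Suc k)" using assms(1) by auto
    then have "simple_refl k i < simple_refl k j" using ij simple_refl_less by blast
    then show "x \<in> map_prod (simple_refl k) (simple_refl k) ` inversions w" using ij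
      by (auto simp: inversions_def intro!: image_eqI[of _ _ "(simple_refl k i, simple_refl k j)"])
  qed
  then show fin: "finite (inversions (w \<circ> simple_refl k))"
    by (rule finite_subset) (simp add: assms(2))
  show "card (inversions w) = Suc (card (inversions (w \<circ> simple_refl k)))"
    using card_inversions_step(2)[of "w \<circ> simple_refl k" k] fin assms(1) by simp
qed

lemma bij_step_cases:
  fixes w :: "nat \<Rightarrow> nat"
  assumes "bij w"
  obtains "w k < w (Suc k)" | "w (Suc k) < w k"
proof -
  have "w k \<noteq> w (Suc k)" using assms by (metis bij_pointE n_not_Suc_n)
  then show ?thesis using that by linarith
qed

lemma finite_inversions_word_perm:
  "finite (inversions (word_perm is)) \<and> card (inversions (word_perm is)) \<le> length is"
proof (induction "is" rule: rev_induct)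
  case Nil
  show ?case by simp
next
  case (snoc k "is")
  have "word_perm (is @ [k]) = word_perm is \<circ> simple_refl k" by (simp add: word_perm_append)
  then show ?case
    using snoc card_inversions_step[of "word_perm is" k] card_inversions_step_down[of "word_perm is" k]
    by (cases rule: bij_step_cases[OF bij_word_perm, of "is" k]) (auto simp del: o_apply)
qed

lemma bij_strict_mono_id:
  fixes w :: "nat \<Rightarrow> nat"
  assumes "bij w" "strict_mono w"
  shows "w = id"
proof -
  have "w n = n" for n
  proof (induction n rule: less_induct)
    case (less n)
    have "n \<le> w n" using assms(2) by (simp add: strict_mono_imp_increasing)
    obtain m where m: "w m = n" using assms(1) by (metis bij_pointE)
    have "m = n"
    proof (rule ccontr)
      assume "m \<noteq> n"
      moreover have "m \<le> n" using m strict_mono_imp_increasing[OF assms(2), of m] by simp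
      ultimately show False using less m by simp
    qed
    then show ?case using m by simp
  qed
  then show ?thesis by auto
qed

text \<open>Bubble sort: removing a descent costs exactly one inversion, and a bijection without
  descents is the identity.\<close>

lemma exists_word:
  assumes "bij w" "finite (inversions w)"
  shows "\<exists>is. word_perm is = w \<and> length is = card (inversions w)"
  using assms
proof (induction "card (inversions w)" arbitrary: w rule: less_induct)
  case less
  show ?case
  proof (cases "\<exists>k. w (Suc k) < w k")
    case True
    then obtain k where k: "w (Suc k) < w k" by blast
    obtain "is" where "word_perm is = w \<circ> simple_refl k" "length is = card (inversions (w \<circ> simple_refl k))"
      using less.hyps[of "w \<circ> simple_refl k"] card_inversions_step_down[OF k less.prems(2)] less.prems
      by (auto intro: bij_comp bij_simple_refl)
    then show ?thesis
      using card_inversions_step_down[OF k less.prems(2)]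
      by (intro exI[of _ "is @ [k]"]) (simp add: word_perm_append)
  next
    case False
    then have "w k < w (Suc k)" for k using less.prems(1) by (metis bij_step_cases)
    then have "strict_mono w" by (simp add: strict_mono_Suc_iff)
    then have "w = id" using less.prems(1) bij_strict_mono_id by blast
    then show ?thesis by (intro exI[of _ "[]"]) simp
  qed
qed

lemma inversions_permutes:
  assumes "w permutes {..<n}"
  shows "inversions w \<subseteq> {..<n} \<times> {..<n}"
proof
  fix x assume "x \<in> inversions w"
  then obtain i j where ij: "x = (i, j)" "i < j" "w j < w i" by (auto simp: inversions_def)
  have "j < n"
  proof (rule ccontr)
    assume j: "\<not> j < n"
    then have "w j = j" using permutes_not_in[OF assms, of j] by simp
    moreover have "w i < j"
      using permutes_in_image[OF assms, of i] permutes_not_in[OF assms, of i] ij(2) j by (cases "i < n") auto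
    ultimately show False using ij by simp
  qed
  then show "x \<in> {..<n} \<times> {..<n}" using ij by simp
qed

lemma permutes_S_inf:
  assumes "w permutes {..<n}"
  shows "w \<in> S_inf"
proof -
  have "finite (inversions w)" by (rule finite_subset[OF inversions_permutes[OF assms]]) simp
  then show ?thesis using exists_word[OF permutes_bij[OF assms]] by (auto simp: S_inf_def)
qed

lemma finite_inversions: "w \<in> S_inf \<Longrightarrow> finite (inversions w)"
  using finite_inversions_word_perm by (auto simp: S_inf_def)

lemma perm_length_inversions:
  assumes "w \<in> S_inf"
  shows "perm_length w = card (inversions w)"
  unfolding perm_length_def
proof (rule Least_equality)
  show "\<exists>is. word_perm is = w \<and> length is = card (inversions w)"
    using exists_word S_inf_bij finite_inversions assms by blast
qed (use finite_inversions_word_perm in auto)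

lemma perm_length_inv:
  assumes "w \<in> S_inf"
  shows "perm_length (inv w) = perm_length w"
proof -
  have *: "(\<exists>is. word_perm is = inv w \<and> length is = n) \<longleftrightarrow> (\<exists>is. word_perm is = w \<and> length is = n)" for n
    by (metis S_inf_bij assms bij_word_perm inv_inv_eq inv_word_perm length_rev)
  show ?thesis unfolding perm_length_def * ..
qed

lemma perm_length_right:
  assumes "w \<in> S_inf"
  shows "w k < w (Suc k) \<Longrightarrow> perm_length (w \<circ> simple_refl k) = Suc (perm_length w)"
    "w (Suc k) < w k \<Longrightarrow> perm_length w = Suc (perm_length (w \<circ> simple_refl k))"
  using assms card_inversions_step card_inversions_step_down
  by (auto simp: perm_length_inversions finite_inversions)

lemma inv_left: "w \<in> S_inf \<Longrightarrow> inv (simple_refl k \<circ> w) = inv w \<circ> simple_refl k"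
  by (simp add: o_inv_distrib S_inf_bij bij_simple_refl inv_simple_refl)

lemma inv_right: "w \<in> S_inf \<Longrightarrow> inv (w \<circ> simple_refl k) = simple_refl k \<circ> inv w"
  by (simp add: o_inv_distrib S_inf_bij bij_simple_refl inv_simple_refl)

lemma perm_length_left:
  assumes "w \<in> S_inf"
  shows "inv w k < inv w (Suc k) \<Longrightarrow> perm_length (simple_refl k \<circ> w) = Suc (perm_length w)"
    "inv w (Suc k) < inv w k \<Longrightarrow> perm_length w = Suc (perm_length (simple_refl k \<circ> w))"
  using perm_length_right[OF S_inf_inv[OF assms], of k] assms perm_length_inv[of w]
    perm_length_inv[of "simple_refl k \<circ> w"] inv_left[of w k]
  by auto

lemma perm_length_id [simp]: "perm_length id = 0"
  by (simp only: perm_length_inversions id_S_inf inversions_id card.empty)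

lemma perm_length_0: "w \<in> S_inf \<Longrightarrow> perm_length w = 0 \<Longrightarrow> w = id"
  using reduced_word_exists by (fastforce simp: reduced_word_def)

lemma perm_length_word_perm: "perm_length (word_perm is) \<le> length is"
  by (simp add: perm_length_inversions finite_inversions_word_perm)

lemma reduced_word_S_inf: "reduced_word w is \<Longrightarrow> w \<in> S_inf"
  by (auto simp: reduced_word_def)

text \<open>At an ascent, multiplying by the first letter would lengthen \<open>w\<close>, but the
  remaining word is shorter than \<open>w\<close>.\<close>

lemma reduced_word_ConsD:
  assumes "reduced_word w (i # is)"
  shows "inv w (Suc i) < inv w i" "reduced_word (simple_refl i \<circ> w) is"
proof -
  have w: "w \<in> S_inf" using assms by (rule reduced_word_S_inf)
  have is_eq: "word_perm is = simple_refl i \<circ> w" using assms by (auto simp: reduced_word_def)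
  have le: "perm_length (simple_refl i \<circ> w) \<le> length is"
    using perm_length_word_perm[of "is"] is_eq by simp
  have len: "Suc (length is) = perm_length w" using assms by (simp add: reduced_word_def)
  show d: "inv w (Suc i) < inv w i"
    using perm_length_left(1)[OF w, of i] le len
    by (cases rule: bij_step_cases[OF S_inf_bij[OF S_inf_inv[OF w]], of i]) auto
  show "reduced_word (simple_refl i \<circ> w) is"
    using perm_length_left(2)[OF w d] is_eq len by (simp add: reduced_word_def)
qed

lemma reduced_word_Cons:
  assumes "reduced_word w is" "inv w i < inv w (Suc i)"
  shows "reduced_word (simple_refl i \<circ> w) (i # is)"
  using assms perm_length_left(1)[OF reduced_word_S_inf] by (auto simp: reduced_word_def)

lemma reduced_word_Cons_down:
  assumes "w \<in> S_inf" "reduced_word (simple_refl i \<circ> w) is" "inv w (Suc i) < inv w i"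
  shows "reduced_word w (i # is)"
  using assms perm_length_left(2)[of w i] by (auto simp: reduced_word_def)

section \<open>Matsumoto's theorem and operators indexed by permutations\<close>

definition braid_family :: "(nat \<Rightarrow> 'a \<Rightarrow> 'a) \<Rightarrow> bool" where
  "braid_family f \<longleftrightarrow> (\<forall>i j x. Suc i < j \<longrightarrow> f i (f j x) = f j (f i x)) \<and>
     (\<forall>i x. f i (f (Suc i) (f i x)) = f (Suc i) (f i (f (Suc i) x)))"

text \<open>If the words start with different letters, both letters are left descents of
  \<open>w\<close>, so \<open>w\<close> also has a reduced word starting with the longest element
  generated by the two reflections. The induction hypothesis compares each word with a common
  continuation, and one braid relation joins them.\<close>

theorem matsumoto:
  assumes "braid_family f" "reduced_word w a" "reduced_word w b"
  shows "foldr f a x = foldr f b x"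
  using assms(2,3)
proof (induction "length a" arbitrary: a b w rule: less_induct)
  case less
  \<comment> \<open>The induction hypothesis is a premise with its own bound \<open>n\<close>, so
    that \<open>main\<close> can also be used with the two words interchanged.\<close>
  have main: "foldr f a x = foldr f b x"
    if ij: "i < j" and a: "a = i # a'" and b: "b = j # b'"
      and ra: "reduced_word w a" and rb: "reduced_word w b" and lb: "length b \<le> n" "length a \<le> n"
      and IH: "\<And>c d v. length c < n \<Longrightarrow> reduced_word v c \<Longrightarrow> reduced_word v d \<Longrightarrow> foldr f c x = foldr f d x"
    for i j a a' b b' n
  proof -
    note A = reduced_word_ConsD[OF ra[unfolded a]] and B = reduced_word_ConsD[OF rb[unfolded b]]
    have w: "w \<in> S_inf" using ra by (rule reduced_word_S_inf)
    show ?thesis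
    proof (cases "j = Suc i")
      case False
      then have far: "Suc i < j" using ij by simp
      define v where "v = simple_refl j \<circ> (simple_refl i \<circ> w)"
      have v: "v \<in> S_inf" "v = simple_refl i \<circ> (simple_refl j \<circ> w)"
        using w far by (auto simp: v_def fun_eq_iff simple_refl_commute[of i j])
      obtain c where c: "reduced_word v c" using v reduced_word_exists by blast
      have "reduced_word (simple_refl i \<circ> w) (j # c)"
        using c w far B(1) by (intro reduced_word_Cons_down) (auto simp: v_def inv_left simple_refl_eq)
      then have 1: "foldr f a' x = foldr f (j # c) x" using lb a by (intro IH[OF _ A(2)]) auto
      have "reduced_word (simple_refl j \<circ> w) (i # c)"
        using c w far A(1) by (intro reduced_word_Cons_down) (auto simp: v(2) inv_left simple_refl_eq)
      then have 2: "foldr f b' x = foldr f (i # c) x" using lb b by (intro IH[OF _ B(2)]) auto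
      have "f i (f j (foldr f c x)) = f j (f i (foldr f c x))"
        using far assms(1) unfolding braid_family_def by blast
      then show ?thesis using 1 2 a b by simp
    next
      case True
      define v where "v = simple_refl i \<circ> (simple_refl j \<circ> (simple_refl i \<circ> w))"
      have v: "v \<in> S_inf" "v = simple_refl j \<circ> (simple_refl i \<circ> (simple_refl j \<circ> w))"
        using w True by (auto simp: v_def fun_eq_iff simple_refl_braid)
      obtain c where c: "reduced_word v c" using v reduced_word_exists by blast
      have "reduced_word (simple_refl j \<circ> (simple_refl i \<circ> w)) (i # c)"
        using c w True B(1) by (intro reduced_word_Cons_down) (auto simp: v_def inv_left simple_refl_eq)
      then have "reduced_word (simple_refl i \<circ> w) (j # i # c)"
        using w True A(1) B(1) by - (rule reduced_word_Cons_down, auto simp: inv_left simple_refl_eq)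
      then have 1: "foldr f a' x = foldr f (j # i # c) x" using lb a by (intro IH[OF _ A(2)]) auto
      have "reduced_word (simple_refl i \<circ> (simple_refl j \<circ> w)) (j # c)"
        using c w True A(1) by (intro reduced_word_Cons_down) (auto simp: v(2) inv_left simple_refl_eq)
      then have "reduced_word (simple_refl j \<circ> w) (i # j # c)"
        using w True A(1) B(1) by - (rule reduced_word_Cons_down, auto simp: inv_left simple_refl_eq)
      then have 2: "foldr f b' x = foldr f (i # j # c) x" using lb b by (intro IH[OF _ B(2)]) auto
      show ?thesis using 1 2 a b True assms(1) by (simp add: braid_family_def)
    qed
  qed
  have len: "length a = length b" using less.prems by (simp add: reduced_word_def)
  show ?case
  proof (cases a)
    case Nil
    then show ?thesis using len by simp
  next
    case a: (Cons i a')
    then obtain j b' where b: "b = j # b'" using len by (cases b) auto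
    consider "i = j" | "i < j" | "j < i" by linarith
    then show ?thesis
    proof cases
      case 1
      have "foldr f a' x = foldr f b' x"
        using reduced_word_ConsD(2)[OF less.prems(1)[unfolded a]] reduced_word_ConsD(2)[OF less.prems(2)[unfolded b]]
        unfolding 1[symmetric] by (rule less.hyps[rotated]) (simp add: a)
      then show ?thesis using a b 1 by simp
    next
      case 2
      show ?thesis
        by (rule main[OF 2 a b less.prems, of "length a"]) (use len in simp, simp, rule less.hyps)
    next
      case 3
      show ?thesis
        by (rule main[OF 3 b a less.prems(2,1), of "length a", symmetric]) (simp, use len in simp, rule less.hyps)
    qed
  qed
qed

text \<open>One construction serves divided differences and both Demazure families. The word is
  chosen exactly as in \<open>demazure_perm\<close> and \<open>demazure_bar_perm\<close>, so these
  are instances by unfolding.\<close>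

definition op_perm :: "(nat \<Rightarrow> 'a \<Rightarrow> 'a) \<Rightarrow> (nat \<Rightarrow> nat) \<Rightarrow> 'a \<Rightarrow> 'a" where
  "op_perm f w x = foldr f (SOME is. reduced_word w is) x"

lemma op_perm_word:
  assumes "braid_family f" "reduced_word w is"
  shows "op_perm f w x = foldr f is x"
  unfolding op_perm_def using assms by (metis matsumoto someI)

lemma op_perm_id [simp]: "op_perm f id x = x"
proof -
  have "(SOME is. reduced_word id is) = []"
    by (rule some_equality) (auto simp: reduced_word_def)
  then show ?thesis by (simp add: op_perm_def)
qed

lemma op_perm_left:
  assumes "braid_family f" "w \<in> S_inf" "inv w i < inv w (Suc i)"
  shows "op_perm f (simple_refl i \<circ> w) x = f i (op_perm f w x)"
proof -
  obtain "is" where "reduced_word w is" using assms(2) reduced_word_exists by blast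
  then show ?thesis using assms reduced_word_Cons op_perm_word by fastforce
qed

lemma op_perm_left_down:
  assumes "braid_family f" "w \<in> S_inf" "inv w (Suc i) < inv w i"
  shows "op_perm f w x = f i (op_perm f (simple_refl i \<circ> w) x)"
  using op_perm_left[of f "simple_refl i \<circ> w" i x] assms by (simp add: inv_left)

lemma op_perm_right:
  assumes "braid_family f" "w \<in> S_inf" "w i < w (Suc i)"
  shows "op_perm f (w \<circ> simple_refl i) x = op_perm f w (f i x)"
proof -
  obtain "is" where "is": "reduced_word w is" using assms(2) reduced_word_exists by blast
  then have "reduced_word (w \<circ> simple_refl i) (is @ [i])"
    using perm_length_right(1)[OF assms(2,3)] by (simp add: reduced_word_def word_perm_append)
  then show ?thesis using assms "is" op_perm_word by fastforce
qed

lemma op_perm_right_down: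
  assumes "braid_family f" "w \<in> S_inf" "w (Suc i) < w i"
  shows "op_perm f w x = op_perm f (w \<circ> simple_refl i) (f i x)"
  using op_perm_right[of f "w \<circ> simple_refl i" i x] assms by simp

section \<open>Divided differences and Demazure operators\<close>

lemma ipoly_sum_keys:
  "f = (\<Sum>\<alpha>\<in>keys f. single \<alpha> (lookup f \<alpha>))"
  by (rule poly_mapping_eqI)
    (auto simp: lookup_sum lookup_single when_def in_keys_iff if_distrib sum.delta cong: if_cong)

lemma ipoly_induct [case_names single add]:
  assumes "\<And>\<alpha> c. P (single \<alpha> c)" "\<And>f g. P f \<Longrightarrow> P g \<Longrightarrow> P (f + g)"
  shows "P (f :: 'a \<Rightarrow>\<^sub>0 'b::comm_monoid_add)"
proof (induction f rule: update_induct)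
  case const
  then show ?case using assms(1)[of undefined 0] by simp
next
  case (update f \<alpha> c)
  have "update \<alpha> c f = single \<alpha> c + f"
    using update.hyps(1) by (intro poly_mapping_eqI)
      (auto simp: lookup_update lookup_add lookup_single when_def in_keys_iff)
  then show ?case using assms update.IH by simp
qed

lemma perm_comp_add: "bij w \<Longrightarrow> perm_comp w (\<alpha> + \<beta>) = perm_comp w \<alpha> + perm_comp w \<beta>"
  by (rule poly_mapping_eqI) (simp add: lookup_perm_comp lookup_add)

lemma perm_comp_comp:
  assumes "bij w" "bij v"
  shows "perm_comp w (perm_comp v \<alpha>) = perm_comp (w \<circ> v) \<alpha>"
proof (rule poly_mapping_eqI)
  fix k
  have "lookup (perm_comp (w \<circ> v) \<alpha>) k = lookup \<alpha> (inv (w \<circ> v) k)"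
    using assms by (intro lookup_perm_comp bij_comp)
  also have "\<dots> = lookup \<alpha> (inv v (inv w k))"
    by (simp add: o_inv_distrib assms)
  finally show "lookup (perm_comp w (perm_comp v \<alpha>)) k = lookup (perm_comp (w \<circ> v) \<alpha>) k"
    using assms by (simp add: lookup_perm_comp)
qed

lemma perm_comp_id [simp]: "perm_comp id \<alpha> = \<alpha>"
  by (rule poly_mapping_eqI) (use lookup_perm_comp[OF bij_id] in simp)

lemma perm_poly_mult:
  assumes "bij w"
  shows "perm_poly w (f * g) = perm_poly w f * perm_poly w g"
proof (induction f rule: ipoly_induct)
  case (single \<alpha> c)
  show ?case
    by (induction g rule: ipoly_induct)
      (simp_all add: mult_single perm_poly_single assms perm_comp_add distrib_left perm_poly_add)
qed (simp add: distrib_right perm_poly_add assms)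

lemma perm_poly_comp:
  assumes "bij w" "bij v"
  shows "perm_poly w (perm_poly v f) = perm_poly (w \<circ> v) f"
  by (induction f rule: ipoly_induct)
    (simp_all only: perm_poly_single perm_comp_comp perm_poly_add assms bij_comp)

abbreviation swap_vars :: "nat \<Rightarrow> ipoly \<Rightarrow> ipoly" where
  "swap_vars i \<equiv> perm_poly (simple_refl i)"

lemma swap_vars_add: "swap_vars i (f + g) = swap_vars i f + swap_vars i g"
  and swap_vars_mult: "swap_vars i (f * g) = swap_vars i f * swap_vars i g"
  and swap_vars_var: "swap_vars i (var j) = var (simple_refl i j)"
  by (simp_all add: perm_poly_add perm_poly_mult perm_poly_var bij_simple_refl)

lemma swap_vars_single:
  "swap_vars i (single \<alpha> c) = single (perm_comp (simple_refl i) \<alpha>) c"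
  by (simp add: perm_poly_single bij_simple_refl)

lemma lookup_swap_comp [simp]:
  "lookup (perm_comp (simple_refl i) \<alpha>) j = lookup \<alpha> (simple_refl i j)"
  by (simp add: lookup_perm_comp bij_simple_refl inv_simple_refl)

lemma swap_comp_swap_comp [simp]: "perm_comp (simple_refl i) (perm_comp (simple_refl i) \<alpha>) = \<alpha>"
  by (rule poly_mapping_eqI) simp

lemma swap_vars_0 [simp]: "swap_vars i 0 = 0"
  using swap_vars_add[of i 0 0] by simp

lemma swap_vars_uminus: "swap_vars i (- f) = - swap_vars i f"
  using swap_vars_add[of i f "- f"] by (simp add: eq_neg_iff_add_eq_0 add.commute)

lemma swap_vars_diff: "swap_vars i (f - g) = swap_vars i f - swap_vars i g"
  using swap_vars_add[of i f "- g"] by (simp add: swap_vars_uminus)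

lemma swap_vars_of_nat [simp]: "swap_vars i (of_nat n) = of_nat n"
proof -
  have "perm_comp (simple_refl i) 0 = 0" by (rule poly_mapping_eqI) simp
  then show ?thesis using swap_vars_single[of i 0 "int n"] by simp
qed

lemma swap_vars_1 [simp]: "swap_vars i 1 = 1"
  using swap_vars_of_nat[of i 1] by simp

lemma swap_vars_prod: "swap_vars i (\<Prod>a\<in>A. f a) = (\<Prod>a\<in>A. swap_vars i (f a))"
  by (induction A rule: infinite_finite_induct) (simp_all add: swap_vars_mult)

lemma swap_vars_swap_vars [simp]: "swap_vars i (swap_vars i f) = f"
  by (induction f rule: ipoly_induct) (simp_all add: swap_vars_single swap_vars_add)

lemma swap_vars_commute:
  assumes "Suc i < j"
  shows "swap_vars i (swap_vars j f) = swap_vars j (swap_vars i f)"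
proof -
  have "simple_refl i \<circ> simple_refl j = simple_refl j \<circ> simple_refl i"
    using simple_refl_commute[OF assms] by (simp add: fun_eq_iff)
  then show ?thesis by (simp only: perm_poly_comp bij_simple_refl)
qed

lemma swap_vars_braid:
  "swap_vars i (swap_vars (Suc i) (swap_vars i f))
   = swap_vars (Suc i) (swap_vars i (swap_vars (Suc i) f))"
proof -
  have "simple_refl i \<circ> (simple_refl (Suc i) \<circ> simple_refl i)
      = simple_refl (Suc i) \<circ> (simple_refl i \<circ> simple_refl (Suc i))"
    by (simp add: fun_eq_iff simple_refl_braid)
  then show ?thesis by (simp only: perm_poly_comp bij_simple_refl bij_comp)
qed

section \<open>Divided differences and the braid relations\<close>

definition ddiff :: "nat \<Rightarrow> ipoly \<Rightarrow> ipoly" where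
  "ddiff i f = (THE g. (var i - var (Suc i)) * g = f - swap_vars i f)"

definition update2 :: "nat \<Rightarrow> nat \<Rightarrow> nat \<Rightarrow> wcomp \<Rightarrow> wcomp" where
  "update2 i p q \<alpha> = update i p (update (Suc i) q \<alpha>)"

lemma lookup_update2:
  "lookup (update2 i p q \<alpha>) j
    = (if j = i then p else if j = Suc i then q else lookup \<alpha> j)"
  by (simp add: update2_def lookup_update)

lemma single_update2:
  "single (update2 i p q \<alpha>) c
    = single (update2 i 0 0 \<alpha>) c * (var i ^ p * var (Suc i) ^ q)"
proof -
  have "update2 i p q \<alpha>
      = update2 i 0 0 \<alpha> + (single i p + single (Suc i) q)"
    by (rule poly_mapping_eqI) (auto simp: lookup_add lookup_update2 lookup_single when_def)
  then show ?thesis by (simp add: var_power mon_def mult_single)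
qed

lemma update2_self: "update2 i (lookup \<alpha> i) (lookup \<alpha> (Suc i)) \<alpha> = \<alpha>"
  by (rule poly_mapping_eqI) (simp add: lookup_update2)

lemma update2_update2 [simp]: "update2 i p q (update2 i r s \<alpha>) = update2 i p q \<alpha>"
  by (rule poly_mapping_eqI) (simp add: lookup_update2)

lemma perm_comp_update2: "perm_comp (simple_refl i) (update2 i p q \<alpha>) = update2 i q p \<alpha>"
  by (rule poly_mapping_eqI) (auto simp: lookup_update2 simple_refl_eq)

lemma ddiff_dvd: "var i - var (Suc i) dvd f - swap_vars i f"
proof (induction f rule: ipoly_induct)
  case (single \<alpha> c)
  define a b where "a = lookup \<alpha> i" and "b = lookup \<alpha> (Suc i)"
  have \<alpha>: "\<alpha> = update2 i a b \<alpha>" by (simp add: a_def b_def update2_self)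
  have "single \<alpha> c - swap_vars i (single \<alpha> c)
     = single (update2 i a b \<alpha>) c - single (update2 i b a \<alpha>) c"
    by (subst (1 2) \<alpha>) (simp add: swap_vars_single perm_comp_update2)
  also have "\<dots> = single (update2 i 0 0 \<alpha>) c
      * (var i ^ a * var (Suc i) ^ b - var (Suc i) ^ a * var i ^ b)"
    unfolding single_update2[of i a b] single_update2[of i b a] by (simp add: algebra_simps)
  finally show ?case by (simp only: dvd_mult diff_dvd_powers)
next
  case (add f g)
  have "f + g - swap_vars i (f + g) = (f - swap_vars i f) + (g - swap_vars i g)"
    by (simp add: swap_vars_add)
  then show ?case using add by (simp only: dvd_add)
qed

lemma ddiffI:
  assumes "(var i - var (Suc i)) * g = f - swap_vars i f"
  shows "ddiff i f = g"
  unfolding ddiff_def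
proof (rule the_equality)
  fix h assume "(var i - var (Suc i)) * h = f - swap_vars i f"
  then show "h = g" using assms mult_left_cancel[OF var_diff_nonzero[of i]] by metis
qed (rule assms)

lemma ddiff_eq: "(var i - var (Suc i)) * ddiff i f = f - swap_vars i f"
  using ddiff_dvd[of i f] ddiffI by (metis dvdE)

lemma demazure_ddiff: "demazure i f = ddiff i (var i * f)"
  by (rule ddiffI[symmetric]) (simp add: demazure_eq swap_vars_mult swap_vars_var)

lemma ddiff_add: "ddiff i (f + g) = ddiff i f + ddiff i g"
  by (rule ddiffI) (simp add: distrib_left ddiff_eq swap_vars_add)

lemma ddiff_diff: "ddiff i (f - g) = ddiff i f - ddiff i g"
  by (rule ddiffI) (simp add: right_diff_distrib ddiff_eq swap_vars_diff)

lemma ddiff_0 [simp]: "ddiff i 0 = 0"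
  by (rule ddiffI) simp

lemma ddiff_sum: "ddiff i (\<Sum>a\<in>A. f a) = (\<Sum>a\<in>A. ddiff i (f a))"
  by (induction A rule: infinite_finite_induct) (simp_all add: ddiff_add)

lemma ddiff_sym_mult: "swap_vars i f = f \<Longrightarrow> ddiff i (f * g) = f * ddiff i g"
  by (rule ddiffI) (simp only: mult.left_commute[of _ f] ddiff_eq swap_vars_mult right_diff_distrib)

lemma ddiff_eq_0: "ddiff i f = 0 \<longleftrightarrow> swap_vars i f = f"
  using ddiff_eq[of i f] ddiffI[of i 0 f] by auto

lemma swap_vars_ddiff [simp]: "swap_vars i (ddiff i f) = ddiff i f"
proof -
  have "swap_vars i ((var i - var (Suc i)) * ddiff i f) = swap_vars i (f - swap_vars i f)"
    by (simp only: ddiff_eq)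
  then have "(var i - var (Suc i)) * swap_vars i (ddiff i f) = f - swap_vars i f"
    by (simp add: swap_vars_mult swap_vars_diff swap_vars_var algebra_simps)
  then have "(var i - var (Suc i)) * swap_vars i (ddiff i f) = (var i - var (Suc i)) * ddiff i f"
    by (simp only: ddiff_eq)
  then show ?thesis using mult_left_cancel[OF var_diff_nonzero[of i]] by blast
qed

lemma ddiff_ddiff [simp]: "ddiff i (ddiff i f) = 0"
  by (simp add: ddiff_eq_0)

lemma ddiff_var: "ddiff i (var i) = 1"
  by (rule ddiffI) (simp add: swap_vars_var)

lemma ddiff_var_mult: "ddiff i (var i * f) = f + var (Suc i) * ddiff i f"
proof (rule ddiffI)
  have "(var i - var (Suc i)) * (f + var (Suc i) * ddiff i f)
    = (var i - var (Suc i)) * f + var (Suc i) * ((var i - var (Suc i)) * ddiff i f)"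
    by (simp add: algebra_simps)
  then show "(var i - var (Suc i)) * (f + var (Suc i) * ddiff i f) = var i * f - swap_vars i (var i * f)"
    unfolding ddiff_eq by (simp add: swap_vars_mult swap_vars_var algebra_simps)
qed

lemma demazure_add: "demazure i (f + g) = demazure i f + demazure i g"
  by (simp add: demazure_ddiff distrib_left ddiff_add)

lemma demazure_diff: "demazure i (f - g) = demazure i f - demazure i g"
  by (simp add: demazure_ddiff right_diff_distrib ddiff_diff)

lemma demazure_0 [simp]: "demazure i 0 = 0"
  by (simp add: demazure_ddiff)

lemma demazure_sum: "demazure i (\<Sum>a\<in>A. f a) = (\<Sum>a\<in>A. demazure i (f a))"
  by (induction A rule: infinite_finite_induct) (simp_all add: demazure_add)

lemma demazure_sym_mult: "swap_vars i f = f \<Longrightarrow> demazure i (f * g) = f * demazure i g"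
  by (simp add: demazure_ddiff mult.left_commute[of _ f] ddiff_sym_mult)

lemma swap_vars_demazure [simp]: "swap_vars i (demazure i f) = demazure i f"
  by (simp add: demazure_ddiff)

lemma demazure_sym: "swap_vars i f = f \<Longrightarrow> demazure i f = f"
  using ddiff_sym_mult[of i f "var i"] by (simp add: demazure_ddiff mult.commute ddiff_var)

lemma demazure_demazure [simp]: "demazure i (demazure i f) = demazure i f"
  by (simp add: demazure_sym)

lemma ddiff_commute:
  assumes "Suc i < j"
  shows "ddiff i (ddiff j f) = ddiff j (ddiff i f)"
proof -
  have sym: "swap_vars j (var i - var (Suc i)) = var i - var (Suc i)"
     "swap_vars i (var j - var (Suc j)) = var j - var (Suc j)"
    using assms by (simp_all add: swap_vars_diff swap_vars_var simple_refl_other)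
  let ?a = "var i - var (Suc i)" and ?b = "var j - var (Suc j)"
  have "?b * (?a * ddiff i (ddiff j f)) = ?b * ddiff j f - swap_vars i (?b * ddiff j f)"
    by (simp only: ddiff_eq[of i] swap_vars_mult sym right_diff_distrib)
  also have "\<dots> = ?a * ddiff i f - swap_vars j (?a * ddiff i f)"
    by (simp add: ddiff_eq swap_vars_diff swap_vars_commute[OF assms])
  also have "\<dots> = ?a * (?b * ddiff j (ddiff i f))"
    by (simp only: ddiff_eq[of j] swap_vars_mult sym right_diff_distrib)
  finally have "(?a * ?b) * ddiff i (ddiff j f) = (?a * ?b) * ddiff j (ddiff i f)"
    by (simp add: algebra_simps)
  then show ?thesis using var_diff_nonzero mult_left_cancel by (metis no_zero_divisors)
qed

lemma var_inj: "var i = var j \<longleftrightarrow> i = j"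
proof
  assume "var i = var j"
  then have "lookup (var i) (single i 1)
    = lookup (var j) (single i 1)" by simp
  then have "single j (1::nat) = single i 1"
    by (auto simp: var_def mon_def lookup_single when_def split: if_splits)
  then show "i = j" by (metis lookup_single_eq lookup_single_not_eq one_neq_zero)
qed simp

text \<open>Clearing denominators turns both sides into the antisymmetrization of \<open>f\<close> over three variables.\<close>

lemma ddiff_braid: "ddiff i (ddiff (Suc i) (ddiff i f)) = ddiff (Suc i) (ddiff i (ddiff (Suc i) f))"
proof -
  let ?j = "Suc i"
  let ?s = "swap_vars i" and ?t = "swap_vars ?j"
  let ?x = "var i" and ?y = "var ?j" and ?z = "var (Suc ?j)"
  have sv: "?s ?x = ?y" "?s ?y = ?x" "?s ?z = ?z" "?t ?x = ?x" "?t ?y = ?z" "?t ?z = ?y"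
    by (simp_all add: swap_vars_var simple_refl_other)
  define h where "h = ddiff i f"
  have h: "(?x - ?y) * h = f - ?s f" "?s h = h" by (simp_all add: h_def ddiff_eq)
  have th: "(?x - ?z) * ?t h = ?t f - ?t (?s f)"
    using arg_cong[OF h(1), of ?t] by (simp add: swap_vars_mult swap_vars_diff sv)
  have sth: "(?y - ?z) * ?s (?t h) = ?s (?t f) - ?s (?t (?s f))"
    using arg_cong[OF th, of ?s] by (simp add: swap_vars_mult swap_vars_diff sv)
  have g: "(?y - ?z) * ddiff ?j h = h - ?t h" by (simp add: ddiff_eq)
  have sg: "(?x - ?z) * ?s (ddiff ?j h) = h - ?s (?t h)"
    using arg_cong[OF g, of ?s] by (simp add: swap_vars_mult swap_vars_diff sv h)
  have L0: "(?x - ?y) * ddiff i (ddiff ?j h) = ddiff ?j h - ?s (ddiff ?j h)" by (simp add: ddiff_eq)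
  have "((?x - ?y) * (?y - ?z) * (?x - ?z)) * ddiff i (ddiff ?j h)
      = (?x - ?z) * ((?y - ?z) * ddiff ?j h) - (?y - ?z) * ((?x - ?z) * ?s (ddiff ?j h))"
    using L0 by algebra
  also have "\<dots> = (?x - ?z) * (h - ?t h) - (?y - ?z) * (h - ?s (?t h))" by (simp only: g sg)
  also have "\<dots> = (?x - ?y) * h - (?x - ?z) * ?t h + (?y - ?z) * ?s (?t h)" by algebra
  finally have L: "((?x - ?y) * (?y - ?z) * (?x - ?z)) * ddiff i (ddiff ?j h)
      = f - ?s f - (?t f - ?t (?s f)) + (?s (?t f) - ?s (?t (?s f)))"
    by (simp only: h th sth)
  define k where "k = ddiff ?j f"
  have k: "(?y - ?z) * k = f - ?t f" "?t k = k" by (simp_all add: k_def ddiff_eq)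
  have sk: "(?x - ?z) * ?s k = ?s f - ?s (?t f)"
    using arg_cong[OF k(1), of ?s] by (simp add: swap_vars_mult swap_vars_diff sv)
  have tsk: "(?x - ?y) * ?t (?s k) = ?t (?s f) - ?t (?s (?t f))"
    using arg_cong[OF sk, of ?t] by (simp add: swap_vars_mult swap_vars_diff sv)
  have g': "(?x - ?y) * ddiff i k = k - ?s k" by (simp add: ddiff_eq)
  have tg: "(?x - ?z) * ?t (ddiff i k) = k - ?t (?s k)"
    using arg_cong[OF g', of ?t] by (simp add: swap_vars_mult swap_vars_diff sv k)
  have R0: "(?y - ?z) * ddiff ?j (ddiff i k) = ddiff i k - ?t (ddiff i k)" by (simp add: ddiff_eq)
  have "((?x - ?y) * (?y - ?z) * (?x - ?z)) * ddiff ?j (ddiff i k)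
      = (?x - ?z) * ((?x - ?y) * ddiff i k) - (?x - ?y) * ((?x - ?z) * ?t (ddiff i k))"
    using R0 by algebra
  also have "\<dots> = (?x - ?z) * (k - ?s k) - (?x - ?y) * (k - ?t (?s k))" by (simp only: g' tg)
  also have "\<dots> = (?y - ?z) * k - (?x - ?z) * ?s k + (?x - ?y) * ?t (?s k)" by algebra
  finally have R: "((?x - ?y) * (?y - ?z) * (?x - ?z)) * ddiff ?j (ddiff i k)
      = f - ?t f - (?s f - ?s (?t f)) + (?t (?s f) - ?t (?s (?t f)))"
    by (simp only: k sk tsk)
  have "((?x - ?y) * (?y - ?z) * (?x - ?z)) * ddiff i (ddiff ?j h)
      = ((?x - ?y) * (?y - ?z) * (?x - ?z)) * ddiff ?j (ddiff i k)"
    unfolding L R swap_vars_braid by simp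
  moreover have "(?x - ?y) * (?y - ?z) * (?x - ?z) \<noteq> 0" by (simp add: var_inj)
  ultimately have "ddiff i (ddiff ?j h) = ddiff ?j (ddiff i k)" using mult_left_cancel by blast
  then show ?thesis by (simp add: h_def k_def)
qed

lemma braid_family_ddiff: "braid_family ddiff"
  unfolding braid_family_def using ddiff_commute ddiff_braid by blast

text \<open>Factors symmetric under a reflection slide through its divided difference. So the triple
  product becomes a triple divided difference of one multiple of \<open>f\<close>, to which the
  braid relation of \<open>ddiff\<close> applies.\<close>

lemma braid_family_demazure: "braid_family demazure"
  unfolding braid_family_def
proof (intro conjI allI impI)
  fix i j f assume ij: "Suc i < j"
  have "swap_vars i (var j) = var j" "swap_vars j (var i) = var i"
    using ij by (simp_all add: swap_vars_var simple_refl_other)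
  then show "demazure i (demazure j f) = demazure j (demazure i f)"
    unfolding demazure_ddiff
    by (simp only: ddiff_sym_mult[symmetric] ddiff_commute[OF ij] mult.left_commute[of "var i"])
next
  fix i f
  let ?j = "Suc i"
  let ?x = "var i" and ?y = "var ?j"
  have sy: "swap_vars ?j ?x = ?x" "swap_vars i (?x * ?y) = ?x * ?y"
    by (simp_all add: swap_vars_var swap_vars_mult simple_refl_other mult.commute)
  have "demazure i (demazure ?j (demazure i f)) = ddiff i (ddiff ?j (?x * (?y * ddiff i (?x * f))))"
    by (simp add: demazure_ddiff ddiff_sym_mult[OF sy(1)])
  also have "\<dots> = ddiff i (ddiff ?j (ddiff i (?x * ?y * (?x * f))))"
    by (simp only: ddiff_sym_mult[OF sy(2)]) (simp only: mult.assoc)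
  finally have L: "demazure i (demazure ?j (demazure i f)) = ddiff ?j (ddiff i (ddiff ?j (?x * ?y * (?x * f))))"
    by (simp only: ddiff_braid)
  define g where "g = ddiff ?j (?x * ?y * f)"
  have "ddiff ?j (?x * ?y * (?x * f)) = ?x * g"
    unfolding g_def ddiff_sym_mult[OF sy(1), symmetric] by (simp only: mult_ac)
  \<comment> \<open>By the Leibniz rule; the summand \<open>g\<close> is a value of
    \<open>ddiff (Suc i)\<close> and dies under the outer operator.\<close>
  then have "ddiff ?j (ddiff i (ddiff ?j (?x * ?y * (?x * f)))) = ddiff ?j (g + ?y * ddiff i g)"
    by (simp add: ddiff_var_mult)
  also have "\<dots> = ddiff ?j (?y * ddiff i g)" by (simp add: ddiff_add g_def)
  also have "\<dots> = demazure ?j (demazure i (demazure ?j f))"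
    unfolding demazure_ddiff g_def ddiff_sym_mult[OF sy(1), symmetric] by (simp only: mult.assoc)
  finally show "demazure i (demazure ?j (demazure i f)) = demazure ?j (demazure i (demazure ?j f))"
    using L by simp
qed

text \<open>After expansion and idempotence, all terms besides the triple product are symmetric in
  the two indices.\<close>

lemma braid_family_demazure_bar: "braid_family demazure_bar"
  unfolding braid_family_def
proof (intro conjI allI impI)
  fix i j f assume "Suc i < j"
  then have "demazure i (demazure j f) = demazure j (demazure i f)"
    using braid_family_demazure unfolding braid_family_def by blast
  then show "demazure_bar i (demazure_bar j f) = demazure_bar j (demazure_bar i f)"
    unfolding demazure_bar_def demazure_diff by simp
next
  fix i f
  have "demazure i (demazure (Suc i) (demazure i f)) = demazure (Suc i) (demazure i (demazure (Suc i) f))"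
    using braid_family_demazure unfolding braid_family_def by blast
  then show "demazure_bar i (demazure_bar (Suc i) (demazure_bar i f))
    = demazure_bar (Suc i) (demazure_bar i (demazure_bar (Suc i) f))"
    by (simp add: demazure_bar_def demazure_diff)
qed

lemma demazure_perm_op_perm: "demazure_perm = op_perm demazure"
  and demazure_bar_perm_op_perm: "demazure_bar_perm = op_perm demazure_bar"
  by (simp_all add: fun_eq_iff demazure_perm_def demazure_bar_perm_def op_perm_def)

section \<open>Explicit formulas on monomials\<close>

lemma ddiff_single:
  fixes \<alpha> :: wcomp and i :: nat
  defines "a \<equiv> lookup \<alpha> i" and "b \<equiv> lookup \<alpha> (Suc i)"
  shows "b \<le> a \<Longrightarrow> ddiff i (single \<alpha> c)
      = (\<Sum>t<a - b. single (update2 i (b + t) (a - Suc t) \<alpha>) c)"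
proof -
  let ?x = "var i" and ?y = "var (Suc i)" and ?\<gamma> = "single (update2 i 0 0 \<alpha>) c"
  have sw: "single \<alpha> c = ?\<gamma> * (?x ^ a * ?y ^ b)"
      "swap_vars i (single \<alpha> c) = ?\<gamma> * (?x ^ b * ?y ^ a)"
  proof -
    have \<alpha>: "update2 i a b \<alpha> = \<alpha>" by (simp add: a_def b_def update2_self)
    show "single \<alpha> c = ?\<gamma> * (?x ^ a * ?y ^ b)"
      using single_update2[of i a b \<alpha> c] unfolding \<alpha> .
    show "swap_vars i (single \<alpha> c) = ?\<gamma> * (?x ^ b * ?y ^ a)"
      using single_update2[of i b a \<alpha> c] perm_comp_update2[of i a b \<alpha>]
      unfolding \<alpha> swap_vars_single by simp
  qed
  show "ddiff i (single \<alpha> c)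
      = (\<Sum>t<a - b. single (update2 i (b + t) (a - Suc t) \<alpha>) c)" if "b \<le> a"
  proof (rule ddiffI)
    have "(\<Sum>t<a - b. single (update2 i (b + t) (a - Suc t) \<alpha>) c)
      = (\<Sum>t<a - b. (?\<gamma> * ?x ^ b * ?y ^ b) * (?y ^ (a - b - Suc t) * ?x ^ t))"
    proof (rule sum.cong)
      fix t assume "t \<in> {..<a - b}"
      then have "a - Suc t = b + (a - b - Suc t)" by auto
      then show "single (update2 i (b + t) (a - Suc t) \<alpha>) c
          = (?\<gamma> * ?x ^ b * ?y ^ b) * (?y ^ (a - b - Suc t) * ?x ^ t)"
        by (subst single_update2) (simp add: power_add mult_ac)
    qed simp
    also have "\<dots> = (?\<gamma> * ?x ^ b * ?y ^ b) * (\<Sum>t<a - b. ?y ^ (a - b - Suc t) * ?x ^ t)"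
      by (simp only: sum_distrib_left)
    finally have "(?x - ?y) * (\<Sum>t<a - b. single (update2 i (b + t) (a - Suc t) \<alpha>) c)
       = (?\<gamma> * ?x ^ b * ?y ^ b) * (?x ^ (a - b) - ?y ^ (a - b))"
      unfolding power_diff_sumr2 by (simp only: mult_ac)
    also have "\<dots> = ?\<gamma> * (?x ^ (b + (a - b)) * ?y ^ b) - ?\<gamma> * (?x ^ b * ?y ^ (b + (a - b)))"
      by (simp add: power_add algebra_simps)
    finally show "(?x - ?y) * (\<Sum>t<a - b. single (update2 i (b + t) (a - Suc t) \<alpha>) c)
        = single \<alpha> c - swap_vars i (single \<alpha> c)"
      unfolding sw(2) unfolding sw(1) using that by simp
  qed
qed

lemma ddiff_swap_vars: "ddiff i (swap_vars i f) = - ddiff i f"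
  by (rule ddiffI) (simp only: mult_minus_right ddiff_eq swap_vars_swap_vars minus_diff_eq)

lemma ddiff_single_neg:
  fixes \<alpha> :: wcomp and i :: nat
  defines "a \<equiv> lookup \<alpha> i" and "b \<equiv> lookup \<alpha> (Suc i)"
  assumes "a \<le> b"
  shows "ddiff i (single \<alpha> c)
    = - (\<Sum>t<b - a. single (update2 i (a + t) (b - Suc t) \<alpha>) c)"
proof -
  have "perm_comp (simple_refl i) (update2 i b a \<alpha>) = \<alpha>"
    by (simp add: perm_comp_update2 a_def b_def update2_self)
  then have "ddiff i (single \<alpha> c) = - ddiff i (single (update2 i b a \<alpha>) c)"
    using ddiff_swap_vars[of i "single (update2 i b a \<alpha>) c"] by (simp only: swap_vars_single)
  then show ?thesis
    using ddiff_single[of "update2 i b a \<alpha>" i c] assms(3) by (simp add: lookup_update2)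
qed

lemma var_mult_single:
  "var i * single \<alpha> c = single (single i 1 + \<alpha>) c"
  by (simp add: var_def mon_def mult_single)

text \<open>The two ranges overlap at \<open>b = Suc a\<close>, where both sums are empty: the
  operator kills such a monomial. This vanishing drives the multiplication by
  \<open>vars {..<k}\<close>.\<close>

lemma demazure_single:
  fixes \<alpha> :: wcomp and i :: nat
  defines "a \<equiv> lookup \<alpha> i" and "b \<equiv> lookup \<alpha> (Suc i)"
  shows "b \<le> Suc a \<Longrightarrow> demazure i (single \<alpha> c)
      = (\<Sum>t<Suc a - b. single (update2 i (b + t) (a - t) \<alpha>) c)"
    and "Suc a \<le> b \<Longrightarrow> demazure i (single \<alpha> c)
      = - (\<Sum>t<b - Suc a. single (update2 i (Suc a + t) (b - Suc t) \<alpha>) c)"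
proof -
  let ?\<beta> = "single i 1 + \<alpha>"
  have l: "lookup ?\<beta> i = Suc a" "lookup ?\<beta> (Suc i) = b"
    by (simp_all add: a_def b_def lookup_add lookup_single)
  have u: "update2 i p q ?\<beta> = update2 i p q \<alpha>" for p q
    by (rule poly_mapping_eqI) (auto simp: lookup_update2 lookup_add lookup_single when_def)
  show "b \<le> Suc a \<Longrightarrow> demazure i (single \<alpha> c)
      = (\<Sum>t<Suc a - b. single (update2 i (b + t) (a - t) \<alpha>) c)"
    using ddiff_single[of ?\<beta> i c] by (simp only: demazure_ddiff var_mult_single l u diff_Suc_Suc)
  show "Suc a \<le> b \<Longrightarrow> demazure i (single \<alpha> c)
      = - (\<Sum>t<b - Suc a. single (update2 i (Suc a + t) (b - Suc t) \<alpha>) c)"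
    using ddiff_single_neg[of ?\<beta> i c] by (simp only: demazure_ddiff var_mult_single l u)
qed

lemma keys_sumE:
  assumes "b \<in> keys (\<Sum>a\<in>A. f a)"
  obtains a where "a \<in> A" "b \<in> keys (f a)"
  using assms keys_sum[of f A] by blast

text \<open>The two conclusions on \<open>p\<close> and \<open>q\<close> serve different ends: the
  drop of the sum by one gives homogeneity, the strict drop of the maximum gives the staircase
  bound.\<close>

lemma keys_ddiff:
  assumes "\<beta> \<in> keys (ddiff i f)"
  obtains \<alpha> p q where "\<alpha> \<in> keys f" "\<beta> = update2 i p q \<alpha>"
    "Suc (p + q) = lookup \<alpha> i + lookup \<alpha> (Suc i)"
    "max p q < max (lookup \<alpha> i) (lookup \<alpha> (Suc i))"
proof -
  have eq: "ddiff i f = (\<Sum>\<alpha>\<in>keys f. ddiff i (single \<alpha> (lookup f \<alpha>)))"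
    using arg_cong[OF ipoly_sum_keys[of f], of "ddiff i"] unfolding ddiff_sum .
  obtain \<alpha> where \<alpha>: "\<alpha> \<in> keys f"
    "\<beta> \<in> keys (ddiff i (single \<alpha> (lookup f \<alpha>)))"
    by (rule keys_sumE[OF assms[unfolded eq]])
  define a b where "a = lookup \<alpha> i" and "b = lookup \<alpha> (Suc i)"
  define c where "c = lookup f \<alpha>"
  show thesis
  proof (cases "b \<le> a")
    case True
    then have "\<beta> \<in> keys (\<Sum>t<a - b. single (update2 i (b + t) (a - Suc t) \<alpha>) c)"
      using \<alpha>(2) ddiff_single[of \<alpha> i c] by (simp only: a_def b_def c_def)
    then obtain t where t: "t \<in> {..<a - b}"
      "\<beta> \<in> keys (single (update2 i (b + t) (a - Suc t) \<alpha>) c)"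
      by (rule keys_sumE)
    then have "\<beta> = update2 i (b + t) (a - Suc t) \<alpha>" by (simp split: if_splits)
    then show thesis
      by (rule that[OF \<alpha>(1)]) (use t(1) in \<open>simp_all flip: a_def b_def\<close>)
  next
    case False
    then have "\<beta> \<in> keys (\<Sum>t<b - a. single (update2 i (a + t) (b - Suc t) \<alpha>) c)"
      using \<alpha>(2) ddiff_single_neg[of \<alpha> i c] by (simp add: a_def b_def c_def)
    then obtain t where t: "t \<in> {..<b - a}"
      "\<beta> \<in> keys (single (update2 i (a + t) (b - Suc t) \<alpha>) c)"
      by (rule keys_sumE)
    then have "\<beta> = update2 i (a + t) (b - Suc t) \<alpha>" by (simp split: if_splits)
    then show thesis
      by (rule that[OF \<alpha>(1)]) (use t(1) in \<open>simp_all flip: a_def b_def\<close>)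
  qed
qed

section \<open>Key and atom polynomials\<close>

lemma is_partition_Suc:
  "is_partition \<mu> \<longleftrightarrow> (\<forall>i. lookup \<mu> (Suc i) \<le> lookup \<mu> i)"
proof
  assume "\<forall>i. lookup \<mu> (Suc i) \<le> lookup \<mu> i"
  then show "is_partition \<mu>" unfolding is_partition_def using lift_Suc_antimono_le by blast
qed (auto simp: is_partition_def)

lemma partition_less: "is_partition \<mu> \<Longrightarrow> lookup \<mu> i < lookup \<mu> j \<Longrightarrow> j < i"
  unfolding is_partition_def by (metis not_le)

lemma sum_keys_superset:
  fixes h :: "nat \<Rightarrow> nat \<Rightarrow> nat"
  assumes "finite A" "keys \<alpha> \<subseteq> A" "\<And>i. h i 0 = 0"
  shows "(\<Sum>i\<in>keys \<alpha>. h i (lookup \<alpha> i)) = (\<Sum>i\<in>A. h i (lookup \<alpha> i))"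
  using assms by (intro sum.mono_neutral_left) (auto simp: in_keys_iff)

text \<open>\<open>R\<close> is the share of all other positions. It is uniform in \<open>p\<close>
  and \<open>q\<close>, so that different updates of \<alpha> can be compared; the sorting measure,
  the squared norm and the degree are instances.\<close>

lemma sum_keys_split:
  fixes h :: "nat \<Rightarrow> nat \<Rightarrow> nat" and i :: nat and \<alpha> :: wcomp
  assumes "\<And>j. h j 0 = 0"
  obtains R where
    "\<And>p q. (\<Sum>j\<in>keys (update2 i p q \<alpha>). h j (lookup (update2 i p q \<alpha>) j))
        = h i p + h (Suc i) q + R"
proof -
  let ?A = "insert i (insert (Suc i) (keys \<alpha>))"
  let ?R = "\<Sum>j\<in>?A - {i, Suc i}. h j (lookup \<alpha> j)"
  have "(\<Sum>j\<in>keys (update2 i p q \<alpha>). h j (lookup (update2 i p q \<alpha>) j))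
      = h i p + h (Suc i) q + ?R" for p q
  proof -
    have "(\<Sum>j\<in>keys (update2 i p q \<alpha>). h j (lookup (update2 i p q \<alpha>) j))
       = (\<Sum>j\<in>?A. h j (lookup (update2 i p q \<alpha>) j))"
      using assms by (intro sum_keys_superset) (auto simp: in_keys_iff lookup_update2 split: if_splits)
    also have "\<dots> = (\<Sum>j\<in>{i, Suc i}. h j (lookup (update2 i p q \<alpha>) j))
        + (\<Sum>j\<in>?A - {i, Suc i}. h j (lookup (update2 i p q \<alpha>) j))"
      by (subst add.commute, rule sum.subset_diff) auto
    also have "(\<Sum>j\<in>?A - {i, Suc i}. h j (lookup (update2 i p q \<alpha>) j)) = ?R"
      by (intro sum.cong) (auto simp: lookup_update2)
    finally show ?thesis by (simp add: lookup_update2)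
  qed
  then show thesis by (rule that)
qed

text \<open>Bubble sort again: exchanging a strict ascent moves the larger part to the left, which
  lowers the sum of position times part.\<close>

lemma exists_sort:
  "\<exists>\<mu>. is_partition \<mu> \<and> (\<exists>w\<in>S_inf. \<alpha> = perm_comp w \<mu>)"
proof (induction "\<Sum>i\<in>keys \<alpha>. i * lookup \<alpha> i" arbitrary: \<alpha> rule: less_induct)
  case less
  show ?case
  proof (cases "is_partition \<alpha>")
    case True
    then show ?thesis using perm_comp_id id_S_inf by metis
  next
    case False
    then obtain i where i: "lookup \<alpha> i < lookup \<alpha> (Suc i)"
      by (auto simp: is_partition_Suc not_le)
    let ?a = "lookup \<alpha> i" and ?b = "lookup \<alpha> (Suc i)"
    have eq: "update2 i ?a ?b \<alpha> = \<alpha>" "update2 i ?b ?a \<alpha> = perm_comp (simple_refl i) \<alpha>"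
      using perm_comp_update2[of i ?a ?b \<alpha>] by (simp_all add: update2_self)
    obtain R where R: "\<And>p q. (\<Sum>j\<in>keys (update2 i p q \<alpha>). j * lookup (update2 i p q \<alpha>) j)
        = i * p + Suc i * q + R"
      using sum_keys_split[where h = "\<lambda>j k. j * k" and i = i and \<alpha> = \<alpha>] by auto
    have "i * ?b + Suc i * ?a + R < i * ?a + Suc i * ?b + R" using i by simp
    then obtain \<mu> w where "is_partition \<mu>" and w: "w \<in> S_inf" "perm_comp (simple_refl i) \<alpha> = perm_comp w \<mu>"
      using less.hyps[of "perm_comp (simple_refl i) \<alpha>"] R[of ?a ?b] R[of ?b ?a] unfolding eq by auto
    moreover have "\<alpha> = perm_comp (simple_refl i \<circ> w) \<mu>"
      using w by (metis S_inf_bij bij_simple_refl perm_comp_comp swap_comp_swap_comp)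
    ultimately show ?thesis using S_inf_left by blast
  qed
qed

text \<open>Isolates the minimality behind \<open>sort_perm\<close> as a relation, so that letters
  can be stripped from \<open>u\<close> and from \<alpha> while \<mu> stays fixed.\<close>

definition min_sort :: "(nat \<Rightarrow> nat) \<Rightarrow> wcomp \<Rightarrow> wcomp \<Rightarrow> bool" where
  "min_sort u \<mu> \<alpha> \<longleftrightarrow> u \<in> S_inf \<and> \<alpha> = perm_comp u \<mu> \<and>
     (\<forall>v\<in>S_inf. \<alpha> = perm_comp v \<mu> \<longrightarrow> perm_length u \<le> perm_length v)"

lemma lookup_S_inf: "u \<in> S_inf \<Longrightarrow> lookup (perm_comp u \<mu>) i = lookup \<mu> (inv u i)"
  by (simp add: lookup_perm_comp S_inf_bij)

lemma perm_comp_left: "u \<in> S_inf \<Longrightarrow> perm_comp (simple_refl i \<circ> u) \<mu> = perm_comp (simple_refl i) (perm_comp u \<mu>)"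
  by (simp only: perm_comp_comp S_inf_bij bij_simple_refl)

lemma perm_comp_left_eq:
  "u \<in> S_inf \<Longrightarrow> perm_comp (simple_refl i) \<alpha> = perm_comp u \<mu> \<Longrightarrow> \<alpha> = perm_comp (simple_refl i \<circ> u) \<mu>"
  by (metis perm_comp_left swap_comp_swap_comp)

lemma swap_comp_eq:
  "lookup \<alpha> i = lookup \<alpha> (Suc i) \<Longrightarrow> perm_comp (simple_refl i) \<alpha> = \<alpha>"
  by (rule poly_mapping_eqI) (simp add: simple_refl_eq)

text \<open>A competitor for the reflected composition has a left descent at \<open>i\<close>, since
  the parts strictly increase there; stripping it gives a competitor for \<alpha>, so the minimum
  rises by exactly one.\<close>

lemma min_sort_up:
  assumes "is_partition \<mu>" "min_sort u \<mu> \<alpha>" "lookup \<alpha> (Suc i) < lookup \<alpha> i"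
  shows "inv u i < inv u (Suc i)" "min_sort (simple_refl i \<circ> u) \<mu> (perm_comp (simple_refl i) \<alpha>)"
proof -
  have u: "u \<in> S_inf" "\<alpha> = perm_comp u \<mu>" using assms(2) by (auto simp: min_sort_def)
  show asc: "inv u i < inv u (Suc i)"
    using assms(3) partition_less[OF assms(1)] by (simp add: u(2) lookup_S_inf u(1))
  show "min_sort (simple_refl i \<circ> u) \<mu> (perm_comp (simple_refl i) \<alpha>)"
    unfolding min_sort_def
  proof (intro conjI ballI impI)
    fix v assume v: "v \<in> S_inf" "perm_comp (simple_refl i) \<alpha> = perm_comp v \<mu>"
    have "lookup (perm_comp v \<mu>) i < lookup (perm_comp v \<mu>) (Suc i)"
      using assms(3) by (simp flip: v(2))
    then have "inv v (Suc i) < inv v i" using partition_less[OF assms(1)] by (simp add: lookup_S_inf v(1))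
    moreover have "perm_length u \<le> perm_length (simple_refl i \<circ> v)"
      using assms(2) v perm_comp_left_eq S_inf_left by (auto simp: min_sort_def)
    ultimately show "perm_length (simple_refl i \<circ> u) \<le> perm_length v"
      using perm_length_left(2)[OF v(1)] perm_length_left(1)[OF u(1) asc] by simp
  qed (use u perm_comp_left in auto)
qed

lemma min_sort_down:
  assumes "is_partition \<mu>" "min_sort u \<mu> \<alpha>" "inv u (Suc i) < inv u i"
  shows "lookup \<alpha> i < lookup \<alpha> (Suc i)"
    "min_sort (simple_refl i \<circ> u) \<mu> (perm_comp (simple_refl i) \<alpha>)"
proof -
  have u: "u \<in> S_inf" "\<alpha> = perm_comp u \<mu>" using assms(2) by (auto simp: min_sort_def)
  \<comment> \<open>With equal parts the reflection fixes \<alpha>, and stripping the descent would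
    give a shorter sorting permutation.\<close>
  have "lookup \<alpha> i \<noteq> lookup \<alpha> (Suc i)"
  proof
    assume "lookup \<alpha> i = lookup \<alpha> (Suc i)"
    then have "\<alpha> = perm_comp (simple_refl i \<circ> u) \<mu>"
      using u swap_comp_eq perm_comp_left by metis
    then have "perm_length u \<le> perm_length (simple_refl i \<circ> u)"
      using assms(2) S_inf_left[OF u(1)] unfolding min_sort_def by blast
    then show False using perm_length_left(2)[OF u(1) assms(3)] by simp
  qed
  moreover have "lookup \<alpha> i \<le> lookup \<alpha> (Suc i)"
    using assms(1,3) u by (simp add: lookup_S_inf is_partition_def)
  ultimately show lt: "lookup \<alpha> i < lookup \<alpha> (Suc i)" by simp
  show "min_sort (simple_refl i \<circ> u) \<mu> (perm_comp (simple_refl i) \<alpha>)"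
    unfolding min_sort_def
  proof (intro conjI ballI impI)
    fix v assume v: "v \<in> S_inf" "perm_comp (simple_refl i) \<alpha> = perm_comp v \<mu>"
    have "lookup (perm_comp v \<mu>) (Suc i) < lookup (perm_comp v \<mu>) i"
      using lt by (simp flip: v(2))
    then have "inv v i < inv v (Suc i)" using partition_less[OF assms(1)] by (simp add: lookup_S_inf v(1))
    moreover have "perm_length u \<le> perm_length (simple_refl i \<circ> v)"
      using assms(2) v perm_comp_left_eq S_inf_left by (auto simp: min_sort_def)
    ultimately show "perm_length (simple_refl i \<circ> u) \<le> perm_length v"
      using perm_length_left(1)[OF v(1)] perm_length_left(2)[OF u(1) assms(3)] by simp
  qed (use u perm_comp_left in auto)
qed

lemma exists_left_descent:
  assumes "u \<in> S_inf" "perm_length u \<noteq> 0"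
  obtains i where "inv u (Suc i) < inv u i"
proof -
  obtain "is" where "is": "reduced_word u is" using assms reduced_word_exists by blast
  then have "is \<noteq> []" using assms(2) by (auto simp: reduced_word_def)
  then show thesis using "is" reduced_word_ConsD(1) that by (cases "is") blast+
qed

text \<open>The left descents of a minimal permutation are the strict ascents of \<alpha>, so
  \<open>u\<close> and \<open>v\<close> share them and can be stripped together.\<close>

lemma min_sort_unique:
  assumes "is_partition \<mu>" "min_sort u \<mu> \<alpha>" "min_sort v \<mu> \<alpha>"
  shows "u = v"
  using assms(2,3)
proof (induction "perm_length u" arbitrary: u v \<alpha> rule: less_induct)
  case less
  have u: "u \<in> S_inf" "\<alpha> = perm_comp u \<mu>" and v: "v \<in> S_inf" "\<alpha> = perm_comp v \<mu>"
    and len: "perm_length u = perm_length v"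
    using less.prems by (auto simp: min_sort_def intro: antisym)
  show ?case
  proof (cases "perm_length u = 0")
    case True
    then show ?thesis using perm_length_0[OF u(1)] perm_length_0[OF v(1)] len by metis
  next
    case False
    then obtain i where i: "inv u (Suc i) < inv u i" using exists_left_descent u(1) by blast
    note d = min_sort_down[OF assms(1) less.prems(1) i]
    have "inv v (Suc i) < inv v i"
      using d(1) partition_less[OF assms(1)] by (simp add: v(2) lookup_S_inf v(1))
    note e = min_sort_down[OF assms(1) less.prems(2) this]
    have "simple_refl i \<circ> u = simple_refl i \<circ> v"
      using less.hyps[OF _ d(2) e(2)] perm_length_left(2)[OF u(1) i] by simp
    then show ?thesis by (metis simple_refl_comp_cancel(1))
  qed
qed

lemma exists_min_sort:
  assumes "w \<in> S_inf" "\<alpha> = perm_comp w \<mu>"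
  shows "min_sort (ARG_MIN perm_length w. w \<in> S_inf \<and> \<alpha> = perm_comp w \<mu>) \<mu> \<alpha>"
  using arg_min_nat_lemma[of "\<lambda>w. w \<in> S_inf \<and> \<alpha> = perm_comp w \<mu>" w perm_length] assms
  by (simp add: min_sort_def)

text \<open>A minimal permutation other than the identity has a left descent, which would be a
  strict ascent of \<nu>. Hence two partitions in one orbit coincide.\<close>

lemma min_sort_partition:
  assumes "is_partition \<mu>" "is_partition \<nu>" "min_sort u \<mu> \<nu>"
  shows "u = id" "\<nu> = \<mu>"
proof -
  have u: "u \<in> S_inf" "\<nu> = perm_comp u \<mu>" using assms(3) by (auto simp: min_sort_def)
  have "perm_length u = 0"
  proof (rule ccontr)
    assume "perm_length u \<noteq> 0"
    then obtain i where "inv u (Suc i) < inv u i" using exists_left_descent u(1) by blast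
    then show False using min_sort_down(1)[OF assms(1,3)] assms(2) by (metis is_partition_Suc not_le)
  qed
  then show "u = id" using perm_length_0 u by blast
  then show "\<nu> = \<mu>" using u by simp
qed

lemma sort_comp_eq:
  assumes "is_partition \<mu>" "w \<in> S_inf"
  shows "sort_comp (perm_comp w \<mu>) = \<mu>"
  unfolding sort_comp_def
proof (rule the_equality)
  fix \<nu> assume "is_partition \<nu> \<and> (\<exists>v\<in>S_inf. perm_comp w \<mu> = perm_comp v \<nu>)"
  then obtain v where \<nu>: "is_partition \<nu>" "v \<in> S_inf" "perm_comp w \<mu> = perm_comp v \<nu>" by blast
  have "perm_comp (inv v \<circ> w) \<mu> = \<nu>"
    by (metis S_inf_bij S_inf_inv assms(2) \<nu>(2,3) perm_comp_comp perm_comp_inverse(1))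
  moreover obtain a b where "inv v = word_perm a" "w = word_perm b"
    using assms(2) S_inf_inv[OF \<nu>(2)] by (auto simp: S_inf_def)
  then have "inv v \<circ> w \<in> S_inf" by (metis word_perm_append word_perm_S_inf)
  ultimately show "\<nu> = \<mu>"
    using exists_min_sort[of "inv v \<circ> w" \<nu> \<mu>] min_sort_partition(2)[OF assms(1) \<nu>(1)] by metis
qed (use assms in blast)

lemma min_sort_sort_perm:
  shows "is_partition (sort_comp \<alpha>)" "min_sort (sort_perm \<alpha>) (sort_comp \<alpha>) \<alpha>"
proof -
  obtain \<mu> w where *: "is_partition \<mu>" "w \<in> S_inf" "\<alpha> = perm_comp w \<mu>" using exists_sort by blast
  then have "sort_comp \<alpha> = \<mu>" using sort_comp_eq by simp
  then show "is_partition (sort_comp \<alpha>)" "min_sort (sort_perm \<alpha>) (sort_comp \<alpha>) \<alpha>"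
    using * exists_min_sort[of w \<alpha> \<mu>] by (simp_all add: sort_perm_def)
qed

definition sorted_op :: "(nat \<Rightarrow> ipoly \<Rightarrow> ipoly) \<Rightarrow> wcomp \<Rightarrow> ipoly" where
  "sorted_op f \<alpha> = op_perm f (sort_perm \<alpha>) (mon (sort_comp \<alpha>))"

lemma key_poly_sorted_op: "key_poly = sorted_op demazure"
  and atom_poly_sorted_op: "atom_poly = sorted_op demazure_bar"
  by (simp_all add: fun_eq_iff key_poly_def atom_poly_def sorted_op_def
      demazure_perm_op_perm demazure_bar_perm_op_perm)

lemma sorted_op_eq:
  assumes "is_partition \<mu>" "min_sort u \<mu> \<alpha>"
  shows "sorted_op f \<alpha> = op_perm f u (mon \<mu>)"
proof -
  have "sort_comp \<alpha> = \<mu>" using assms sort_comp_eq by (auto simp: min_sort_def)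
  then show ?thesis
    using min_sort_unique[OF assms] min_sort_sort_perm(2)[of \<alpha>] by (auto simp: sorted_op_def)
qed

lemma sorted_op_partition: "is_partition \<mu> \<Longrightarrow> sorted_op f \<mu> = mon \<mu>"
  using sorted_op_eq[of \<mu> id \<mu> f] by (simp add: min_sort_def)

lemma sorted_op_step:
  assumes "braid_family f" "lookup \<alpha> (Suc i) < lookup \<alpha> i"
  shows "f i (sorted_op f \<alpha>) = sorted_op f (perm_comp (simple_refl i) \<alpha>)"
proof -
  note m = min_sort_sort_perm[of \<alpha>]
  note up = min_sort_up[OF m assms(2)]
  have "sort_perm \<alpha> \<in> S_inf" using m(2) by (simp add: min_sort_def)
  then show ?thesis
    using sorted_op_eq[OF m(1) up(2)] op_perm_left[OF assms(1) _ up(1)] by (simp add: sorted_op_def)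
qed

text \<open>When \<open>\<alpha>\<close> has two equal adjacent parts, the simple reflection passes through the minimal sorting permutation.\<close>

lemma sorted_op_equal_parts:
  assumes "braid_family f" "lookup \<alpha> (Suc i) = lookup \<alpha> i"
  obtains p where "lookup (sort_comp \<alpha>) (Suc p) = lookup (sort_comp \<alpha>) p"
    "f i (sorted_op f \<alpha>) = op_perm f (sort_perm \<alpha>) (f p (mon (sort_comp \<alpha>)))"
proof -
  define u \<mu> where "u = sort_perm \<alpha>" and "\<mu> = sort_comp \<alpha>"
  have \<mu>: "is_partition \<mu>" and m: "min_sort u \<mu> \<alpha>" by (simp_all add: u_def \<mu>_def min_sort_sort_perm)
  then have u: "u \<in> S_inf" "\<alpha> = perm_comp u \<mu>" by (auto simp: min_sort_def)
  have bij: "bij u" using u S_inf_bij by blast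
  define p q where "p = inv u i" and "q = inv u (Suc i)"
  have up: "u p = i" "u q = Suc i" using bij by (simp_all add: p_def q_def bij_is_surj surj_f_inv_f)
  have eq: "lookup \<mu> p = lookup \<mu> q"
    using assms(2) u by (simp add: lookup_S_inf p_def q_def)
  have "p \<noteq> q" using up by auto
  moreover have "\<not> q < p" using min_sort_down(1)[OF \<mu> m, of i] assms(2) by (auto simp: p_def q_def)
  ultimately have pq: "p < q" by simp
  \<comment> \<open>Among equal parts a minimal permutation keeps the order: an inversion there
    could be removed without changing \<alpha>.\<close>
  have incr: "u j < u (Suc j)" if "lookup \<mu> (Suc j) = lookup \<mu> j" for j
  proof (rule ccontr)
    assume "\<not> u j < u (Suc j)"
    then have less: "u (Suc j) < u j" using bij by (metis bij_step_cases)
    have "perm_comp (u \<circ> simple_refl j) \<mu> = perm_comp u (perm_comp (simple_refl j) \<mu>)"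
      by (simp only: perm_comp_comp bij bij_simple_refl)
    then have "\<alpha> = perm_comp (u \<circ> simple_refl j) \<mu>" using swap_comp_eq that u by simp
    then have "perm_length u \<le> perm_length (u \<circ> simple_refl j)"
      using m u S_inf_right unfolding min_sort_def by blast
    then show False using perm_length_right(2)[OF u(1) less] by simp
  qed
  have block: "lookup \<mu> (Suc j) = lookup \<mu> j" if "p \<le> j" "j < q" for j
    using that \<mu> eq unfolding is_partition_def by (metis Suc_leI antisym le_SucI order_refl)
  \<comment> \<open>The positions from \<open>p\<close> to \<open>q\<close> carry equal parts, so
    \<open>u\<close> rises by at least one at each step; the total rise from \<open>i\<close> to
    \<open>Suc i\<close> is one, hence \<open>q = Suc p\<close>.\<close>
  have "p + d \<le> q \<Longrightarrow> u p + d \<le> u (p + d)" for d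
  proof (induction d)
    case (Suc d)
    then have "u (p + d) < u (Suc (p + d))" using incr block by simp
    then show ?case using Suc by simp
  qed simp
  from this[of "q - p"] have q: "q = Suc p" using pq up by simp
  have conj: "simple_refl i \<circ> u = u \<circ> simple_refl p"
  proof
    fix x
    show "(simple_refl i \<circ> u) x = (u \<circ> simple_refl p) x"
    proof (cases "x = p \<or> x = q")
      case False
      then have "u x \<noteq> i" "u x \<noteq> Suc i" using up bij by (metis bij_pointE)+
      then show ?thesis using False q by (simp add: simple_refl_other)
    qed (use up q in auto)
  qed
  have "f i (op_perm f u (mon \<mu>)) = op_perm f (simple_refl i \<circ> u) (mon \<mu>)"
    using op_perm_left[OF assms(1) u(1), of i] pq by (simp add: p_def q_def)
  also have "\<dots> = op_perm f u (f p (mon \<mu>))"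
    unfolding conj using op_perm_right[OF assms(1) u(1), of p] up q by simp
  finally show thesis using that[of p] eq q by (simp add: sorted_op_def u_def \<mu>_def)
qed

lemma demazure_mon_equal:
  assumes "lookup \<alpha> (Suc i) = lookup \<alpha> i"
  shows "demazure i (mon \<alpha>) = mon \<alpha>"
  using assms by (simp add: demazure_sym mon_def swap_vars_single swap_comp_eq)

theorem demazure_key_poly:
  "demazure i (key_poly \<alpha>)
    = key_poly (if lookup \<alpha> (Suc i) < lookup \<alpha> i then perm_comp (simple_refl i) \<alpha> else \<alpha>)"
proof -
  note step = sorted_op_step[OF braid_family_demazure, folded key_poly_sorted_op]
  consider "lookup \<alpha> (Suc i) < lookup \<alpha> i"
    | "lookup \<alpha> (Suc i) = lookup \<alpha> i"
    | "lookup \<alpha> i < lookup \<alpha> (Suc i)"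
    by linarith
  then show ?thesis
  proof cases
    case 1
    then show ?thesis by (simp add: step)
  next
    case 2
    then obtain p where "lookup (sort_comp \<alpha>) (Suc p) = lookup (sort_comp \<alpha>) p"
        "demazure i (key_poly \<alpha>) = op_perm demazure (sort_perm \<alpha>) (demazure p (mon (sort_comp \<alpha>)))"
      using sorted_op_equal_parts[OF braid_family_demazure, of \<alpha> i] key_poly_sorted_op by metis
    then show ?thesis using 2 by (simp add: demazure_mon_equal key_poly_sorted_op sorted_op_def)
  next
    case 3
    \<comment> \<open>The key polynomial is itself a value of the idempotent
      \<open>demazure i\<close>, hence fixed by it.\<close>
    then have "demazure i (key_poly (perm_comp (simple_refl i) \<alpha>)) = key_poly \<alpha>"
      using step[of "perm_comp (simple_refl i) \<alpha>" i] by simp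
    then show ?thesis using 3 by (metis demazure_demazure not_less_iff_gr_or_eq)
  qed
qed

lemma key_poly_partition: "is_partition \<mu> \<Longrightarrow> key_poly \<mu> = mon \<mu>"
  by (simp add: key_poly_sorted_op sorted_op_partition)

lemma demazure_bar_0 [simp]: "demazure_bar i 0 = 0"
  by (simp add: demazure_bar_def)

lemma op_perm_0: "(\<And>i. f i 0 = 0) \<Longrightarrow> op_perm f w 0 = 0"
proof -
  assume "\<And>i. f i 0 = 0"
  then have "foldr f is 0 = 0" for "is" by (induction "is") auto
  then show ?thesis by (simp add: op_perm_def)
qed

text \<open>For equal parts the reflection passes through to the dominant monomial, which is
  symmetric under it, and there the barred operator gives zero.\<close>

lemma demazure_bar_atom_poly:
  shows "lookup \<alpha> (Suc i) < lookup \<alpha> i \<Longrightarrow>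
      demazure_bar i (atom_poly \<alpha>) = atom_poly (perm_comp (simple_refl i) \<alpha>)"
    "lookup \<alpha> (Suc i) = lookup \<alpha> i \<Longrightarrow> demazure_bar i (atom_poly \<alpha>) = 0"
proof -
  show "lookup \<alpha> (Suc i) < lookup \<alpha> i \<Longrightarrow>
      demazure_bar i (atom_poly \<alpha>) = atom_poly (perm_comp (simple_refl i) \<alpha>)"
    unfolding atom_poly_sorted_op by (rule sorted_op_step[OF braid_family_demazure_bar])
  assume "lookup \<alpha> (Suc i) = lookup \<alpha> i"
  then obtain p where "lookup (sort_comp \<alpha>) (Suc p) = lookup (sort_comp \<alpha>) p"
      "demazure_bar i (atom_poly \<alpha>) = op_perm demazure_bar (sort_perm \<alpha>) (demazure_bar p (mon (sort_comp \<alpha>)))"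
    using sorted_op_equal_parts[OF braid_family_demazure_bar, of \<alpha> i] atom_poly_sorted_op by metis
  then show "demazure_bar i (atom_poly \<alpha>) = 0"
    by (simp add: demazure_bar_def[of p] demazure_mon_equal op_perm_0)
qed

section \<open>Nonnegative combinations\<close>

lemma sum_list_count_list:
  fixes B :: "'a \<Rightarrow> 'b::comm_ring_1"
  shows "(\<Sum>\<alpha>\<leftarrow>\<alpha>s. B \<alpha>) = (\<Sum>\<alpha>\<in>set \<alpha>s. of_nat (count_list \<alpha>s \<alpha>) * B \<alpha>)"
proof -
  have "(\<Sum>\<alpha>\<leftarrow>\<alpha>s. B \<alpha>) = (\<Sum>\<alpha>\<in>A. of_nat (count_list \<alpha>s \<alpha>) * B \<alpha>)" if "finite A" "set \<alpha>s \<subseteq> A" for A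
    using that(2)
  proof (induction \<alpha>s)
    case (Cons \<beta> \<alpha>s)
    have "(\<Sum>\<alpha>\<in>A. of_nat (count_list (\<beta> # \<alpha>s) \<alpha>) * B \<alpha>)
        = (\<Sum>\<alpha>\<in>A. of_nat (count_list \<alpha>s \<alpha>) * B \<alpha> + (if \<alpha> = \<beta> then B \<alpha> else 0))"
      by (intro sum.cong) (auto simp: distrib_right)
    then show ?case using Cons that(1) by (simp add: sum.distrib sum.delta add.commute)
  qed simp
  then show ?thesis by blast
qed

text \<open>Repetition in a list encodes the multiplicities, so addition becomes concatenation,
  linear maps act entrywise, and a sum of key polynomials vanishes only for the empty list.\<close>

lemma nonneg_combination_list: "nonneg_combination B f \<longleftrightarrow> (\<exists>\<alpha>s. f = (\<Sum>\<alpha>\<leftarrow>\<alpha>s. B \<alpha>))"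
proof
  assume "nonneg_combination B f"
  then obtain A and c :: "wcomp \<Rightarrow> nat" where "finite A" "f = (\<Sum>\<alpha>\<in>A. of_nat (c \<alpha>) * B \<alpha>)"
    unfolding nonneg_combination_def by blast
  then show "\<exists>\<alpha>s. f = (\<Sum>\<alpha>\<leftarrow>\<alpha>s. B \<alpha>)"
  proof (induction A arbitrary: f rule: finite_induct)
    case empty
    then show ?case by (intro exI[of _ "[]"]) simp
  next
    case (insert \<alpha> A)
    then obtain \<alpha>s where "(\<Sum>\<alpha>\<in>A. of_nat (c \<alpha>) * B \<alpha>) = (\<Sum>\<alpha>\<leftarrow>\<alpha>s. B \<alpha>)" by blast
    then show ?case using insert
      by (intro exI[of _ "replicate (c \<alpha>) \<alpha> @ \<alpha>s"]) (simp add: sum_list_replicate)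
  qed
next
  assume "\<exists>\<alpha>s. f = (\<Sum>\<alpha>\<leftarrow>\<alpha>s. B \<alpha>)"
  then obtain \<alpha>s where "f = (\<Sum>\<alpha>\<leftarrow>\<alpha>s. B \<alpha>)" by blast
  then have "f = (\<Sum>\<alpha>\<in>set \<alpha>s. of_nat (count_list \<alpha>s \<alpha>) * B \<alpha>)"
    by (simp add: sum_list_count_list)
  then show "nonneg_combination B f" unfolding nonneg_combination_def by blast
qed

lemma nonneg_combination_0 [simp]: "nonneg_combination B 0"
  unfolding nonneg_combination_list by (rule exI[of _ "[]"]) simp

lemma nonneg_combination_base [simp]: "nonneg_combination B (B \<alpha>)"
  unfolding nonneg_combination_list by (rule exI[of _ "[\<alpha>]"]) simp

lemma nonneg_combination_add:
  assumes "nonneg_combination B f" "nonneg_combination B g"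
  shows "nonneg_combination B (f + g)"
proof -
  obtain xs ys where "f = (\<Sum>\<alpha>\<leftarrow>xs. B \<alpha>)" "g = (\<Sum>\<alpha>\<leftarrow>ys. B \<alpha>)"
    using assms by (auto simp: nonneg_combination_list)
  then show ?thesis unfolding nonneg_combination_list by (intro exI[of _ "xs @ ys"]) simp
qed

lemma nonneg_combination_sum:
  "(\<And>a. a \<in> A \<Longrightarrow> nonneg_combination B (f a)) \<Longrightarrow> nonneg_combination B (\<Sum>a\<in>A. f a)"
  by (induction A rule: infinite_finite_induct) (auto intro: nonneg_combination_add)

lemma nonneg_combination_sum_list:
  "(\<And>a. a \<in> set xs \<Longrightarrow> nonneg_combination B (f a)) \<Longrightarrow> nonneg_combination B (\<Sum>a\<leftarrow>xs. f a)"
  by (induction xs) (auto intro: nonneg_combination_add)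

lemma nonneg_combination_of_nat_mult:
  "nonneg_combination B f \<Longrightarrow> nonneg_combination B (of_nat n * f)"
  by (induction n) (auto simp: distrib_right intro: nonneg_combination_add)

lemma nonneg_combination_map:
  assumes "nonneg_combination B f" "T 0 = 0" "\<And>f g. T (f + g) = T f + T g"
    "\<And>\<alpha>. nonneg_combination C (T (B \<alpha>))"
  shows "nonneg_combination C (T f)"
proof -
  obtain xs where "f = (\<Sum>\<alpha>\<leftarrow>xs. B \<alpha>)" using assms(1) by (auto simp: nonneg_combination_list)
  then have "T f = (\<Sum>\<alpha>\<leftarrow>xs. T (B \<alpha>))"
    using assms(2,3) by (induction xs arbitrary: f) auto
  then show ?thesis using assms(4) by (simp add: nonneg_combination_sum_list)
qed

lemma key_positive_demazure: "key_positive f \<Longrightarrow> key_positive (demazure i f)"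
  by (rule nonneg_combination_map[of key_poly f]) (simp_all add: demazure_add demazure_key_poly)

lemma key_positive_op_perm:
  assumes "key_positive f"
  shows "key_positive (op_perm demazure w f)"
proof -
  have "key_positive (foldr demazure is f)" for "is"
    using assms by (induction "is") (simp_all add: key_positive_demazure)
  then show ?thesis by (simp add: op_perm_def)
qed

section \<open>Atom positivity\<close>

lemma atom_or_0:
  assumes "w \<in> S_inf" "is_partition \<mu>"
  shows "op_perm demazure_bar w (mon \<mu>) \<in> {0, atom_poly (perm_comp w \<mu>)}"
  using assms(1)
proof (induction "perm_length w" arbitrary: w rule: less_induct)
  case less
  show ?case
  proof (cases "perm_length w = 0")
    case True
    then have "w = id" using less.prems perm_length_0 by blast
    then show ?thesis using assms(2) sorted_op_partition[of \<mu> demazure_bar] by (simp add: atom_poly_sorted_op)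
  next
    case False
    then obtain i where i: "inv w (Suc i) < inv w i" using exists_left_descent less.prems by blast
    define v where "v = simple_refl i \<circ> w"
    have v: "v \<in> S_inf" "w = simple_refl i \<circ> v" using less.prems by (simp_all add: v_def)
    have asc: "inv v i < inv v (Suc i)" using i by (simp add: v_def inv_left less.prems)
    have eq: "op_perm demazure_bar w (mon \<mu>) = demazure_bar i (op_perm demazure_bar v (mon \<mu>))"
      unfolding v(2) by (rule op_perm_left[OF braid_family_demazure_bar v(1) asc])
    \<comment> \<open>The ascent of \<open>inv v\<close> leaves two cases: strictly decreasing parts
      give the next atom, equal parts give zero.\<close>
    have "lookup (perm_comp v \<mu>) (Suc i) \<le> lookup (perm_comp v \<mu>) i"
      using asc assms(2) v(1) by (simp add: lookup_S_inf is_partition_def)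
    moreover have "op_perm demazure_bar v (mon \<mu>) \<in> {0, atom_poly (perm_comp v \<mu>)}"
      using less.hyps[OF _ v(1)] perm_length_left(2)[OF less.prems i] by (simp add: v_def)
    ultimately show ?thesis
      using eq demazure_bar_atom_poly[of "perm_comp v \<mu>" i] perm_comp_left[OF v(1), of i \<mu>] v(2)
      by (auto simp: le_less)
  qed
qed

lemma op_perm_add:
  assumes "\<And>i f g. T i (f + g) = T i f + T i g"
  shows "op_perm T w (f + g) = op_perm T w f + op_perm T w (g :: 'a :: ab_group_add)"
proof -
  have "foldr T is (f + g) = foldr T is f + foldr T is g" for "is"
    by (induction "is") (auto simp: assms)
  then show ?thesis by (simp add: op_perm_def)
qed

lemma demazure_bar_add: "demazure_bar i (f + g) = demazure_bar i f + demazure_bar i g"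
  by (simp add: demazure_bar_def demazure_add)

lemma demazure_bar_demazure [simp]: "demazure_bar i (demazure i f) = 0"
  by (simp add: demazure_bar_def)

text \<open>On the right, \<open>demazure i\<close> is absorbed one letter at a time:
  it either annihilates or splits as \<open>demazure_bar i + 1\<close>, which lengthens the word or keeps it.\<close>

lemma atom_positive_word:
  assumes "w \<in> S_inf" "is_partition \<mu>"
  shows "nonneg_combination atom_poly (op_perm demazure_bar w (foldr demazure is (mon \<mu>)))"
  using assms(1)
proof (induction "is" arbitrary: w)
  case Nil
  then show ?case using atom_or_0[OF Nil assms(2)] by auto
next
  case (Cons i "is")
  let ?g = "foldr demazure is (mon \<mu>)"
  show ?case
  proof (cases rule: bij_step_cases[OF S_inf_bij[OF Cons.prems], of i])
    case 1
    have "op_perm demazure_bar w (demazure i ?g)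
      = op_perm demazure_bar w (demazure_bar i ?g) + op_perm demazure_bar w ?g"
      using op_perm_add[of demazure_bar w "demazure_bar i ?g" ?g, OF demazure_bar_add]
      by (simp add: demazure_bar_def[of i])
    also have "op_perm demazure_bar w (demazure_bar i ?g) = op_perm demazure_bar (w \<circ> simple_refl i) ?g"
      by (rule op_perm_right[OF braid_family_demazure_bar Cons.prems 1, symmetric])
    finally have eq: "op_perm demazure_bar w (foldr demazure (i # is) (mon \<mu>))
        = op_perm demazure_bar (w \<circ> simple_refl i) ?g + op_perm demazure_bar w ?g"
      unfolding foldr_Cons comp_apply .
    show ?thesis
      unfolding eq by (rule nonneg_combination_add[OF Cons.IH[OF S_inf_right[OF Cons.prems]] Cons.IH[OF Cons.prems]])
  next
    case 2
    then show ?thesis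
      using op_perm_right_down[OF braid_family_demazure_bar Cons.prems 2, of "demazure i ?g"]
      by (simp add: op_perm_0)
  qed
qed

lemma key_poly_word: "\<exists>is. key_poly \<alpha> = foldr demazure is (mon (sort_comp \<alpha>))"
  unfolding key_poly_sorted_op sorted_op_def op_perm_def by blast

theorem atom_positive_op_perm:
  assumes "key_positive f" "w \<in> S_inf"
  shows "nonneg_combination atom_poly (op_perm demazure_bar w f)"
proof (rule nonneg_combination_map[OF assms(1)])
  fix \<alpha>
  show "nonneg_combination atom_poly (op_perm demazure_bar w (key_poly \<alpha>))"
    using key_poly_word[of \<alpha>] atom_positive_word[OF assms(2) min_sort_sort_perm(1)] by metis
qed (simp_all add: op_perm_0 op_perm_add demazure_bar_add)

section \<open>Leading terms, and multiplication by dominant monomials\<close>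

definition sqsum :: "wcomp \<Rightarrow> nat" where
  "sqsum \<alpha> = (\<Sum>i\<in>keys \<alpha>. (lookup \<alpha> i)\<^sup>2)"

lemma sqsum_update2: "\<exists>R. \<forall>p q. sqsum (update2 i p q \<alpha>) = p\<^sup>2 + q\<^sup>2 + R"
proof -
  obtain R where "\<And>p q. (\<Sum>j\<in>keys (update2 i p q \<alpha>). (lookup (update2 i p q \<alpha>) j)\<^sup>2)
      = p\<^sup>2 + q\<^sup>2 + R"
    using sum_keys_split[where h = "\<lambda>_ k. k\<^sup>2" and i = i and \<alpha> = \<alpha>] by auto
  then show ?thesis unfolding sqsum_def by blast
qed

lemma demazure_single_top:
  fixes \<alpha> :: wcomp
  assumes "sqsum \<alpha> \<le> m"
  shows "\<beta> \<in> keys (demazure i (single \<alpha> c)) \<Longrightarrow> sqsum \<beta> \<le> m"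
    and "is_partition \<mu> \<Longrightarrow> sqsum \<mu> = m \<Longrightarrow>
      lookup (demazure i (single \<alpha> c)) \<mu> = lookup (single \<alpha> c) \<mu>"
proof -
  define a b where "a = lookup \<alpha> i" and "b = lookup \<alpha> (Suc i)"
  obtain R where "\<forall>p q. sqsum (update2 i p q \<alpha>) = p\<^sup>2 + q\<^sup>2 + R" using sqsum_update2 ..
  then have R: "sqsum (update2 i p q \<alpha>) = p\<^sup>2 + q\<^sup>2 + R" for p q by simp
  have \<alpha>: "update2 i a b \<alpha> = \<alpha>" by (simp add: a_def b_def update2_self)
  then have q\<alpha>: "a\<^sup>2 + b\<^sup>2 + R \<le> m" using R[of a b] assms by simp
  have "(\<forall>\<beta>\<in>keys (demazure i (single \<alpha> c)). sqsum \<beta> \<le> m) \<and>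
    (is_partition \<mu> \<and> sqsum \<mu> = m \<longrightarrow>
      lookup (demazure i (single \<alpha> c)) \<mu> = lookup (single \<alpha> c) \<mu>)"
  proof (cases "b \<le> a")
    case True
    then obtain d where d: "a = b + d" using le_Suc_ex by blast
    have dem: "demazure i (single \<alpha> c)
        = (\<Sum>t<Suc d. single (update2 i (b + t) (b + d - t) \<alpha>) c)"
      using demazure_single(1)[of \<alpha> i c] d by (simp add: a_def[symmetric] b_def[symmetric])
    \<comment> \<open>Strict convexity of the square: the norm drops by
      \<open>2 * t * (d - t)\<close>, so only the two ends of the segment keep it. The end
      \<open>t = d\<close> is \<alpha> itself; the end \<open>t = 0\<close> is its reflection, which
      is not a partition for \<open>d > 0\<close>.\<close>
    have sq: "(b + t)\<^sup>2 + (b + d - t)\<^sup>2 + 2 * t * (d - t) = a\<^sup>2 + b\<^sup>2" if "t \<le> d" for t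
    proof -
      from le_Suc_ex[OF that] obtain e where "d = t + e" by blast
      then show ?thesis using d by (simp add: power2_eq_square algebra_simps)
    qed
    show ?thesis
    proof (intro conjI ballI impI)
      fix \<beta> assume "\<beta> \<in> keys (demazure i (single \<alpha> c))"
      then obtain t where "t \<in> {..<Suc d}"
        "\<beta> \<in> keys (single (update2 i (b + t) (b + d - t) \<alpha>) c)"
        unfolding dem by (rule keys_sumE)
      then show "sqsum \<beta> \<le> m" using sq[of t] q\<alpha> by (auto simp: R split: if_splits)
    next
      assume \<mu>: "is_partition \<mu> \<and> sqsum \<mu> = m"
      have neq: "update2 i (b + t) (b + d - t) \<alpha> \<noteq> \<mu>" if "t < d" for t
      proof
        assume eq: "update2 i (b + t) (b + d - t) \<alpha> = \<mu>"
        then have "m = (b + t)\<^sup>2 + (b + d - t)\<^sup>2 + R" using R \<mu> by metis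
        then have "2 * t * (d - t) = 0" using sq[of t] q\<alpha> that by linarith
        then have "t = 0" using that by simp
        then have "lookup \<mu> i = b" "lookup \<mu> (Suc i) = b + d"
          using eq by (auto simp: lookup_update2)
        moreover have "lookup \<mu> (Suc i) \<le> lookup \<mu> i" using \<mu> is_partition_Suc by blast
        ultimately show False using that by simp
      qed
      have "lookup (demazure i (single \<alpha> c)) \<mu>
          = (\<Sum>t<Suc d. lookup (single (update2 i (b + t) (b + d - t) \<alpha>) c) \<mu>)"
        by (simp only: dem lookup_sum)
      also have "\<dots> = lookup (single (update2 i (b + d) (b + d - d) \<alpha>) c) \<mu>
          + (\<Sum>t<d. lookup (single (update2 i (b + t) (b + d - t) \<alpha>) c) \<mu>)"
        by (simp only: sum.lessThan_Suc add.commute)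
      also have "(\<Sum>t<d. lookup (single (update2 i (b + t) (b + d - t) \<alpha>) c) \<mu>) = 0"
        using neq by (intro sum.neutral) (simp add: lookup_single when_def)
      finally show "lookup (demazure i (single \<alpha> c)) \<mu>
          = lookup (single \<alpha> c) \<mu>"
        using \<alpha> d by simp
    qed
  next
    case False
    then have "Suc a \<le> b" by simp
    then obtain d where d: "b = Suc a + d" using le_Suc_ex by blast
    have dem: "demazure i (single \<alpha> c)
        = - (\<Sum>t<d. single (update2 i (Suc a + t) (a + d - t) \<alpha>) c)"
      using demazure_single(2)[of \<alpha> i c] d by (simp add: a_def[symmetric] b_def[symmetric])
    \<comment> \<open>Here all exponents lie strictly inside the segment, so the norm strictly
      drops. As \<alpha> is no partition in this case, both coefficients at \<mu> are zero.\<close>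
    have sq: "(Suc a + t)\<^sup>2 + (a + d - t)\<^sup>2 < a\<^sup>2 + b\<^sup>2" if "t < d" for t
    proof -
      from less_imp_Suc_add[OF that] obtain e where "d = Suc (t + e)" by blast
      then show ?thesis using d by (simp add: power2_eq_square algebra_simps)
    qed
    have le: "sqsum \<beta> < m" if "\<beta> \<in> keys (demazure i (single \<alpha> c))" for \<beta>
    proof -
      have "\<beta> \<in> keys (\<Sum>t<d. single (update2 i (Suc a + t) (a + d - t) \<alpha>) c)"
        using that by (simp only: dem keys_minus)
      then obtain t where t: "t \<in> {..<d}"
        "\<beta> \<in> keys (single (update2 i (Suc a + t) (a + d - t) \<alpha>) c)"
        by (rule keys_sumE)
      then have "\<beta> = update2 i (Suc a + t) (a + d - t) \<alpha>" by (simp split: if_splits)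
      then have "sqsum \<beta> = (Suc a + t)\<^sup>2 + (a + d - t)\<^sup>2 + R" by (simp only: R)
      then show ?thesis using sq[of t] t(1) q\<alpha> by simp
    qed
    have "\<mu> \<noteq> \<alpha>" if "is_partition \<mu>"
      using that False by (auto simp: is_partition_Suc a_def b_def)
    note neq = this
    show ?thesis
    proof (intro conjI ballI impI)
      fix \<beta> assume "\<beta> \<in> keys (demazure i (single \<alpha> c))"
      from le[OF this] show "sqsum \<beta> \<le> m" by simp
    next
      assume \<mu>: "is_partition \<mu> \<and> sqsum \<mu> = m"
      have "\<mu> \<notin> keys (demazure i (single \<alpha> c))"
      proof
        assume "\<mu> \<in> keys (demazure i (single \<alpha> c))"
        from le[OF this] show False using \<mu> by simp
      qed
      then have "lookup (demazure i (single \<alpha> c)) \<mu> = 0"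
        by (simp only: in_keys_iff not_not)
      then show "lookup (demazure i (single \<alpha> c)) \<mu>
          = lookup (single \<alpha> c) \<mu>"
        using neq \<mu> by (simp add: lookup_single_not_eq)
    qed
  qed
  then show "\<beta> \<in> keys (demazure i (single \<alpha> c)) \<Longrightarrow> sqsum \<beta> \<le> m"
    "is_partition \<mu> \<Longrightarrow> sqsum \<mu> = m \<Longrightarrow>
      lookup (demazure i (single \<alpha> c)) \<mu> = lookup (single \<alpha> c) \<mu>"
    by auto
qed

text \<open>A Demazure operator moves exponent vectors into the segment between \<open>\<alpha>\<close> and its reflection,
  so it preserves the coefficients of dominant monomials of maximal norm.\<close>

lemma demazure_top:
  assumes "\<forall>\<alpha>\<in>keys f. sqsum \<alpha> \<le> m"
  shows "\<forall>\<beta>\<in>keys (demazure i f). sqsum \<beta> \<le> m"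
    "is_partition \<mu> \<Longrightarrow> sqsum \<mu> = m \<Longrightarrow>
      lookup (demazure i f) \<mu> = lookup f \<mu>"
proof -
  have eq: "demazure i f
      = (\<Sum>\<alpha>\<in>keys f. demazure i (single \<alpha> (lookup f \<alpha>)))"
    using arg_cong[OF ipoly_sum_keys[of f], of "demazure i"] unfolding demazure_sum .
  show "\<forall>\<beta>\<in>keys (demazure i f). sqsum \<beta> \<le> m"
  proof
    fix \<beta> assume "\<beta> \<in> keys (demazure i f)"
    then obtain \<alpha> where "\<alpha> \<in> keys f"
      "\<beta> \<in> keys (demazure i (single \<alpha> (lookup f \<alpha>)))"
      unfolding eq by (rule keys_sumE)
    then show "sqsum \<beta> \<le> m" using demazure_single_top(1) assms by blast
  qed
  assume \<mu>: "is_partition \<mu>" "sqsum \<mu> = m"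
  have "lookup (demazure i f) \<mu>
    = (\<Sum>\<alpha>\<in>keys f. lookup (single \<alpha> (lookup f \<alpha>)) \<mu>)"
    unfolding eq lookup_sum using demazure_single_top(2)[OF _ \<mu>] assms by (intro sum.cong) auto
  then show "lookup (demazure i f) \<mu> = lookup f \<mu>"
    using arg_cong[OF ipoly_sum_keys[of f], of "\<lambda>g. lookup g \<mu>"] unfolding lookup_sum by simp
qed

text \<open>Coefficients of dominant monomials of top norm survive every letter of the word, so they
  are those of \<open>mon (sort_comp \<alpha>)\<close>.\<close>

lemma key_poly_top:
  assumes "is_partition \<mu>" "sqsum (sort_comp \<alpha>) \<le> sqsum \<mu>"
  shows "lookup (key_poly \<alpha>) \<mu> = (if \<mu> = sort_comp \<alpha> then 1 else 0)"
proof -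
  let ?f = "mon (sort_comp \<alpha>)"
  have "(\<forall>\<beta>\<in>keys (foldr demazure is ?f). sqsum \<beta> \<le> sqsum \<mu>) \<and>
      lookup (foldr demazure is ?f) \<mu> = lookup ?f \<mu>" for "is"
  proof (induction "is")
    case Nil
    then show ?case using assms by (simp add: mon_def)
  next
    case (Cons i "is")
    then show ?case using demazure_top(1)[of "foldr demazure is ?f" "sqsum \<mu>" i]
      demazure_top(2)[of "foldr demazure is ?f" "sqsum \<mu>" \<mu> i] assms(1) by simp
  qed
  then show ?thesis using key_poly_word[of \<alpha>] by (auto simp: mon_def lookup_single when_def)
qed

text \<open>At the dominant monomial of a shape of largest norm, each summand contributes 0 or 1,
  and the chosen \<beta> contributes 1.\<close>

lemma sum_keys_nonzero:
  assumes "\<alpha>s \<noteq> []"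
  shows "(\<Sum>\<alpha>\<leftarrow>\<alpha>s. key_poly \<alpha>) \<noteq> 0"
proof
  assume zero: "(\<Sum>\<alpha>\<leftarrow>\<alpha>s. key_poly \<alpha>) = 0"
  let ?S = "(\<lambda>\<alpha>. sqsum (sort_comp \<alpha>)) ` set \<alpha>s"
  have "Max ?S \<in> ?S" using assms by (intro Max_in) auto
  then obtain \<beta> where "\<beta> \<in> set \<alpha>s" "Max ?S = sqsum (sort_comp \<beta>)" by blast
  moreover have "sqsum (sort_comp \<alpha>) \<le> Max ?S" if "\<alpha> \<in> set \<alpha>s" for \<alpha> using that by simp
  ultimately have \<beta>: "\<beta> \<in> set \<alpha>s" "\<And>\<alpha>. \<alpha> \<in> set \<alpha>s \<Longrightarrow> sqsum (sort_comp \<alpha>) \<le> sqsum (sort_comp \<beta>)"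
    by simp_all
  let ?\<mu> = "sort_comp \<beta>"
  have "lookup (\<Sum>\<alpha>\<leftarrow>xs. key_poly \<alpha>) ?\<mu> = (\<Sum>\<alpha>\<leftarrow>xs. if ?\<mu> = sort_comp \<alpha> then 1 else 0)"
    if "set xs \<subseteq> set \<alpha>s" for xs
    using that by (induction xs) (auto simp: lookup_add key_poly_top[OF min_sort_sort_perm(1) \<beta>(2)])
  then have "(\<Sum>\<alpha>\<leftarrow>\<alpha>s. if ?\<mu> = sort_comp \<alpha> then 1 else 0 :: int) = 0" using zero by (metis lookup_zero order_refl)
  moreover have "(1::int) \<le> (\<Sum>\<alpha>\<leftarrow>\<alpha>s. if ?\<mu> = sort_comp \<alpha> then 1 else 0)"
    by (rule member_le_sum_list) (use \<beta>(1) in force, auto)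
  ultimately show False by simp
qed

text \<open>Key polynomials go to key polynomials, so the image is again a sum over a nonempty
  list.\<close>

lemma key_positive_demazure_nonzero:
  assumes "key_positive f" "f \<noteq> 0"
  shows "demazure i f \<noteq> 0"
proof -
  obtain xs where f: "f = (\<Sum>\<alpha>\<leftarrow>xs. key_poly \<alpha>)" using assms(1) by (auto simp: nonneg_combination_list)
  define g where
    "g \<alpha> = (if lookup \<alpha> (Suc i) < lookup \<alpha> i then perm_comp (simple_refl i) \<alpha> else \<alpha>)" for \<alpha>
  have "demazure i (sum_list (map key_poly ys)) = sum_list (map key_poly (map g ys))" for ys
    by (induction ys) (simp_all add: demazure_add demazure_key_poly g_def)
  then have "demazure i f = sum_list (map key_poly (map g xs))" by (simp only: f)
  moreover have "map g xs \<noteq> []" using assms(2) f by auto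
  ultimately show ?thesis using sum_keys_nonzero[of "map g xs"] by (simp only: not_False_eq_True)
qed

lemma key_positive_op_perm_nonzero:
  assumes "key_positive f" "f \<noteq> 0"
  shows "op_perm demazure w f \<noteq> 0"
proof -
  have "key_positive (foldr demazure is f) \<and> foldr demazure is f \<noteq> 0" for "is"
    using assms by (induction "is") (simp_all add: key_positive_demazure key_positive_demazure_nonzero)
  then show ?thesis by (simp add: op_perm_def)
qed

section \<open>Multiplication by initial products of variables\<close>

definition vars :: "nat set \<Rightarrow> ipoly" where
  "vars T = (\<Prod>t\<in>T. var t)"

text \<open>Moving \<open>var i\<close> inside the operator costs a positive correction, moving
  \<open>var (Suc i)\<close> a negative one. The second sign is the one that must be shown to
  cancel.\<close>

lemma var_mult_demazure:
  "var (Suc i) * demazure i f = demazure i (var i * f) - var i * f"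
  "var i * demazure i f = demazure i (var (Suc i) * f) + var i * f"
proof -
  show 1: "var (Suc i) * demazure i f = demazure i (var i * f) - var i * f"
    using ddiff_var_mult[of i "var i * f"] by (simp add: demazure_ddiff)
  have "swap_vars i (var i + var (Suc i)) = var i + var (Suc i)"
    by (simp add: swap_vars_add swap_vars_var add.commute)
  from demazure_sym_mult[OF this, of f]
  have "demazure i (var i * f) + demazure i (var (Suc i) * f) = var i * demazure i f + var (Suc i) * demazure i f"
    by (simp only: distrib_right demazure_add)
  then show "var i * demazure i f = demazure i (var (Suc i) * f) + var i * f"
    unfolding 1 by (simp add: algebra_simps)
qed

lemma swap_vars_vars:
  assumes "i \<in> T \<longleftrightarrow> Suc i \<in> T"
  shows "swap_vars i (vars T) = vars T"
proof -
  have im: "simple_refl i ` T = T"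
  proof -
    have "simple_refl i ` T \<subseteq> T" using assms by (auto simp: simple_refl_eq)
    moreover have "T \<subseteq> simple_refl i ` T"
      using calculation by (metis image_subset_iff simple_refl_simps(3) subsetI image_eqI)
    ultimately show ?thesis by blast
  qed
  have "swap_vars i (vars T) = (\<Prod>t\<in>T. var (simple_refl i t))"
    by (simp add: vars_def swap_vars_prod swap_vars_var)
  also have "\<dots> = (\<Prod>t\<in>simple_refl i ` T. var t)"
    by (subst prod.reindex) (auto intro: inj_on_subset[OF bij_is_inj[OF bij_simple_refl]])
  finally show ?thesis by (simp add: im vars_def)
qed

text \<open>The Demazure product with a simple reflection, that is, multiplication in the 0-Hecke
  monoid.\<close>

definition dem_prod :: "(nat \<Rightarrow> nat) \<Rightarrow> nat \<Rightarrow> nat \<Rightarrow> nat" where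
  "dem_prod z i = (if z i < z (Suc i) then z \<circ> simple_refl i else z)"

lemma dem_prod_S_inf [simp]: "z \<in> S_inf \<Longrightarrow> dem_prod z i \<in> S_inf"
  by (simp add: dem_prod_def)

lemma dem_prod_apply:
  "dem_prod z i j = (if j = i then max (z i) (z (Suc i)) else if j = Suc i then min (z i) (z (Suc i)) else z j)"
  by (auto simp: dem_prod_def simple_refl_eq)

lemma op_perm_dem_prod:
  assumes "z \<in> S_inf"
  shows "op_perm demazure z (demazure i f) = op_perm demazure (dem_prod z i) f"
proof (cases rule: bij_step_cases[OF S_inf_bij[OF assms], of i])
  case 1
  then show ?thesis by (simp add: dem_prod_def op_perm_right[OF braid_family_demazure assms])
next
  case 2
  then show ?thesis
    using op_perm_right_down[OF braid_family_demazure assms 2] by (simp add: dem_prod_def)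
qed

text \<open>Call \<open>a\<close> outside \<open>T\<close> before \<open>b\<close> in
  \<open>T\<close> a gap: the permutation must invert every gap. The starting set
  \<open>{..<k}\<close> has none, so it may be paired with the identity.\<close>

definition straightened :: "(nat \<Rightarrow> nat) \<times> nat set \<Rightarrow> bool" where
  "straightened p \<longleftrightarrow> fst p \<in> S_inf \<and> finite (snd p) \<and>
     (\<forall>a b. a < b \<and> a \<notin> snd p \<and> b \<in> snd p \<longrightarrow> fst p b < fst p a)"

lemma op_perm_diff:
  assumes "\<And>i f g. T i (f + g) = T i f + T i g"
  shows "op_perm T w (f - g) = op_perm T w f - op_perm T w (g :: 'a :: ab_group_add)"
  using op_perm_add[of T w "f - g" g, OF assms] by simp

lemma vars_demazure_step:
  assumes "straightened (z, T)"
  shows "\<exists>L. (\<forall>p\<in>set L. straightened p) \<and>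
    (\<forall>f. op_perm demazure z (vars T * demazure i f) = (\<Sum>(y, U)\<leftarrow>L. op_perm demazure y (vars U * f)))"
proof -
  have z: "z \<in> S_inf" and T: "finite T" and desc: "\<And>a b. a < b \<Longrightarrow> a \<notin> T \<Longrightarrow> b \<in> T \<Longrightarrow> z b < z a"
    using assms by (auto simp: straightened_def)
  consider (same) "i \<in> T \<longleftrightarrow> Suc i \<in> T" | (good) "i \<in> T" "Suc i \<notin> T" | (bad) "i \<notin> T" "Suc i \<in> T"
    by blast
  then show ?thesis
  proof cases
    case same
    have "straightened (dem_prod z i, T)"
      unfolding straightened_def
    proof (clarsimp simp: z T)
      fix a b assume ab: "a < b" "a \<notin> T" "b \<in> T"
      have "a \<in> {i, Suc i} \<and> b > Suc i \<or> b \<in> {i, Suc i} \<and> a < i \<or> a \<notin> {i, Suc i} \<and> b \<notin> {i, Suc i}"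
        using ab same by (cases "a \<in> {i, Suc i}"; cases "b \<in> {i, Suc i}") auto
      then consider "a \<in> {i, Suc i}" "b > Suc i" | "b \<in> {i, Suc i}" "a < i" | "a \<notin> {i, Suc i}" "b \<notin> {i, Suc i}"
        by blast
      then show "dem_prod z i b < dem_prod z i a"
      proof cases
        case 1
        then have "z b < z i" "z b < z (Suc i)" using desc[of i b] desc[of "Suc i" b] ab same by auto
        then show ?thesis using 1 by (auto simp: dem_prod_apply)
      next
        case 2
        then have "z i < z a" "z (Suc i) < z a" using desc[of a i] desc[of a "Suc i"] ab same by auto
        then show ?thesis using 2 by (auto simp: dem_prod_apply)
      next
        case 3
        then show ?thesis using desc[OF ab] by (simp add: dem_prod_apply)
      qed
    qed
    then show ?thesis
      by (intro exI[of _ "[(dem_prod z i, T)]"])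
        (simp add: op_perm_dem_prod[OF z] demazure_sym_mult[OF swap_vars_vars[OF same], symmetric])
  next
    case good
    let ?U = "insert (Suc i) (T - {i})" and ?P = "T - {i}"
    have "swap_vars i (vars ?P) = vars ?P" by (rule swap_vars_vars) (use good in auto)
    note P = demazure_sym_mult[OF this]
    have TU: "vars T = var i * vars ?P" "vars ?U = var (Suc i) * vars ?P"
      using T good by (simp_all add: vars_def prod.remove)
    \<comment> \<open>The correction is positive and reproduces the pair \<open>(z, T)\<close>, so
      this case contributes two terms.\<close>
    have eq: "vars T * demazure i f = demazure i (vars ?U * f) + vars T * f" for f
    proof -
      have "vars T * demazure i f = vars ?P * (var i * demazure i f)" by (simp add: TU mult_ac)
      also have "\<dots> = demazure i (vars ?P * (var (Suc i) * f)) + vars ?P * (var i * f)"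
        by (simp only: var_mult_demazure(2) P distrib_left)
      finally show ?thesis by (simp add: TU mult_ac)
    qed
    \<comment> \<open>The set \<open>?U\<close> has the new gap \<open>i\<close> before
      \<open>Suc i\<close>, and \<open>dem_prod\<close> forces exactly the descent that this gap
      demands.\<close>
    have "straightened (dem_prod z i, ?U)"
      unfolding straightened_def
    proof (clarsimp simp: z T)
      fix a b assume ab: "a < b" "a \<noteq> Suc i" "a \<in> T \<longrightarrow> a = i" "b = Suc i \<or> b \<in> T \<and> b \<noteq> i"
      have "a = i \<and> b = Suc i \<or> a = i \<and> b > Suc i \<and> b \<in> T \<or> b = Suc i \<and> a < i \<and> a \<notin> T
          \<or> a \<notin> {i, Suc i} \<and> b \<notin> {i, Suc i} \<and> a \<notin> T \<and> b \<in> T"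
      proof (cases "a = i")
        case True
        show ?thesis
        proof (cases "b = Suc i")
          case False
          then have "Suc i < b" "b \<in> T" using ab True Suc_lessI[of i b] by blast+
          then show ?thesis using True by blast
        qed (use True in blast)
      next
        case False
        then have a: "a \<notin> T" using ab(3) by blast
        show ?thesis
        proof (cases "b = Suc i")
          case True
          then have "a < i" using ab(1) False by linarith
          then show ?thesis using True a by blast
        qed (use a False ab in blast)
      qed
      then consider "a = i" "b = Suc i" | "a = i" "b > Suc i" "b \<in> T" | "b = Suc i" "a < i" "a \<notin> T"
          | "a \<notin> {i, Suc i}" "b \<notin> {i, Suc i}" "a \<notin> T" "b \<in> T"
        by blast
      then show "dem_prod z i b < dem_prod z i a"
      proof cases
        case 1
        have "z i \<noteq> z (Suc i)" using S_inf_bij[OF z] by (metis bij_pointE n_not_Suc_n)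
        then show ?thesis using 1 by (auto simp: dem_prod_apply)
      next
        case 2
        then have "z b < z (Suc i)" using desc[of "Suc i" b] good by auto
        then show ?thesis using 2 by (auto simp: dem_prod_apply)
      next
        case 3
        then have "z i < z a" using desc[of a i] good by auto
        then show ?thesis using 3 by (auto simp: dem_prod_apply)
      next
        case 4
        then show ?thesis using desc[OF ab(1)] by (simp add: dem_prod_apply)
      qed
    qed
    then show ?thesis using assms
      by (intro exI[of _ "[(dem_prod z i, ?U), (z, T)]"])
        (simp add: eq op_perm_add[OF demazure_add] op_perm_dem_prod[OF z])
  next
    case bad
    let ?U = "insert i (T - {Suc i})" and ?P = "T - {Suc i}"
    have "swap_vars i (vars ?P) = vars ?P" by (rule swap_vars_vars) (use bad in auto)
    note P = demazure_sym_mult[OF this]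
    have TU: "vars T = var (Suc i) * vars ?P" "vars ?U = var i * vars ?P"
      using T bad by (simp_all add: vars_def prod.remove)
    have eq: "vars T * demazure i f = demazure i (vars ?U * f) - vars ?U * f" for f
    proof -
      have "vars T * demazure i f = vars ?P * (var (Suc i) * demazure i f)" by (simp add: TU mult_ac)
      also have "\<dots> = demazure i (vars ?P * (var i * f)) - vars ?P * (var i * f)"
        by (simp only: var_mult_demazure(1) P right_diff_distrib)
      finally show ?thesis by (simp add: TU mult_ac)
    qed
    \<comment> \<open>The gap at \<open>i\<close> is a descent of \<open>z\<close>, so
      \<open>op_perm demazure z\<close> absorbs \<open>demazure i\<close> and the two terms of
      \<open>eq\<close> cancel. Hence the empty list.\<close>
    have "dem_prod z i = z" using desc[of i "Suc i"] bad by (simp add: dem_prod_def)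
    then show ?thesis
      by (intro exI[of _ "[]"]) (simp add: eq op_perm_diff[OF demazure_add] op_perm_dem_prod[OF z])
  qed
qed

text \<open>Moving the dominant monomial past the operators one letter at a time. The invariant \<open>straightened\<close>
  makes the terms with negative sign cancel.\<close>

lemma vars_demazure_word:
  "\<exists>L. (\<forall>p\<in>set L. straightened p) \<and>
    (\<forall>f. vars {..<k} * foldr demazure is f = (\<Sum>(y, U)\<leftarrow>L. op_perm demazure y (vars U * f)))"
proof (induction "is" rule: rev_induct)
  case Nil
  show ?case by (intro exI[of _ "[(id, {..<k})]"]) (auto simp: straightened_def)
next
  case (snoc i "is")
  then obtain L where L: "\<forall>p\<in>set L. straightened p"
    "\<And>f. vars {..<k} * foldr demazure is f = (\<Sum>(y, U)\<leftarrow>L. op_perm demazure y (vars U * f))"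
    by blast
  have "\<exists>L'. (\<forall>p\<in>set L'. straightened p) \<and>
    (\<forall>f. (\<Sum>(y, U)\<leftarrow>L. op_perm demazure y (vars U * demazure i f))
       = (\<Sum>(y, U)\<leftarrow>L'. op_perm demazure y (vars U * f)))"
    using L(1)
  proof (induction L)
    case Nil
    show ?case by (intro exI[of _ "[]"]) simp
  next
    case (Cons p L)
    obtain z T where p: "p = (z, T)" by (cases p)
    obtain M where M: "\<forall>p\<in>set M. straightened p"
      "\<And>f. (\<Sum>(y, U)\<leftarrow>L. op_perm demazure y (vars U * demazure i f))
         = (\<Sum>(y, U)\<leftarrow>M. op_perm demazure y (vars U * f))"
      using Cons by auto
    obtain N where N: "\<forall>p\<in>set N. straightened p"
      "\<And>f. op_perm demazure z (vars T * demazure i f) = (\<Sum>(y, U)\<leftarrow>N. op_perm demazure y (vars U * f))"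
      using vars_demazure_step[of z T i] Cons.prems p by auto
    show ?case using M N p by (intro exI[of _ "N @ M"]) auto
  qed
  then show ?case using L(2) by simp
qed

lemma vars_mult_mon:
  assumes "finite T"
  shows "\<exists>\<beta>. vars T * mon \<alpha> = mon \<beta> \<and>
    (\<forall>i. lookup \<beta> i = lookup \<alpha> i + (if i \<in> T then 1 else 0))"
  using assms
proof (induction T)
  case empty
  then show ?case by (auto simp: vars_def)
next
  case (insert t T)
  then obtain \<beta> where \<beta>: "vars T * mon \<alpha> = mon \<beta>"
    "\<forall>i. lookup \<beta> i = lookup \<alpha> i + (if i \<in> T then 1 else 0)" by blast
  have "vars (insert t T) * mon \<alpha> = var t * (vars T * mon \<alpha>)"
    using insert by (simp add: vars_def mult_ac)
  also have "\<dots> = mon (single t 1 + \<beta>)" unfolding \<beta>(1) by (simp add: mon_def var_mult_single)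
  finally show ?case
    using insert \<beta>(2) by (intro exI[of _ "single t 1 + \<beta>"]) (auto simp: lookup_add lookup_single when_def)
qed

theorem key_positive_vars_mult:
  assumes "key_positive f"
  shows "key_positive (vars {..<k} * f)"
proof (rule nonneg_combination_map[OF assms])
  fix \<alpha>
  define \<mu> where "\<mu> = sort_comp \<alpha>"
  have \<mu>: "is_partition \<mu>" by (simp add: \<mu>_def min_sort_sort_perm)
  obtain "is" where "key_poly \<alpha> = foldr demazure is (mon \<mu>)" using key_poly_word \<mu>_def by blast
  then obtain L where L: "\<forall>p\<in>set L. straightened p"
    "vars {..<k} * key_poly \<alpha> = (\<Sum>(y, U)\<leftarrow>L. op_perm demazure y (vars U * mon \<mu>))"
    using vars_demazure_word[of k "is"] by auto
  have "key_positive (op_perm demazure y (vars U * mon \<mu>))" if "straightened (y, U)" for y U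
  proof -
    have y: "y \<in> S_inf" "finite U" using that by (auto simp: straightened_def)
    obtain \<beta> where \<beta>: "vars U * mon \<mu> = mon \<beta>"
      "\<And>i. lookup \<beta> i = lookup \<mu> i + (if i \<in> U then 1 else 0)"
      using vars_mult_mon[OF y(2)] by blast
    show ?thesis
    proof (cases "is_partition \<beta>")
      case True
      then show ?thesis unfolding \<beta>(1)
        using key_positive_op_perm nonneg_combination_base key_poly_partition by metis
    next
      case False
      then obtain i where i: "lookup \<beta> i < lookup \<beta> (Suc i)"
        by (auto simp: is_partition_Suc not_le)
      moreover have "lookup \<mu> (Suc i) \<le> lookup \<mu> i" using \<mu> is_partition_Suc by blast
      \<comment> \<open>Exponents grow by at most one, so the order fails only by one and only at a
        gap of \<open>U\<close>. There \<open>demazure i\<close> kills the monomial, and the descent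
        of \<open>y\<close> at the gap lets \<open>op_perm demazure y\<close> apply
        \<open>demazure i\<close> first.\<close>
      ultimately have U: "i \<notin> U" "Suc i \<in> U" "lookup \<beta> (Suc i) = Suc (lookup \<beta> i)"
        by (auto simp: \<beta>(2) split: if_splits)
      then have "demazure i (mon \<beta>) = 0" using demazure_single(1)[of \<beta> i 1] by (simp add: mon_def)
      moreover have "y (Suc i) < y i" using that U by (auto simp: straightened_def)
      ultimately show ?thesis unfolding \<beta>(1)
        by (simp add: op_perm_right_down[OF braid_family_demazure y(1)] op_perm_0)
    qed
  qed
  then show "key_positive (vars {..<k} * key_poly \<alpha>)"
    unfolding L(2) using L(1) by (intro nonneg_combination_sum_list) auto
qed (simp_all add: distrib_left)

section \<open>Schubert polynomials\<close>

lemma foldr_ddiff_0 [simp]: "foldr ddiff is 0 = 0"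
  by (induction "is") auto

lemma foldr_ddiff_diff: "foldr ddiff is (f - g) = foldr ddiff is f - foldr ddiff is g"
  by (induction "is") (auto simp: ddiff_diff)

lemma foldr_ddiff_sum: "foldr ddiff is (\<Sum>a\<in>A. f a) = (\<Sum>a\<in>A. foldr ddiff is (f a))"
  by (induction "is") (auto simp: ddiff_sum)

text \<open>The nilCoxeter relation: appending a letter at a descent squares a divided difference.
  So a nonzero value proves that the word is reduced.\<close>

lemma foldr_ddiff_word:
  "foldr ddiff is f = (if reduced_word (word_perm is) is then op_perm ddiff (word_perm is) f else 0)"
proof (induction "is")
  case Nil
  have "reduced_word id []" by (simp add: reduced_word_def)
  moreover have "foldr ddiff [] f = f" by simp
  ultimately show ?case by (simp only: word_perm_Nil op_perm_id if_True)
next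
  case (Cons i "is")
  define v where "v = word_perm is"
  have v: "v \<in> S_inf" "word_perm (i # is) = simple_refl i \<circ> v" by (simp_all add: v_def)
  have fold: "foldr ddiff (i # is) f = ddiff i (foldr ddiff is f)" by simp
  show ?case
  proof (cases "reduced_word v is")
    case False
    then have "\<not> reduced_word (simple_refl i \<circ> v) (i # is)"
      using reduced_word_ConsD(2)[of "simple_refl i \<circ> v" i "is"] by auto
    then show ?thesis using False Cons.IH unfolding fold v(2) v_def[symmetric]
      by (simp only: if_False ddiff_0)
  next
    case True
    show ?thesis
    proof (cases rule: bij_step_cases[OF S_inf_bij[OF S_inf_inv[OF v(1)]], of i])
      case 1
      show ?thesis using reduced_word_Cons[OF True 1] True Cons.IH
        unfolding fold v(2) v_def[symmetric] op_perm_left[OF braid_family_ddiff v(1) 1]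
        by (simp only: if_True)
    next
      case 2
      have "\<not> reduced_word (simple_refl i \<circ> v) (i # is)"
        using reduced_word_ConsD(1)[of "simple_refl i \<circ> v" i "is"] 2 by (auto simp: inv_left v(1))
      then show ?thesis using True Cons.IH
        unfolding fold v(2) v_def[symmetric] op_perm_left_down[OF braid_family_ddiff v(1) 2]
        by (simp only: if_False if_True ddiff_ddiff)
    qed
  qed
qed

section \<open>Degrees and staircase bounds\<close>

definition wdeg :: "wcomp \<Rightarrow> nat" where
  "wdeg \<alpha> = (\<Sum>i\<in>keys \<alpha>. lookup \<alpha> i)"

definition homogeneous :: "nat \<Rightarrow> ipoly \<Rightarrow> bool" where
  "homogeneous d f \<longleftrightarrow> (\<forall>\<alpha>\<in>keys f. wdeg \<alpha> = d)"

text \<open>The bounds are the exponents of \<open>stair n\<close>. They confine attention to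
  permutations of \<open>{..<n}\<close>, since divided differences beyond \<open>n\<close> vanish on
  such polynomials.\<close>

definition stair_bounded :: "nat \<Rightarrow> ipoly \<Rightarrow> bool" where
  "stair_bounded n f \<longleftrightarrow> (\<forall>\<alpha>\<in>keys f. \<forall>i. lookup \<alpha> i \<le> n - Suc i)"

lemma wdeg_update2: "\<exists>R. \<forall>p q. wdeg (update2 i p q \<alpha>) = p + q + R"
proof -
  obtain R where "\<And>p q. (\<Sum>j\<in>keys (update2 i p q \<alpha>). lookup (update2 i p q \<alpha>) j)
      = p + q + R"
    using sum_keys_split[where h = "\<lambda>_ k. k" and i = i and \<alpha> = \<alpha>] by auto
  then show ?thesis unfolding wdeg_def by blast
qed

lemma homogeneous_ddiff_Suc:
  assumes "homogeneous d f" "\<beta> \<in> keys (ddiff i f)"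
  shows "Suc (wdeg \<beta>) = d"
proof -
  obtain \<alpha> p q where \<alpha>: "\<alpha> \<in> keys f" "\<beta> = update2 i p q \<alpha>"
      "Suc (p + q) = lookup \<alpha> i + lookup \<alpha> (Suc i)"
    by (rule keys_ddiff[OF assms(2)])
  obtain R where R: "\<forall>p q. wdeg (update2 i p q \<alpha>) = p + q + R" using wdeg_update2 ..
  have "wdeg \<alpha> = lookup \<alpha> i + lookup \<alpha> (Suc i) + R"
    using R update2_self[of i \<alpha>] by metis
  moreover have "wdeg \<alpha> = d" using assms(1) \<alpha>(1) by (auto simp: homogeneous_def)
  ultimately show ?thesis using R \<alpha>(2,3) by simp
qed

lemma homogeneous_ddiff: "homogeneous (Suc d) f \<Longrightarrow> homogeneous d (ddiff i f)"
  using homogeneous_ddiff_Suc unfolding homogeneous_def by blast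

lemma homogeneous_foldr_ddiff:
  assumes "homogeneous d f"
  shows "foldr ddiff is f = 0 \<or> length is \<le> d \<and> homogeneous (d - length is) (foldr ddiff is f)"
proof (induction "is")
  case (Cons i "is")
  let ?g = "foldr ddiff is f"
  show ?case
  proof (cases "ddiff i ?g = 0")
    case False
    then have "?g \<noteq> 0" by auto
    then have IH: "length is \<le> d" "homogeneous (d - length is) ?g" using Cons by auto
    obtain \<beta> where "\<beta> \<in> keys (ddiff i ?g)" using False by fastforce
    then have "Suc (wdeg \<beta>) = d - length is" using homogeneous_ddiff_Suc IH(2) by blast
    then have "d - length is = Suc (d - Suc (length is))" "Suc (length is) \<le> d" by simp_all
    then show ?thesis using homogeneous_ddiff IH(2) by simp
  qed simp
qed (use assms in simp)

lemma homogeneous_0 [simp]: "homogeneous d 0"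
  by (simp add: homogeneous_def)

lemma homogeneous_1_iff: "homogeneous d 1 \<longleftrightarrow> d = 0"
  by (auto simp: homogeneous_def wdeg_def)

lemma homogeneous_add: "homogeneous d f \<Longrightarrow> homogeneous d g \<Longrightarrow> homogeneous d (f + g)"
  unfolding homogeneous_def using keys_add[of f g] by blast

lemma homogeneous_diff: "homogeneous d f \<Longrightarrow> homogeneous d g \<Longrightarrow> homogeneous d (f - g)"
  using homogeneous_add[of d f "- g"] by (simp add: homogeneous_def)

lemma homogeneous_sum: "(\<And>a. a \<in> A \<Longrightarrow> homogeneous d (f a)) \<Longrightarrow> homogeneous d (\<Sum>a\<in>A. f a)"
  by (induction A rule: infinite_finite_induct) (auto intro: homogeneous_add)

text \<open>Both new exponents lie strictly below the larger old one, which is at most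
  \<open>n - Suc i\<close>; the strictness gives the sharper bound wanted at
  \<open>Suc i\<close>.\<close>

lemma stair_bounded_ddiff:
  assumes "stair_bounded n f"
  shows "stair_bounded n (ddiff i f)"
  unfolding stair_bounded_def
proof (intro ballI allI)
  fix \<beta> j assume "\<beta> \<in> keys (ddiff i f)"
  then obtain \<alpha> p q where \<alpha>: "\<alpha> \<in> keys f" "\<beta> = update2 i p q \<alpha>"
      "max p q < max (lookup \<alpha> i) (lookup \<alpha> (Suc i))"
    by (rule keys_ddiff)
  then have a: "lookup \<alpha> k \<le> n - Suc k" for k using assms by (auto simp: stair_bounded_def)
  show "lookup \<beta> j \<le> n - Suc j"
    using \<alpha>(2,3) a[of i] a[of "Suc i"] a[of j] by (auto simp: lookup_update2)
qed

lemma stair_bounded_ddiff_0: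
  assumes "stair_bounded n f" "n \<le> Suc i"
  shows "ddiff i f = 0"
proof (rule ccontr)
  assume "ddiff i f \<noteq> 0"
  then obtain \<beta> where "\<beta> \<in> keys (ddiff i f)" by fastforce
  then obtain \<alpha> p q where \<alpha>: "\<alpha> \<in> keys f" "\<beta> = update2 i p q \<alpha>"
      "max p q < max (lookup \<alpha> i) (lookup \<alpha> (Suc i))"
    by (rule keys_ddiff)
  then have "lookup \<alpha> k \<le> n - Suc k" for k using assms by (auto simp: stair_bounded_def)
  from this[of i] this[of "Suc i"] show False using \<alpha>(3) assms(2) by simp
qed

lemma stair_bounded_foldr_ddiff: "stair_bounded n f \<Longrightarrow> stair_bounded n (foldr ddiff is f)"
  by (induction "is") (auto intro: stair_bounded_ddiff)

lemma stair_bounded_foldr_0: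
  assumes "stair_bounded n f" "i \<in> set is" "n \<le> Suc i"
  shows "foldr ddiff is f = 0"
  using assms(2)
proof (induction "is")
  case (Cons j "is")
  then show ?case
    using stair_bounded_ddiff_0[OF stair_bounded_foldr_ddiff[OF assms(1)] assms(3)] by (cases "j = i") auto
qed simp

lemma lookup_swap_vars:
  "lookup (swap_vars i f) \<beta> = lookup f (perm_comp (simple_refl i) \<beta>)"
proof -
  have "inj (perm_comp (simple_refl i))" by (rule inj_perm_comp[OF bij_simple_refl])
  then show ?thesis by (simp add: perm_poly_def inv_simple_refl Poly_Mapping.map_key.rep_eq)
qed

text \<open>A polynomial invariant under all adjacent transpositions of infinitely many variables is constant,
  so divided differences detect nonzero homogeneous polynomials.\<close>

lemma homogeneous_eq_0:
  assumes "homogeneous d f" "\<And>is. length is = d \<Longrightarrow> foldr ddiff is f = 0"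
  shows "f = 0"
  using assms
proof (induction d arbitrary: f)
  case 0
  from 0(2)[of "[]"] show ?case by simp
next
  case (Suc d)
  have sym: "swap_vars i f = f" for i
  proof -
    have "ddiff i f = 0"
    proof (rule Suc.IH[OF homogeneous_ddiff[OF Suc.prems(1)]])
      fix "is" :: "nat list" assume "length is = d"
      then show "foldr ddiff is (ddiff i f) = 0" using Suc.prems(2)[of "is @ [i]"] by simp
    qed
    then show ?thesis by (simp add: ddiff_eq_0)
  qed
  show ?case
  proof (rule ccontr)
    assume "f \<noteq> 0"
    then obtain \<alpha> where \<alpha>: "\<alpha> \<in> keys f" by fastforce
    then have "wdeg \<alpha> = Suc d" using Suc.prems(1) by (auto simp: homogeneous_def)
    then have ne: "keys \<alpha> \<noteq> {}" by (auto simp: wdeg_def)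
    let ?U = "\<Union>\<alpha>\<in>keys f. keys \<alpha>"
    define m where "m = Max ?U"
    have fin: "finite ?U" by simp
    have "m \<in> ?U" unfolding m_def using \<alpha> ne by (intro Max_in fin) blast
    then obtain \<beta> where \<beta>: "\<beta> \<in> keys f" "m \<in> keys \<beta>" by blast
    let ?\<gamma> = "perm_comp (simple_refl m) \<beta>"
    have "lookup f ?\<gamma> = lookup f \<beta>"
      using lookup_swap_vars[of m f ?\<gamma>] sym by simp
    then have "?\<gamma> \<in> keys f" using \<beta>(1) by (simp add: in_keys_iff)
    moreover have "Suc m \<in> keys ?\<gamma>" using \<beta>(2) by (simp add: in_keys_iff)
    ultimately have "Suc m \<in> ?U" by blast
    then have "Suc m \<le> m" unfolding m_def by (intro Max_ge fin)
    then show False by simp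
  qed
qed

section \<open>Schubert polynomials as divided differences of a staircase monomial\<close>

definition rev_perm :: "nat \<Rightarrow> nat \<Rightarrow> nat" where
  "rev_perm n i = (if i < n then n - Suc i else i)"

definition stair :: "nat \<Rightarrow> ipoly" where
  "stair n = (\<Prod>p<n. vars {..<p})"

text \<open>The definition of Lascoux and Schuetzenberger from the longest permutation of
  \<open>{..<n}\<close>, with \<open>n\<close> kept as a parameter.\<close>

definition schubert :: "nat \<Rightarrow> (nat \<Rightarrow> nat) \<Rightarrow> ipoly" where
  "schubert n w = op_perm ddiff (inv w \<circ> rev_perm n) (stair n)"

lemma rev_perm_rev_perm: "rev_perm n \<circ> rev_perm n = id"
  by (auto simp: fun_eq_iff rev_perm_def)

lemma rev_perm_permutes: "rev_perm n permutes {..<n}"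
  unfolding permutes_def
proof (intro conjI allI impI)
  fix y show "\<exists>!x. rev_perm n x = y"
    using rev_perm_rev_perm[of n] by (metis comp_apply id_apply)
qed (simp add: rev_perm_def)

lemma inv_rev_perm: "inv (rev_perm n) = rev_perm n"
  using rev_perm_rev_perm by (simp add: inv_unique_comp)

lemma permutes_right_simple_refl:
  assumes "w permutes {..<n}" "Suc i < n"
  shows "w \<circ> simple_refl i permutes {..<n}"
  using assms unfolding simple_refl_def by (intro permutes_compose permutes_swap_id) auto

lemma permutes_less_beyond:
  assumes "w permutes {..<n}" "n \<le> Suc i"
  shows "w i < w (Suc i)"
proof -
  have "w (Suc i) = Suc i" using assms by (intro permutes_not_in[OF assms(1)]) simp
  moreover have "w i < Suc i"
  proof (cases "i < n")
    case True
    then have "w i < n" using permutes_in_image[OF assms(1), of i] by simp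
    then show ?thesis using assms(2) by simp
  next
    case False
    then show ?thesis using permutes_not_in[OF assms(1), of i] by simp
  qed
  ultimately show ?thesis by simp
qed

lemma stair_mon: "\<exists>\<alpha>. stair n = mon \<alpha> \<and> (\<forall>i. lookup \<alpha> i = n - Suc i)"
proof (induction n)
  case 0
  show ?case by (intro exI[of _ 0]) (simp add: stair_def mon_def)
next
  case (Suc n)
  then obtain \<alpha> where \<alpha>: "stair n = mon \<alpha>" "\<forall>i. lookup \<alpha> i = n - Suc i" by blast
  obtain \<beta> where \<beta>: "vars {..<n} * mon \<alpha> = mon \<beta>"
    "\<forall>i. lookup \<beta> i = lookup \<alpha> i + (if i \<in> {..<n} then 1 else 0)"
    using vars_mult_mon[of "{..<n}" \<alpha>] by auto
  have "stair (Suc n) = mon \<beta>" using \<alpha>(1) \<beta>(1) by (simp add: stair_def mult.commute)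
  then show ?case using \<alpha>(2) \<beta>(2) by (intro exI[of _ \<beta>]) auto
qed

lemma schubert_rev_perm: "schubert n (rev_perm n) = stair n"
  by (simp only: schubert_def inv_rev_perm rev_perm_rev_perm op_perm_id)

lemma rev_perm_less: "i < n \<Longrightarrow> j < n \<Longrightarrow> rev_perm n i < rev_perm n j \<longleftrightarrow> j < i"
  by (auto simp: rev_perm_def)

lemma schubert_perm:
  assumes "w permutes {..<n}"
  shows "inv w \<circ> rev_perm n \<in> S_inf" "inv (inv w \<circ> rev_perm n) = rev_perm n \<circ> w"
proof -
  have "inv w \<circ> rev_perm n permutes {..<n}"
    by (intro permutes_compose rev_perm_permutes permutes_inv assms)
  then show "inv w \<circ> rev_perm n \<in> S_inf" by (rule permutes_S_inf)
  have "inv (inv w \<circ> rev_perm n) = inv (rev_perm n) \<circ> inv (inv w)"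
    by (intro o_inv_distrib permutes_bij[OF permutes_inv[OF assms]] permutes_bij[OF rev_perm_permutes])
  then show "inv (inv w \<circ> rev_perm n) = rev_perm n \<circ> w"
    by (simp only: inv_rev_perm inv_inv_eq[OF permutes_bij[OF assms]])
qed

lemma permutes_Suc_less:
  assumes "w permutes {..<n}" "w (Suc i) < w i"
  shows "Suc i < n" "w i < n" "w (Suc i) < n"
proof -
  show "Suc i < n" using permutes_less_beyond[OF assms(1), of i] assms(2) by linarith
  then show "w i < n" "w (Suc i) < n"
    using permutes_in_image[OF assms(1), of i] permutes_in_image[OF assms(1), of "Suc i"] by simp_all
qed

lemma stair_bounded_schubert: "stair_bounded n (schubert n w)"
proof -
  obtain \<alpha> where "stair n = mon \<alpha>" "\<forall>i. lookup \<alpha> i = n - Suc i" using stair_mon by blast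
  then have "stair_bounded n (stair n)" by (simp add: stair_bounded_def mon_def)
  then show ?thesis unfolding schubert_def op_perm_def by (rule stair_bounded_foldr_ddiff)
qed

lemma ddiff_schubert:
  assumes "w permutes {..<n}"
  shows "w (Suc i) < w i \<Longrightarrow> ddiff i (schubert n w) = schubert n (w \<circ> simple_refl i)"
    "w i < w (Suc i) \<Longrightarrow> ddiff i (schubert n w) = 0"
proof -
  note v = schubert_perm[OF assms]
  assume d: "w (Suc i) < w i"
  note lt = permutes_Suc_less[OF assms d]
  have "inv (w \<circ> simple_refl i) \<circ> rev_perm n = simple_refl i \<circ> (inv w \<circ> rev_perm n)"
    using inv_right[OF permutes_S_inf[OF assms], of i] by (simp only: comp_assoc)
  then have "schubert n (w \<circ> simple_refl i) = op_perm ddiff (simple_refl i \<circ> (inv w \<circ> rev_perm n)) (stair n)"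
    by (simp only: schubert_def)
  also have "\<dots> = ddiff i (schubert n w)"
    unfolding schubert_def using lt d by (intro op_perm_left[OF braid_family_ddiff v(1)]) (simp add: v(2) rev_perm_less)
  finally show "ddiff i (schubert n w) = schubert n (w \<circ> simple_refl i)" by simp
next
  note v = schubert_perm[OF assms]
  assume a: "w i < w (Suc i)"
  show "ddiff i (schubert n w) = 0"
  proof (cases "Suc i < n")
    case True
    then have "w i < n" "w (Suc i) < n"
      using permutes_in_image[OF assms, of i] permutes_in_image[OF assms, of "Suc i"] by simp_all
    \<comment> \<open>The reversal turns the ascent of \<open>w\<close> into a left descent, so the
      Schubert polynomial is already a value of \<open>ddiff i\<close>, which squares to
      zero.\<close>
    then have "schubert n w = ddiff i (op_perm ddiff (simple_refl i \<circ> (inv w \<circ> rev_perm n)) (stair n))"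
      unfolding schubert_def using a
      by (intro op_perm_left_down[OF braid_family_ddiff v(1)]) (simp add: v(2) rev_perm_less)
    then show ?thesis by simp
  next
    case False
    then show ?thesis using stair_bounded_ddiff_0[OF stair_bounded_schubert] by simp
  qed
qed

lemma word_perm_upt:
  "word_perm [0..<n] x = (if x < n then Suc x else if x = n then 0 else x)"
proof (induction n arbitrary: x)
  case (Suc n)
  have "word_perm [0..<Suc n] = word_perm [0..<n] \<circ> word_perm [n]"
    by (simp only: upt_Suc_append word_perm_append le0)
  then have "word_perm [0..<Suc n] x = word_perm [0..<n] (simple_refl n x)" by simp
  then show ?case by (simp add: Suc.IH simple_refl_eq)
qed simp

fun rev_word :: "nat \<Rightarrow> nat list" where
  "rev_word 0 = []"
| "rev_word (Suc n) = [0..<n] @ rev_word n"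

lemma word_perm_rev_word: "word_perm (rev_word n) = rev_perm n"
proof (induction n)
  case 0
  show ?case by (auto simp: rev_perm_def)
next
  case (Suc n)
  show ?case
  proof
    fix x
    have "word_perm (rev_word (Suc n)) x = word_perm [0..<n] (rev_perm n x)"
      by (simp add: word_perm_append Suc.IH)
    then show "word_perm (rev_word (Suc n)) x = rev_perm (Suc n) x"
      by (auto simp: word_perm_upt rev_perm_def)
  qed
qed

lemma vars_lessThan_Suc: "vars {..<Suc k} = var k * vars {..<k}"
  by (simp add: vars_def mult.commute)

lemma foldr_ddiff_upt: "foldr ddiff [0..<n] (vars {..<n}) = 1"
proof (induction n)
  case (Suc n)
  have "swap_vars n (vars {..<n}) = vars {..<n}" by (rule swap_vars_vars) simp
  then have "ddiff n (vars {..<Suc n}) = vars {..<n}"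
    using ddiff_sym_mult[of n "vars {..<n}" "var n"] by (simp add: vars_lessThan_Suc mult.commute ddiff_var)
  then show ?case using Suc by simp
qed (simp add: vars_def)

text \<open>The letters of \<open>rev_word n\<close> leave \<open>vars {..<n}\<close> symmetric, so
  this inner word consumes \<open>stair n\<close> alone; the prefix \<open>[0..<n]\<close> then
  consumes the remaining factor.\<close>

lemma foldr_ddiff_rev_word: "foldr ddiff (rev_word n) (stair n) = 1"
proof (induction n)
  case 0
  then show ?case by (simp add: stair_def)
next
  case (Suc n)
  have letters: "Suc i < n" if "i \<in> set (rev_word n)" for i n
    using that by (induction n) (auto simp: less_Suc_eq)
  have "foldr ddiff is (vars {..<n} * f) = vars {..<n} * foldr ddiff is f" if "set is \<subseteq> set (rev_word n)" for "is" f
    using that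
  proof (induction "is")
    case (Cons i "is")
    then have "swap_vars i (vars {..<n}) = vars {..<n}"
      using letters[of i n] by (intro swap_vars_vars) auto
    then show ?case using Cons by (simp add: ddiff_sym_mult)
  qed simp
  then have "foldr ddiff (rev_word n) (vars {..<n} * stair n) = vars {..<n}"
    using Suc by (metis mult.right_neutral order_refl)
  then have "foldr ddiff (rev_word n) (stair (Suc n)) = vars {..<n}"
    by (simp add: stair_def mult.commute)
  then show ?case by (simp add: foldr_ddiff_upt)
qed

lemma schubert_id: "schubert n id = 1"
proof -
  \<comment> \<open>The value 1 excludes the zero branch of \<open>foldr_ddiff_word\<close>, so the
    word is reduced without a count of its letters.\<close>
  have "op_perm ddiff (rev_perm n) (stair n) = 1"
    using foldr_ddiff_word[of "rev_word n" "stair n"]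
    by (simp add: word_perm_rev_word foldr_ddiff_rev_word split: if_splits)
  then show ?thesis by (simp only: schubert_def inv_id id_comp)
qed

text \<open>Orthogonality, by peeling off the letter applied first. A descent of \<open>w\<close>
  passes to a shorter permutation; at an ascent the polynomial dies, and no word of this length
  ending in that letter represents \<open>w\<close>.\<close>

lemma foldr_ddiff_schubert:
  assumes "w permutes {..<n}" "length is = perm_length w"
  shows "foldr ddiff is (schubert n w) = (if word_perm is = w then 1 else 0)"
  using assms
proof (induction "is" arbitrary: w rule: rev_induct)
  case Nil
  then have "w = id" using perm_length_0[OF permutes_S_inf[OF Nil(1)]] by simp
  moreover have "foldr ddiff [] (schubert n w) = schubert n w" by simp
  ultimately show ?case using schubert_id by (simp only: word_perm_Nil if_True simp_thms)
next
  case (snoc i "is")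
  have w: "w \<in> S_inf" using snoc.prems(1) by (rule permutes_S_inf)
  have wp: "word_perm (is @ [i]) = word_perm is \<circ> simple_refl i" by (simp add: word_perm_append)
  have iff: "word_perm (is @ [i]) = w \<longleftrightarrow> word_perm is = w \<circ> simple_refl i"
    unfolding wp by (metis simple_refl_comp_cancel(2))
  have fold: "foldr ddiff (is @ [i]) (schubert n w) = foldr ddiff is (ddiff i (schubert n w))" by simp
  show ?case
  proof (cases rule: bij_step_cases[OF S_inf_bij[OF w], of i])
    case 1
    have "word_perm is \<noteq> w \<circ> simple_refl i"
    proof
      assume eq: "word_perm is = w \<circ> simple_refl i"
      show False
        using perm_length_word_perm[of "is"] perm_length_right(1)[OF w 1] snoc.prems(2) unfolding eq by simp
    qed
    then show ?thesis unfolding fold iff using ddiff_schubert(2)[OF snoc.prems(1) 1] by simp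
  next
    case 2
    have "length is = perm_length (w \<circ> simple_refl i)"
      using perm_length_right(2)[OF w 2] snoc.prems(2) by simp
    then show ?thesis unfolding fold iff ddiff_schubert(1)[OF snoc.prems(1) 2]
      using snoc.IH permutes_right_simple_refl[OF snoc.prems(1)] permutes_Suc_less(1)[OF snoc.prems(1) 2] by blast
  qed
qed

text \<open>Homogeneity of some degree is inherited from the staircase monomial; the degree itself
  is read off from a reduced word of \<open>w\<close>, which takes the polynomial to 1.\<close>

lemma homogeneous_schubert:
  assumes "w permutes {..<n}"
  shows "homogeneous (perm_length w) (schubert n w)"
proof -
  obtain \<alpha> where "stair n = mon \<alpha>" using stair_mon by blast
  then have st: "homogeneous (wdeg \<alpha>) (stair n)" by (simp add: homogeneous_def mon_def)
  have "\<exists>d. homogeneous d (schubert n w)"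
    unfolding schubert_def op_perm_def using homogeneous_foldr_ddiff[OF st] homogeneous_0 by metis
  then obtain d where d: "homogeneous d (schubert n w)" ..
  obtain "is" where "is": "reduced_word w is" using permutes_S_inf[OF assms] reduced_word_exists by blast
  then have "foldr ddiff is (schubert n w) = 1" "length is = perm_length w"
    using foldr_ddiff_schubert[OF assms] by (auto simp: reduced_word_def)
  then show ?thesis using homogeneous_foldr_ddiff[OF d, of "is"] d by (auto simp: homogeneous_1_iff)
qed

lemma word_perm_permutes:
  "\<forall>i\<in>set is. Suc i < n \<Longrightarrow> word_perm is permutes {..<n}"
proof (induction "is")
  case (Cons i "is")
  have "simple_refl i permutes {..<n}"
    using Cons.prems unfolding simple_refl_def by (intro permutes_swap_id) auto
  moreover have "word_perm is permutes {..<n}" using Cons by simp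
  ultimately show ?case unfolding word_perm_Cons by (intro permutes_compose)
qed (simp only: word_perm_Nil permutes_id)

text \<open>By orthogonality both sides take the same value under every word of length
  \<open>d\<close>, and such words separate homogeneous polynomials of degree
  \<open>d\<close>.\<close>

theorem schubert_expansion:
  assumes "stair_bounded n f" "homogeneous d f"
    "\<And>w. w permutes {..<n} \<Longrightarrow> perm_length w = d \<Longrightarrow> op_perm ddiff w f \<in> {0, 1}"
  shows "f = (\<Sum>w | w permutes {..<n} \<and> perm_length w = d \<and> op_perm ddiff w f = 1. schubert n w)"
proof -
  define A where "A = {w. w permutes {..<n} \<and> perm_length w = d \<and> op_perm ddiff w f = 1}"
  have fin: "finite A" unfolding A_def by (rule finite_subset[OF _ finite_permutations[of "{..<n}"]]) auto
  have "f - (\<Sum>w\<in>A. schubert n w) = 0"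
  proof (rule homogeneous_eq_0)
    show "homogeneous d (f - (\<Sum>w\<in>A. schubert n w))"
      using homogeneous_schubert by (intro homogeneous_diff assms(2) homogeneous_sum) (auto simp: A_def)
    fix "is" :: "nat list" assume len: "length is = d"
    define v where "v = word_perm is"
    have "foldr ddiff is (\<Sum>w\<in>A. schubert n w) = (\<Sum>w\<in>A. if w = v then 1 else 0)"
      unfolding foldr_ddiff_sum using foldr_ddiff_schubert[of _ n "is"] len
      by (intro sum.cong) (auto simp: A_def v_def)
    then have S: "foldr ddiff is (\<Sum>w\<in>A. schubert n w) = (if v \<in> A then 1 else 0)"
      using fin by (simp add: sum.delta)
    have "foldr ddiff is f = (if v \<in> A then 1 else 0)"
    proof (cases "reduced_word v is")
      case False
      then have "v \<notin> A" using len by (auto simp: A_def reduced_word_def v_def)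
      then show ?thesis using foldr_ddiff_word[of "is" f] False by (simp add: v_def)
    next
      case True
      then have eq: "foldr ddiff is f = op_perm ddiff v f" using foldr_ddiff_word[of "is" f] by (simp add: v_def)
      have pl: "perm_length v = d" using True len by (simp add: reduced_word_def)
      show ?thesis
      proof (cases "v permutes {..<n}")
        case True
        then show ?thesis using assms(3)[OF True pl] pl eq by (auto simp: A_def)
      next
        case False
        \<comment> \<open>A word whose product moves something outside \<open>{..<n}\<close>
          contains a letter that kills staircase-bounded polynomials.\<close>
        then obtain i where "i \<in> set is" "n \<le> Suc i" using word_perm_permutes[of "is" n] v_def by (metis not_le)
        then have "foldr ddiff is f = 0" using stair_bounded_foldr_0[OF assms(1)] by blast
        then show ?thesis using False by (simp add: A_def)
      qed
    qed
    then show "foldr ddiff is (f - (\<Sum>w\<in>A. schubert n w)) = 0" by (simp add: foldr_ddiff_diff S)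
  qed
  then show ?thesis by (simp add: A_def)
qed

section \<open>Key positivity of Schubert polynomials\<close>

lemma key_positive_vars_power_mult:
  "key_positive f \<Longrightarrow> key_positive (vars {..<k} ^ e * f)"
proof (induction e)
  case (Suc e)
  then show ?case using key_positive_vars_mult[of "vars {..<k} ^ e * f" k] by (simp add: mult.assoc)
qed simp

definition rothe_column :: "(nat \<Rightarrow> nat) \<Rightarrow> nat \<Rightarrow> nat set" where
  "rothe_column w j = {i. i < inv w j \<and> j < w i}"

text \<open>Only columns that are initial segments give dominant monomials. The others get weight 1
  and stay in the remaining factor of the orthodontia.\<close>

definition column_weight :: "(nat \<Rightarrow> nat) \<Rightarrow> nat \<Rightarrow> ipoly" where
  "column_weight w j = (if \<exists>p. rothe_column w j = {..<p} then vars (rothe_column w j) else 1)"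

lemma column_weight_interval: "rothe_column w j = {..<p} \<Longrightarrow> column_weight w j = vars {..<p}"
  by (auto simp: column_weight_def)

lemma key_positive_column_weight_mult:
  assumes "key_positive f"
  shows "key_positive ((\<Prod>j\<in>J. column_weight w j) * f)"
proof (induction J rule: infinite_finite_induct)
  case (insert j J)
  have "key_positive (column_weight w j * ((\<Prod>j\<in>J. column_weight w j) * f))"
    using insert key_positive_vars_mult by (auto simp: column_weight_def)
  then show ?case using insert by (simp add: mult.assoc)
qed (use assms in simp_all)

text \<open>At an ascent \<open>k\<close>, a column other than that of \<open>w k\<close> which
  contains row \<open>k\<close> also contains row \<open>Suc k\<close>, so an initial segment is
  symmetric in these rows. A column that becomes an initial segment after the swap contains
  \<open>k\<close> but not \<open>Suc k\<close>, hence is exactly \<open>{..<Suc k}\<close>.\<close>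

lemma rothe_column_swap:
  assumes "bij w" "j \<noteq> w k" "w k < w (Suc k)"
  shows "swap_vars k (column_weight w j) = column_weight w j"
    "\<exists>e. column_weight (w \<circ> simple_refl k) j = column_weight w j * vars {..<Suc k} ^ e"
proof -
  define p where "p = inv w j"
  have wp: "w p = j" using assms(1) by (simp add: p_def bij_is_surj surj_f_inv_f)
  have "inv (w \<circ> simple_refl k) = simple_refl k \<circ> inv w"
    by (simp only: o_inv_distrib assms(1) bij_simple_refl inv_simple_refl)
  then have p': "inv (w \<circ> simple_refl k) j = simple_refl k p" by (simp add: p_def)
  have col: "i \<in> rothe_column w j \<longleftrightarrow> i < p \<and> j < w i" for i by (simp add: rothe_column_def p_def)
  have col': "i \<in> rothe_column (w \<circ> simple_refl k) j \<longleftrightarrow> i < simple_refl k p \<and> j < w (simple_refl k i)" for i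
    by (simp add: rothe_column_def p')
  have pk: "p \<noteq> k" using wp assms(2) by auto
  show sym: "swap_vars k (column_weight w j) = column_weight w j"
  proof (cases "\<exists>q. rothe_column w j = {..<q}")
    case False
    then show ?thesis by (simp add: column_weight_def)
  next
    case True
    then obtain q where q: "rothe_column w j = {..<q}" by blast
    have "Suc k \<in> rothe_column w j" if "k \<in> rothe_column w j"
    proof -
      have "k < p" "j < w k" using that col by auto
      moreover then have "p \<noteq> Suc k" using wp assms(3) by auto
      ultimately show ?thesis using col assms(3) by auto
    qed
    then have "k \<in> {..<q} \<longleftrightarrow> Suc k \<in> {..<q}" unfolding q by auto
    then show ?thesis unfolding column_weight_interval[OF q] by (rule swap_vars_vars)
  qed
  show "\<exists>e. column_weight (w \<circ> simple_refl k) j = column_weight w j * vars {..<Suc k} ^ e"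
  proof (cases "rothe_column (w \<circ> simple_refl k) j = rothe_column w j")
    case True
    then have "column_weight (w \<circ> simple_refl k) j = column_weight w j" by (simp only: column_weight_def)
    then show ?thesis by (intro exI[of _ 0]) simp
  next
    case False
    have "p \<noteq> Suc k"
    proof
      assume p: "p = Suc k"
      then have "w k < j" using wp assms(3) by simp
      then have "rothe_column (w \<circ> simple_refl k) j = rothe_column w j"
        unfolding set_eq_iff col col' using p by (auto simp: simple_refl_eq less_Suc_eq)
      then show False using False by simp
    qed
    then have iff: "i \<in> rothe_column (w \<circ> simple_refl k) j \<longleftrightarrow> simple_refl k i \<in> rothe_column w j" for i
      unfolding col col' using pk by (auto simp: simple_refl_eq)
    have k: "k \<notin> rothe_column w j" "Suc k \<in> rothe_column w j"
    proof -
      have imp: "Suc k \<in> rothe_column w j" if "k \<in> rothe_column w j"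
        using that \<open>p \<noteq> Suc k\<close> assms(3) unfolding col by auto
      have "\<not> (k \<in> rothe_column w j \<longleftrightarrow> Suc k \<in> rothe_column w j)"
      proof
        assume eq: "k \<in> rothe_column w j \<longleftrightarrow> Suc k \<in> rothe_column w j"
        have "rothe_column (w \<circ> simple_refl k) j = rothe_column w j"
          unfolding set_eq_iff iff using eq by (auto simp: simple_refl_eq)
        then show False using False by simp
      qed
      then show "k \<notin> rothe_column w j" "Suc k \<in> rothe_column w j" using imp by blast+
    qed
    have w1: "column_weight w j = 1"
    proof -
      have "\<nexists>q. rothe_column w j = {..<q}"
      proof
        assume "\<exists>q. rothe_column w j = {..<q}"
        then obtain q where "rothe_column w j = {..<q}" by blast
        then show False using k by simp
      qed
      then show ?thesis by (simp add: column_weight_def)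
    qed
    have k': "k \<in> rothe_column (w \<circ> simple_refl k) j" "Suc k \<notin> rothe_column (w \<circ> simple_refl k) j"
      using k by (simp_all add: iff)
    show ?thesis
    proof (cases "\<exists>q. rothe_column (w \<circ> simple_refl k) j = {..<q}")
      case True
      then obtain q where q: "rothe_column (w \<circ> simple_refl k) j = {..<q}" by blast
      then have "k < q" "\<not> Suc k < q" using k' by simp_all
      then have "q = Suc k" by simp
      then show ?thesis using w1 column_weight_interval[OF q] by (intro exI[of _ 1]) (simp del: o_apply)
    next
      case False
      then have "column_weight (w \<circ> simple_refl k) j = 1" unfolding column_weight_def by (rule if_not_P)
      then show ?thesis using w1 by (intro exI[of _ 0]) (simp del: o_apply)
    qed
  qed
qed

lemma permutes_decreasing:
  assumes "w permutes {..<n}" "\<And>k. Suc k < n \<Longrightarrow> w (Suc k) < w k"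
  shows "w = rev_perm n"
proof -
  have "strict_mono (rev_perm n \<circ> w)"
    unfolding strict_mono_Suc_iff
  proof
    fix i
    have v: "rev_perm n \<circ> w permutes {..<n}" by (intro permutes_compose assms(1) rev_perm_permutes)
    show "(rev_perm n \<circ> w) i < (rev_perm n \<circ> w) (Suc i)"
    proof (cases "Suc i < n")
      case True
      then have "w i < n" "w (Suc i) < n"
        using permutes_in_image[OF assms(1), of i] permutes_in_image[OF assms(1), of "Suc i"] by simp_all
      then show ?thesis using assms(2)[OF True] by (simp add: rev_perm_less)
    next
      case False
      then show ?thesis using permutes_less_beyond[OF v, of i] by linarith
    qed
  qed
  moreover have "bij (rev_perm n \<circ> w)"
    by (intro bij_comp permutes_bij[OF assms(1)] permutes_bij[OF rev_perm_permutes])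
  ultimately have "rev_perm n \<circ> w = id" by (rule bij_strict_mono_id[rotated])
  then have "rev_perm n \<circ> (rev_perm n \<circ> w) = rev_perm n" by simp
  then show ?thesis by (simp only: comp_assoc[symmetric] rev_perm_rev_perm id_comp)
qed

lemma perm_length_bound:
  assumes "w permutes {..<n}"
  shows "perm_length w \<le> n * n"
proof -
  have "card (inversions w) \<le> card ({..<n} \<times> {..<n})" by (intro card_mono inversions_permutes assms) auto
  then show ?thesis by (simp add: perm_length_inversions permutes_S_inf[OF assms] card_cartesian_product)
qed

text \<open>Magyar's orthodontia. Columns of the Rothe diagram that are initial segments factor out;
  at the first ascent \<open>k\<close> the column of \<open>w k\<close> gains a cell, which turns \<open>ddiff k\<close> into \<open>demazure k\<close>.\<close>

lemma schubert_orthodontia: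
  assumes "w permutes {..<n}"
  shows "\<exists>R. key_positive R \<and> schubert n w = (\<Prod>j<n. column_weight w j) * R"
  using assms
proof (induction "n * n - perm_length w" arbitrary: w rule: less_induct)
  case less
  note w = less.prems
  have bij: "bij w" using w by (rule permutes_bij)
  show ?case
  proof (cases "\<exists>k. Suc k < n \<and> w k < w (Suc k)")
    case False
    have "w (Suc k) < w k" if "Suc k < n" for k
    proof (cases rule: bij_step_cases[OF bij, of k])
      case 1
      then show ?thesis using False that by blast
    qed
    then have w0: "w = rev_perm n" by (rule permutes_decreasing[OF w])
    \<comment> \<open>For the longest permutation every column is an initial segment, so the whole
      staircase factors out and the remaining factor is 1.\<close>
    have "column_weight w j = vars {..<n - Suc j}" if "j < n" for j
      unfolding w0 using that
      by (intro column_weight_interval) (auto simp: rothe_column_def inv_rev_perm, auto simp: rev_perm_def)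
    then have "(\<Prod>j<n. column_weight w j) = (\<Prod>j<n. vars {..<n - Suc j})" by simp
    also have "\<dots> = stair n" unfolding stair_def by (rule prod.nat_diff_reindex)
    finally have "schubert n w = (\<Prod>j<n. column_weight w j) * 1" using w0 schubert_rev_perm by simp
    moreover have "key_positive 1"
      using nonneg_combination_base[of key_poly 0] key_poly_partition[of 0] by (simp add: is_partition_def mon_def)
    ultimately show ?thesis by blast
  next
    case True
    define k where "k = (LEAST k. Suc k < n \<and> w k < w (Suc k))"
    have k: "Suc k < n" "w k < w (Suc k)" using LeastI_ex[OF True] by (simp_all add: k_def)
    have before: "w (Suc i) < w i" if "i < k" for i
    proof (cases rule: bij_step_cases[OF bij, of i])
      case 1
      have "\<not> (Suc i < n \<and> w i < w (Suc i))" using not_less_Least[of i] that unfolding k_def by blast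
      then show ?thesis using 1 that k(1) by simp
    qed
    \<comment> \<open>Before the first ascent the values fall, so every row above \<open>k\<close>
      has a value exceeding \<open>w k\<close>, and the column of \<open>w k\<close> is all of
      \<open>{..<k}\<close>.\<close>
    have "d \<le> k \<Longrightarrow> w k + d \<le> w (k - d)" for d
    proof (induction d)
      case (Suc d)
      then have "w (Suc (k - Suc d)) < w (k - Suc d)" by (intro before) simp
      then show ?case using Suc by (simp add: Suc_diff_Suc)
    qed simp
    note decr = this
    have dec: "w k < w i" if "i < k" for i
      using decr[of "k - i"] that by simp
    define w' where "w' = w \<circ> simple_refl k"
    have w': "w' permutes {..<n}" unfolding w'_def by (rule permutes_right_simple_refl[OF w k(1)])
    have len: "perm_length w' = Suc (perm_length w)"
      unfolding w'_def by (rule perm_length_right(1)[OF permutes_S_inf[OF w] k(2)])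
    then have "n * n - perm_length w' < n * n - perm_length w" using perm_length_bound[OF w'] by simp
    then obtain R where R: "key_positive R" "schubert n w' = (\<Prod>j<n. column_weight w' j) * R"
      using less.hyps w' by blast
    have desc: "w' (Suc k) < w' k" using k(2) by (simp add: w'_def)
    have ww: "w' \<circ> simple_refl k = w" by (simp only: w'_def simple_refl_comp_cancel)
    have sch: "schubert n w = ddiff k (schubert n w')"
      unfolding ddiff_schubert(1)[OF w' desc] ww ..
    let ?V = "vars {..<Suc k}" and ?J = "{..<n} - {w k}"
    have inv: "inv w (w k) = k" "inv w' (w k) = Suc k"
      using bij permutes_bij[OF w'] by (simp_all add: inv_equality bij_is_inj w'_def inv_f_eq)
    have "rothe_column w (w k) = {..<k}"
      unfolding rothe_column_def inv using dec by auto
    then have c1: "column_weight w (w k) = vars {..<k}" by (rule column_weight_interval)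
    have "w k < w' i" if "i < Suc k" for i
      using that dec k(2) by (cases "i = k") (auto simp: w'_def simple_refl_other)
    then have "rothe_column w' (w k) = {..<Suc k}"
      unfolding rothe_column_def inv by auto
    then have c2: "column_weight w' (w k) = ?V" by (rule column_weight_interval)
    have "\<forall>j\<in>?J. \<exists>e. column_weight w' j = column_weight w j * ?V ^ e"
      using rothe_column_swap(2)[OF bij _ k(2)] unfolding w'_def by blast
    then obtain e where e: "\<And>j. j \<in> ?J \<Longrightarrow> column_weight w' j = column_weight w j * ?V ^ e j" by metis
    define A where "A = (\<Prod>j\<in>?J. column_weight w j)"
    define c where "c = (\<Sum>j\<in>?J. e j)"
    have wk: "w k \<in> {..<n}" using permutes_in_image[OF w, of k] k(1) by simp
    have "(\<Prod>j<n. column_weight w' j) = column_weight w' (w k) * (\<Prod>j\<in>?J. column_weight w' j)"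
      by (rule prod.remove) (use wk in auto)
    also have "(\<Prod>j\<in>?J. column_weight w' j) = A * ?V ^ c"
      unfolding A_def c_def power_sum prod.distrib[symmetric] using e by (intro prod.cong) auto
    finally have P': "(\<Prod>j<n. column_weight w' j) = ?V * (A * ?V ^ c)" by (simp only: c2)
    have P: "(\<Prod>j<n. column_weight w j) = vars {..<k} * A"
      unfolding A_def c1[symmetric] by (rule prod.remove) (use wk in auto)
    have "swap_vars k A = A"
      unfolding A_def swap_vars_prod using rothe_column_swap(1)[OF bij _ k(2)] by (intro prod.cong) auto
    moreover have "swap_vars k (vars {..<k}) = vars {..<k}" by (rule swap_vars_vars) simp
    ultimately have symA: "swap_vars k (vars {..<k} * A) = vars {..<k} * A" by (simp add: swap_vars_mult)
    \<comment> \<open>The factors \<open>A\<close> and \<open>vars {..<k}\<close> are symmetric and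
      leave the operator. The powers of \<open>?V\<close> are not symmetric; they stay inside, where
      multiplication by them preserves key positivity.\<close>
    have "schubert n w = ddiff k ((vars {..<k} * A) * (var k * (?V ^ c * R)))"
      unfolding sch R(2) P' by (simp add: vars_lessThan_Suc mult_ac)
    also have "\<dots> = (\<Prod>j<n. column_weight w j) * demazure k (?V ^ c * R)"
      unfolding P demazure_ddiff ddiff_sym_mult[OF symA] ..
    finally show ?thesis
      using key_positive_demazure[OF key_positive_vars_power_mult[OF R(1)]] by blast
  qed
qed

theorem key_positive_schubert:
  assumes "w permutes {..<n}"
  shows "key_positive (schubert n w)"
  using schubert_orthodontia[OF assms] key_positive_column_weight_mult by metis

lemma key_positive_foldr_ddiff_schubert:
  assumes "w permutes {..<n}"
  shows "key_positive (foldr ddiff is (schubert n w))"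
proof -
  have "foldr ddiff is (schubert n w) = 0 \<or> (\<exists>v. v permutes {..<n} \<and> foldr ddiff is (schubert n w) = schubert n v)"
  proof (induction "is")
    case (Cons i "is")
    show ?case
    proof (cases "foldr ddiff is (schubert n w) = 0")
      case False
      then obtain v where v: "v permutes {..<n}" "foldr ddiff is (schubert n w) = schubert n v"
        using Cons by blast
      have fold: "foldr ddiff (i # is) (schubert n w) = ddiff i (schubert n v)" by (simp add: v(2))
      show ?thesis
      proof (cases rule: bij_step_cases[OF permutes_bij[OF v(1)], of i])
        case 1
        then show ?thesis unfolding fold using ddiff_schubert(2)[OF v(1)] by simp
      next
        case 2
        then show ?thesis unfolding fold ddiff_schubert(1)[OF v(1) 2]
          using permutes_right_simple_refl[OF v(1)] permutes_Suc_less(1)[OF v(1) 2] by blast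
      qed
    qed simp
  qed (use assms in auto)
  then show ?thesis using key_positive_schubert by auto
qed

section \<open>Divided differences of mirror-symmetric polynomials\<close>

definition perm_list :: "nat list \<Rightarrow> nat \<Rightarrow> nat" where
  "perm_list L x = (if x < length L then L ! x else x)"

lemma perm_list_swap:
  "perm_list (A @ [b, a] @ C) = perm_list (A @ [a, b] @ C) \<circ> simple_refl (length A)"
proof
  fix x
  consider "x < length A" | "x = length A" | "x = Suc (length A)" | "x > Suc (length A)" by linarith
  then show "perm_list (A @ [b, a] @ C) x = (perm_list (A @ [a, b] @ C) \<circ> simple_refl (length A)) x"
  proof cases
    case 4
    then have "x = Suc (Suc (length A + (x - Suc (Suc (length A)))))" by simp
    then obtain y where "x = Suc (Suc (length A + y))" ..
    then show ?thesis by (simp add: perm_list_def simple_refl_eq nth_append)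
  qed (simp_all add: perm_list_def simple_refl_eq nth_append)
qed

lemma perm_list_permutes:
  assumes "distinct L" "set L = {..<n}"
  shows "perm_list L permutes {..<n}"
proof -
  have len: "length L = n" using distinct_card[OF assms(1)] assms(2) by simp
  have "bij_betw ((!) L) {..<n} {..<n}" by (rule bij_betw_nth[OF assms(1)]) (simp_all add: len assms(2))
  then have "bij_betw (perm_list L) {..<n} {..<n}"
    by (subst bij_betw_cong[of _ _ "(!) L"]) (simp_all add: perm_list_def len)
  then show ?thesis by (rule bij_imp_permutes) (simp add: perm_list_def len)
qed

text \<open>Outermost pair first: exchanging two neighbouring pairs amounts to two commuting
  reflections in mirrored positions.\<close>

definition pair_word :: "(nat \<times> nat) list \<Rightarrow> nat list" where
  "pair_word ls = map fst ls @ rev (map snd ls)"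

definition pairs_valid :: "nat \<Rightarrow> (nat \<times> nat) list \<Rightarrow> bool" where
  "pairs_valid n ls \<longleftrightarrow> distinct (pair_word ls) \<and> set (pair_word ls) = {..<n}"

definition pair_ddiff :: "ipoly \<Rightarrow> (nat \<times> nat) list \<Rightarrow> ipoly" where
  "pair_ddiff f ls = op_perm ddiff (perm_list (pair_word ls)) f"

lemma set_pair_word: "set (pair_word ls) = fst ` set ls \<union> snd ` set ls"
  by (simp add: pair_word_def)

lemma pairs_valid_mset:
  assumes "mset ls = mset ls'"
  shows "pairs_valid n ls \<longleftrightarrow> pairs_valid n ls'"
proof -
  have "mset (pair_word ls) = mset (pair_word ls')" using assms by (simp add: pair_word_def)
  then show ?thesis unfolding pairs_valid_def by (metis mset_eq_imp_distinct_iff mset_eq_setD)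
qed

lemma pairs_valid_length: "pairs_valid n ls \<Longrightarrow> n = 2 * length ls"
  using distinct_card[of "pair_word ls"] by (simp add: pairs_valid_def pair_word_def)

lemma pairs_valid_permutes: "pairs_valid n ls \<Longrightarrow> perm_list (pair_word ls) permutes {..<n}"
  using perm_list_permutes by (simp add: pairs_valid_def)

text \<open>For increasing pairs, read as intervals with distinct endpoints, comparability excludes
  nesting, and separation means disjointness.\<close>

definition comparable :: "nat \<times> nat \<Rightarrow> nat \<times> nat \<Rightarrow> bool" where
  "comparable p q \<longleftrightarrow> fst p < fst q \<and> snd p < snd q \<or> fst q < fst p \<and> snd q < snd p"

definition separated :: "nat \<times> nat \<Rightarrow> nat \<times> nat \<Rightarrow> bool" where
  "separated p q \<longleftrightarrow> snd p < fst q \<or> snd q < fst p"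

text \<open>Since \<open>flat\<close> is injective, \<open>flat S = [0..<2 * M]\<close> pins
  \<open>S\<close> down as (0, 1), (2, 3), and so on.\<close>

definition flat :: "(nat \<times> nat) list \<Rightarrow> nat list" where
  "flat ls = concat (map (\<lambda>p. [fst p, snd p]) ls)"

lemma flat_inj: "flat ls = flat ls' \<Longrightarrow> ls = ls'"
proof (induction ls arbitrary: ls')
  case Nil
  then show ?case by (cases ls') (auto simp: flat_def)
next
  case (Cons p ls)
  then show ?case by (cases ls') (auto simp: flat_def prod_eq_iff)
qed

lemma set_flat: "set (flat ls) = fst ` set ls \<union> snd ` set ls"
  by (auto simp: flat_def)

text \<open>The symmetry \<open>ddiff i f = ddiff (2 * M - 2 - i) f\<close>, with \<open>ddiff (M - 1) f = 0\<close>, lets us permute the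
  pairs of values in positions \<open>i\<close> and \<open>2 * M - 1 - i\<close>.\<close>

definition mirror_symmetric :: "nat \<Rightarrow> ipoly \<Rightarrow> bool" where
  "mirror_symmetric M f \<longleftrightarrow> (\<forall>i. Suc i < M \<longrightarrow> ddiff i f = ddiff (2 * M - 2 - i) f) \<and> ddiff (M - 1) f = 0"

context
  fixes M :: nat and f :: ipoly
  assumes f: "mirror_symmetric M f"
begin

text \<open>The descent at \<open>i\<close> extracts \<open>ddiff i f\<close>, which equals
  \<open>ddiff j f\<close> at the mirrored index. If the second components descend at
  \<open>j\<close>, a further \<open>ddiff j\<close> comes out and squares to zero; if they ascend,
  \<open>ddiff j\<close> is reabsorbed and both components have been exchanged.\<close>

lemma pair_ddiff_step:
  assumes v: "pairs_valid (2 * M) (xs @ p # q # ys)" and "fst q < fst p"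
  shows "snd p < snd q \<Longrightarrow> pair_ddiff f (xs @ p # q # ys) = 0"
    "snd q < snd p \<Longrightarrow> pair_ddiff f (xs @ p # q # ys) = pair_ddiff f (xs @ q # p # ys)"
proof -
  define A B C where "A = map fst xs" and "B = map fst ys @ rev (map snd ys)" and "C = rev (map snd xs)"
  define w where "w = perm_list (pair_word (xs @ p # q # ys))"
  have w: "w \<in> S_inf" unfolding w_def by (rule permutes_S_inf[OF pairs_valid_permutes[OF v]])
  have L: "pair_word (xs @ p # q # ys) = A @ [fst p, fst q] @ B @ [snd q, snd p] @ C"
    and L': "pair_word (xs @ q # p # ys) = A @ [fst q, fst p] @ B @ [snd p, snd q] @ C"
    by (simp_all add: pair_word_def A_def B_def C_def)
  define i j where "i = length A" and "j = length (A @ [fst q, fst p] @ B)"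
  have M: "M = length xs + 2 + length ys" using pairs_valid_length[OF v] by simp
  have ij: "Suc i < M" "2 * M - 2 - i = j" "Suc i < j"
    by (simp_all add: i_def j_def A_def B_def M)
  have "perm_list (pair_word (xs @ q # p # ys))
      = perm_list ((A @ [fst q, fst p] @ B) @ [snd q, snd p] @ C) \<circ> simple_refl j"
    unfolding j_def by (subst perm_list_swap[symmetric]) (simp add: L')
  also have "perm_list ((A @ [fst q, fst p] @ B) @ [snd q, snd p] @ C) = w \<circ> simple_refl i"
    unfolding w_def L i_def by (subst perm_list_swap[symmetric]) simp
  finally have w': "perm_list (pair_word (xs @ q # p # ys)) = w \<circ> simple_refl i \<circ> simple_refl j" .
  have vals: "w i = fst p" "w (Suc i) = fst q" "w j = snd q" "w (Suc j) = snd p"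
    unfolding w_def L i_def j_def by (simp_all add: perm_list_def nth_append)
  have "op_perm ddiff w f = op_perm ddiff (w \<circ> simple_refl i) (ddiff i f)"
    by (rule op_perm_right_down[OF braid_family_ddiff w]) (simp add: vals assms(2))
  also have "ddiff i f = ddiff j f" using f ij by (auto simp: mirror_symmetric_def)
  finally have eq: "op_perm ddiff w f = op_perm ddiff (w \<circ> simple_refl i) (ddiff j f)" .
  have sv: "(w \<circ> simple_refl i) j = snd q" "(w \<circ> simple_refl i) (Suc j) = snd p"
    using ij(3) by (simp_all add: simple_refl_other vals)
  show "pair_ddiff f (xs @ p # q # ys) = 0" if "snd p < snd q"
    using op_perm_right_down[OF braid_family_ddiff S_inf_right[OF w], of i j "ddiff j f"] sv that eq
    by (simp add: pair_ddiff_def w_def[symmetric] op_perm_0)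
  show "pair_ddiff f (xs @ p # q # ys) = pair_ddiff f (xs @ q # p # ys)" if "snd q < snd p"
    unfolding pair_ddiff_def w' w_def[symmetric] eq
    by (rule op_perm_right[OF braid_family_ddiff S_inf_right[OF w], symmetric]) (simp only: sv that)
qed

lemma pair_ddiff_swap:
  assumes "pairs_valid (2 * M) (xs @ p # q # ys)" "comparable p q"
  shows "pair_ddiff f (xs @ p # q # ys) = pair_ddiff f (xs @ q # p # ys)"
proof -
  have v: "pairs_valid (2 * M) (xs @ q # p # ys)"
    using assms(1) by (subst pairs_valid_mset[of _ "xs @ p # q # ys"]) simp_all
  show ?thesis
    using assms(2) pair_ddiff_step(2)[OF assms(1)] pair_ddiff_step(2)[OF v] unfolding comparable_def by metis
qed

text \<open>The last pair occupies the two middle positions, so its inversion extracts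
  \<open>ddiff (M - 1) f\<close>.\<close>

lemma pair_ddiff_innermost:
  assumes v: "pairs_valid (2 * M) (xs @ [p])" and "snd p < fst p"
  shows "pair_ddiff f (xs @ [p]) = 0"
proof -
  define w where "w = perm_list (pair_word (xs @ [p]))"
  have w: "w \<in> S_inf" unfolding w_def by (rule permutes_S_inf[OF pairs_valid_permutes[OF v]])
  have M: "M = Suc (length xs)" using pairs_valid_length[OF v] by simp
  have "w (M - 1) = fst p" "w (Suc (M - 1)) = snd p"
    unfolding w_def by (simp_all add: perm_list_def pair_word_def nth_append M)
  then have "op_perm ddiff w f = op_perm ddiff (w \<circ> simple_refl (M - 1)) (ddiff (M - 1) f)"
    using assms(2) by (intro op_perm_right_down[OF braid_family_ddiff w]) simp
  then show ?thesis using f by (simp add: pair_ddiff_def w_def mirror_symmetric_def op_perm_0)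
qed

lemma pairs_valid_distinct:
  assumes "pairs_valid n (xs @ p # ys @ q # zs)"
  shows "fst p \<noteq> fst q" "snd p \<noteq> snd q" "fst p \<noteq> snd p" "fst q \<noteq> snd q"
  using assms by (auto simp: pairs_valid_def pair_word_def)

text \<open>The inverted pair \<open>p\<close> is moved towards the middle. An increasing pair that
  is not comparable with \<open>p\<close> starts below \<open>fst p\<close> and ends above
  \<open>snd p\<close>, which already gives zero.\<close>

lemma pair_ddiff_inverted:
  assumes "pairs_valid (2 * M) (xs @ p # ys)" "snd p < fst p" "\<forall>q\<in>set ys. fst q < snd q"
  shows "pair_ddiff f (xs @ p # ys) = 0"
  using assms
proof (induction ys arbitrary: xs)
  case Nil
  then show ?case using pair_ddiff_innermost by simp
next
  case (Cons q ys)
  have ne: "fst p \<noteq> fst q" "snd p \<noteq> snd q" using pairs_valid_distinct[of _ xs p "[]" q ys] Cons.prems(1) by auto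
  show ?case
  proof (cases "comparable p q")
    case True
    have "pair_ddiff f (xs @ p # q # ys) = pair_ddiff f ((xs @ [q]) @ p # ys)"
      using pair_ddiff_swap[OF Cons.prems(1) True] by simp
    moreover have "pairs_valid (2 * M) ((xs @ [q]) @ p # ys)"
      using Cons.prems(1) by (subst pairs_valid_mset[of _ "xs @ p # q # ys"]) simp_all
    ultimately show ?thesis using Cons.IH[of "xs @ [q]"] Cons.prems by simp
  next
    case False
    then have "fst q < fst p" "snd p < snd q"
      using ne Cons.prems(2,3) by (auto simp: comparable_def)
    then show ?thesis using pair_ddiff_step(1)[OF Cons.prems(1)] by simp
  qed
qed

text \<open>\<open>p\<close> is moved towards \<open>q\<close>. A pair \<open>r\<close> in between
  is comparable with \<open>p\<close> and lets it pass, or encloses \<open>p\<close> and gives zero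
  at once, or is enclosed by \<open>p\<close> and takes over its role, being enclosed by
  \<open>q\<close> as well.\<close>

lemma pair_ddiff_nested:
  assumes "pairs_valid (2 * M) (xs @ p # ys @ q # zs)" "fst q < fst p" "snd p < snd q"
  shows "pair_ddiff f (xs @ p # ys @ q # zs) = 0"
  using assms
proof (induction ys arbitrary: xs p)
  case Nil
  then show ?case using pair_ddiff_step(1)[of xs p q zs] by simp
next
  case (Cons r ys)
  have ne: "fst p \<noteq> fst r" "snd p \<noteq> snd r"
    using pairs_valid_distinct[of _ xs p "[]" r "ys @ q # zs"] Cons.prems(1) by auto
  consider "comparable p r" | "fst r < fst p" "snd p < snd r" | "fst p < fst r" "snd r < snd p"
    using ne unfolding comparable_def by (metis linorder_neqE_nat)
  then show ?case
  proof cases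
    case 1
    have "pair_ddiff f (xs @ p # r # ys @ q # zs) = pair_ddiff f ((xs @ [r]) @ p # ys @ q # zs)"
      using pair_ddiff_swap[of xs p r "ys @ q # zs"] Cons.prems(1) 1 by simp
    moreover have "pairs_valid (2 * M) ((xs @ [r]) @ p # ys @ q # zs)"
      using Cons.prems(1) by (subst pairs_valid_mset[of _ "xs @ p # r # ys @ q # zs"]) simp_all
    ultimately show ?thesis using Cons.IH[of "xs @ [r]" p] Cons.prems by simp
  next
    case 2
    then show ?thesis using pair_ddiff_step(1)[of xs p r "ys @ q # zs"] Cons.prems(1) by simp
  next
    case 3
    then show ?thesis using Cons.IH[of "xs @ [p]" r] Cons.prems by simp
  qed
qed

lemma pair_ddiff_move:
  assumes "pairs_valid (2 * M) (xs @ ys @ p # zs)" "\<forall>q\<in>set ys. comparable q p"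
  shows "pair_ddiff f (xs @ ys @ p # zs) = pair_ddiff f (xs @ p # ys @ zs)"
  using assms
proof (induction ys arbitrary: zs rule: rev_induct)
  case (snoc q ys)
  have "pair_ddiff f ((xs @ ys) @ q # p # zs) = pair_ddiff f ((xs @ ys) @ p # q # zs)"
    using snoc.prems by (intro pair_ddiff_swap) simp_all
  moreover have "pairs_valid (2 * M) (xs @ ys @ p # q # zs)"
    using snoc.prems(1) by (subst pairs_valid_mset[of _ "xs @ (ys @ [q]) @ p # zs"]) simp_all
  ultimately show ?case using snoc.IH[of "q # zs"] snoc.prems(2) by simp
qed simp

lemma pair_ddiff_mset:
  assumes "mset ls = mset ls'" "pairs_valid (2 * M) (xs @ ls)"
    "\<forall>p\<in>set ls. \<forall>q\<in>set ls. p \<noteq> q \<longrightarrow> comparable p q"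
  shows "pair_ddiff f (xs @ ls) = pair_ddiff f (xs @ ls')"
  using assms
proof (induction ls arbitrary: xs ls')
  case (Cons p ls)
  have "p \<in> set ls'" using Cons.prems(1) by (metis list.set_intros(1) mset_eq_setD)
  then obtain ys zs where ls': "ls' = ys @ p # zs" by (meson split_list)
  have m: "mset ls = mset (ys @ zs)" using Cons.prems(1) by (simp add: ls')
  have v': "pairs_valid (2 * M) (xs @ ys @ p # zs)"
    using Cons.prems(2) by (subst pairs_valid_mset[of _ "xs @ p # ls"]) (simp_all add: m)
  have "comparable q p" if "q \<in> set ys" for q
  proof -
    have "q \<in> set ls" using mset_eq_setD[OF m] that by simp
    moreover have "q \<noteq> p"
    proof
      assume "q = p"
      with that have "p \<in> set ys" by simp
      then obtain us vs where "ys = us @ p # vs" by (meson split_list)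
      then show False using pairs_valid_distinct(1)[of _ "xs @ us" p vs p zs] v' by simp
    qed
    ultimately show ?thesis using Cons.prems(3) by simp
  qed
  then have "pair_ddiff f (xs @ ls') = pair_ddiff f ((xs @ [p]) @ ys @ zs)"
    using pair_ddiff_move[OF v'] by (simp add: ls')
  also have "\<dots> = pair_ddiff f ((xs @ [p]) @ ls)"
    using Cons.IH[OF m, of "xs @ [p]"] Cons.prems by simp
  finally show ?case by simp
qed simp

text \<open>Disjoint intervals are comparable, so they may be sorted freely; sorted and exhausting
  \<open>{..<2 * M}\<close>, they list the numbers in order.\<close>

lemma pair_ddiff_separated:
  assumes v: "pairs_valid (2 * M) ls" and up: "\<forall>p\<in>set ls. fst p < snd p"
    and sep: "\<forall>p\<in>set ls. \<forall>q\<in>set ls. p \<noteq> q \<longrightarrow> separated p q"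
  shows "\<exists>S. pair_ddiff f ls = pair_ddiff f S \<and> flat S = [0..<2 * M]"
proof -
  define S where "S = sort_key fst ls"
  have mS: "mset ls = mset S" by (simp add: S_def)
  then have sS: "set S = set ls" by (metis mset_eq_setD)
  have vS: "pairs_valid (2 * M) S" using v pairs_valid_mset[OF mS] by simp
  have "comparable p q" if "p \<in> set ls" "q \<in> set ls" "p \<noteq> q" for p q
  proof -
    have "fst p < snd p" "fst q < snd q" "snd p < fst q \<or> snd q < fst p"
      using that up sep by (auto simp: separated_def)
    then show ?thesis unfolding comparable_def by linarith
  qed
  then have eq: "pair_ddiff f ls = pair_ddiff f S"
    using pair_ddiff_mset[OF mS, of "[]"] v by simp
  have "distinct S" using vS by (auto simp: pairs_valid_def pair_word_def distinct_map)
  have "sorted_wrt (\<lambda>p q. snd p < fst q) S"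
    unfolding sorted_wrt_iff_nth_less
  proof (intro allI impI)
    fix i j assume ij: "i < j" "j < length S"
    have "sorted (map fst S)" unfolding S_def by (rule sorted_sort_key)
    then have "fst (S ! i) \<le> fst (S ! j)" using sorted_nth_mono[of "map fst S" i j] ij by simp
    moreover have "S ! i \<noteq> S ! j" using \<open>distinct S\<close> ij by (simp add: nth_eq_iff_index_eq)
    moreover have "S ! i \<in> set ls" "S ! j \<in> set ls" using ij by (simp_all flip: sS)
    ultimately show "snd (S ! i) < fst (S ! j)"
      using sep up unfolding separated_def by (meson less_le_trans less_trans not_le)
  qed
  moreover have "\<forall>p\<in>set S. fst p < snd p" using up sS by simp
  ultimately have "sorted_wrt (<) (flat S)"
  proof (induction S)
    case (Cons p S)
    have lt: "snd p < x" if "x \<in> set (flat S)" for x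
    proof -
      from that obtain q where "q \<in> set S" "x = fst q \<or> x = snd q" by (auto simp: set_flat)
      moreover from this have "snd p < fst q" "fst q < snd q" using Cons.prems by simp_all
      ultimately show ?thesis by auto
    qed
    have p: "fst p < snd p" using Cons.prems(2) by simp
    have lt': "fst p < x" if "x \<in> set (flat S)" for x using p lt[OF that] by simp
    have "sorted_wrt (<) (flat S)" using Cons by simp
    moreover have "\<forall>x\<in>set (flat S). snd p < x" using lt by blast
    moreover have "\<forall>x\<in>set (snd p # flat S). fst p < x" using p lt' by (metis set_ConsD)
    moreover have "flat (p # S) = fst p # snd p # flat S" by (simp add: flat_def)
    ultimately show ?case by (simp only: sorted_wrt.simps)
  qed (simp add: flat_def)
  moreover have "set (flat S) = {..<2 * M}"
    using vS by (simp add: set_flat pairs_valid_def set_pair_word)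
  moreover have "set [0..<2 * M] = {..<2 * M}" by auto
  ultimately have "flat S = [0..<2 * M]"
    using strict_sorted_equal[of "[0..<2 * M]" "flat S"] sorted_wrt_upt[of 0 "2 * M"] by (simp only:)
  then show ?thesis using eq by blast
qed

text \<open>Any two of the \<open>M\<close> pairs meet in four pairs of positions. At most two of
  these are inversions, and at most one if the intervals overlap, so a single overlap pushes the
  total below twice the number of pairs of pairs.\<close>

lemma inversions_pairs_bound:
  assumes v: "pairs_valid (2 * M) ls" and up: "\<forall>p\<in>set ls. fst p < snd p"
    and nest: "\<And>i j. i < j \<Longrightarrow> j < M \<Longrightarrow> \<not> (fst (ls ! j) < fst (ls ! i) \<and> snd (ls ! i) < snd (ls ! j))"
    and ij: "i0 < j0" "j0 < M" "\<not> separated (ls ! i0) (ls ! j0)"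
  shows "card (inversions (perm_list (pair_word ls))) < 2 * (\<Sum>j<M. j)"
proof -
  define w where "w = perm_list (pair_word ls)"
  have len: "length ls = M" using pairs_valid_length[OF v] by simp
  have a: "w i = fst (ls ! i)" "w (2 * M - 1 - i) = snd (ls ! i)" if "i < M" for i
  proof -
    from less_imp_Suc_add[OF that] obtain k where k: "M = Suc (i + k)" by blast
    then have e: "2 * M - 1 - i = M + k" "M - Suc k = i" "k < M" by simp_all
    show "w i = fst (ls ! i)" "w (2 * M - 1 - i) = snd (ls ! i)"
      unfolding e(1) using that e(2,3) by (simp_all add: w_def perm_list_def pair_word_def len nth_append rev_nth)
  qed
  have ab: "fst (ls ! i) < snd (ls ! i)" if "i < M" for i using that up len by simp
  have wp: "w permutes {..<2 * M}" unfolding w_def by (rule pairs_valid_permutes[OF v])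
  define I where "I i j = inversions w \<inter>
    {(i, j), (i, 2 * M - 1 - j), (j, 2 * M - 1 - i), (2 * M - 1 - j, 2 * M - 1 - i)}" for i j
  let ?T = "SIGMA j:{..<M}. {..<j}"
  have cover: "inversions w \<subseteq> (\<Union>(j, i)\<in>?T. I i j)"
  proof
    fix z assume z: "z \<in> inversions w"
    then obtain x y where xy: "z = (x, y)" "x < y" "w y < w x" by (auto simp: inversions_def)
    have y: "y < 2 * M" using inversions_permutes[OF wp] z xy(1) by auto
    define m where "m x = (if x < M then x else 2 * M - 1 - x)" for x
    have m: "m x < M" "x = m x \<or> x = 2 * M - 1 - m x" if "x < 2 * M" for x using that by (auto simp: m_def)
    \<comment> \<open>\<open>m\<close> sends a position to the index of its pair. The two positions
      of one pair are never inverted, because the pair is increasing.\<close>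
    have "m x \<noteq> m y"
    proof
      assume eq: "m x = m y"
      then have "x = m x" "y = 2 * M - 1 - m x" using m[of x] m[of y] y xy(2) by auto
      then show False using a[of "m x"] ab[of "m x"] m(1)[of x] xy y by simp
    qed
    then consider "m x < m y" | "m y < m x" by linarith
    then show "z \<in> (\<Union>(j, i)\<in>?T. I i j)"
    proof cases
      case 1
      have "z \<in> I (m x) (m y)" using z xy y m[of x] m[of y] 1 by (auto simp: I_def)
      then show ?thesis using 1 m(1)[of y] y by blast
    next
      case 2
      have "z \<in> I (m y) (m x)" using z xy y m[of x] m[of y] 2 by (auto simp: I_def)
      then show ?thesis using 2 m(1)[of x] y xy(2) by fastforce
    qed
  qed
  have inv_iff: "(i, j) \<in> inversions w \<longleftrightarrow> fst (ls ! j) < fst (ls ! i)"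
      "(i, 2 * M - 1 - j) \<in> inversions w \<longleftrightarrow> snd (ls ! j) < fst (ls ! i)"
      "(j, 2 * M - 1 - i) \<in> inversions w \<longleftrightarrow> snd (ls ! i) < fst (ls ! j)"
      "(2 * M - 1 - j, 2 * M - 1 - i) \<in> inversions w \<longleftrightarrow> snd (ls ! i) < snd (ls ! j)" if "i < j" "j < M" for i j
    unfolding inversions_def using that a[of i] a[of j] by auto
  \<comment> \<open>Without separation the second and third inversions in \<open>I i j\<close> are
    impossible, and the first and fourth together would be the forbidden nesting.\<close>
  have c1: "card (I i j) \<le> 1" if "i < j" "j < M" "\<not> separated (ls ! i) (ls ! j)" for i j
  proof -
    have "I i j \<subseteq> {(i, j)} \<or> I i j \<subseteq> {(2 * M - 1 - j, 2 * M - 1 - i)}"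
      using inv_iff[OF that(1,2)] that(3) nest[OF that(1,2)] unfolding I_def separated_def by blast
    then show ?thesis using card_mono[of "{_}" "I i j"] by fastforce
  qed
  \<comment> \<open>Separation in one direction allows only the first two inversions, in the other
    direction only the last two; without separation the first and fourth remain.\<close>
  have c2: "card (I i j) \<le> 2" if "i < j" "j < M" for i j
  proof -
    have "I i j \<subseteq> {(i, j), (i, 2 * M - 1 - j)} \<or> I i j \<subseteq> {(j, 2 * M - 1 - i), (2 * M - 1 - j, 2 * M - 1 - i)}
      \<or> I i j \<subseteq> {(i, j), (2 * M - 1 - j, 2 * M - 1 - i)}"
    proof -
      consider "snd (ls ! j) < fst (ls ! i)" | "snd (ls ! i) < fst (ls ! j)"
        | "\<not> snd (ls ! j) < fst (ls ! i)" "\<not> snd (ls ! i) < fst (ls ! j)" by blast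
      then show ?thesis
      proof cases
        case 1
        then have "\<not> snd (ls ! i) < fst (ls ! j)" "\<not> snd (ls ! i) < snd (ls ! j)"
          using ab[of i] ab[of j] that by auto
        then show ?thesis using inv_iff[OF that] unfolding I_def by blast
      next
        case 2
        then have "\<not> snd (ls ! j) < fst (ls ! i)" "\<not> fst (ls ! j) < fst (ls ! i)"
          using ab[of i] ab[of j] that by auto
        then show ?thesis using inv_iff[OF that] unfolding I_def by blast
      next
        case 3
        then show ?thesis using inv_iff[OF that] unfolding I_def by blast
      qed
    qed
    moreover have "card {x, y :: nat \<times> nat} \<le> 2" for x y by (simp add: card_insert_if)
    ultimately show ?thesis by (meson card_mono finite.emptyI finite_insert le_trans)
  qed
  have "card (inversions w) \<le> (\<Sum>(j, i)\<in>?T. card (I i j))"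
    using card_mono[OF _ cover] card_UN_le[of ?T "\<lambda>(j, i). I i j"]
    by (auto simp: I_def split_def intro: le_trans)
  also have "\<dots> < (\<Sum>(j, i)\<in>?T. 2)"
  proof (rule sum_strict_mono_ex1)
    show "\<forall>x\<in>?T. (case x of (j, i) \<Rightarrow> card (I i j)) \<le> (case x of (j, i) \<Rightarrow> 2)" using c2 by auto
    show "\<exists>x\<in>?T. (case x of (j, i) \<Rightarrow> card (I i j)) < (case x of (j, i) \<Rightarrow> 2)"
      using c1[OF ij] ij by (intro bexI[of _ "(j0, i0)"]) auto
  qed simp
  also have "(\<Sum>(j, i)\<in>?T. 2::nat) = 2 * (\<Sum>j<M. j)" by (simp add: split_def card_SigmaI)
  finally show ?thesis by (simp add: w_def)
qed

text \<open>Nonvanishing excludes inverted and forbidden nested pairs; the prescribed length is the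
  maximum then possible, and it forces separation.\<close>

lemma pair_ddiff_canonical:
  assumes v: "pairs_valid (2 * M) ls" and nz: "pair_ddiff f ls \<noteq> 0"
    and len: "card (inversions (perm_list (pair_word ls))) = 2 * (\<Sum>j<M. j)"
  shows "\<exists>S. pair_ddiff f ls = pair_ddiff f S \<and> flat S = [0..<2 * M]"
proof -
  have M: "length ls = M" using pairs_valid_length[OF v] by simp
  have up: "\<forall>p\<in>set ls. fst p < snd p"
  proof (rule ccontr)
    assume "\<not> (\<forall>p\<in>set ls. fst p < snd p)"
    \<comment> \<open>The last inverted pair is taken, so that all pairs further inside are
      increasing.\<close>
    then obtain xs p ys where ls: "ls = xs @ p # ys" "\<not> fst p < snd p" "\<forall>q\<in>set ys. fst q < snd q"
      using split_list_last_prop[of ls "\<lambda>p. \<not> fst p < snd p"] by blast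
    moreover have "fst p \<noteq> snd p" using v by (auto simp: pairs_valid_def pair_word_def ls(1))
    ultimately show False using pair_ddiff_inverted[of xs p ys] v nz by auto
  qed
  have nest: "\<not> (fst (ls ! j) < fst (ls ! i) \<and> snd (ls ! i) < snd (ls ! j))" if "i < j" "j < M" for i j
  proof
    assume n: "fst (ls ! j) < fst (ls ! i) \<and> snd (ls ! i) < snd (ls ! j)"
    have 1: "ls = take i ls @ ls ! i # drop (Suc i) ls" using that M by (simp add: id_take_nth_drop)
    have 2: "drop (Suc i) ls = take (j - Suc i) (drop (Suc i) ls) @ ls ! j # drop (Suc j) ls"
      using that M id_take_nth_drop[of "j - Suc i" "drop (Suc i) ls"] by simp
    have "ls = take i ls @ ls ! i # take (j - Suc i) (drop (Suc i) ls) @ ls ! j # drop (Suc j) ls"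
      using 1 2 by metis
    then show False using pair_ddiff_nested n v nz by metis
  qed
  have "separated p q" if "p \<in> set ls" "q \<in> set ls" "p \<noteq> q" for p q
  proof -
    from that M obtain i j where "i < M" "p = ls ! i" "j < M" "q = ls ! j" by (metis in_set_conv_nth)
    moreover have "separated (ls ! i) (ls ! j)" if "i < j" "j < M" for i j
    proof (rule ccontr)
      assume "\<not> separated (ls ! i) (ls ! j)"
      from inversions_pairs_bound[OF v up nest that this] show False using len by simp
    qed
    ultimately show ?thesis using that(3) by (metis linorder_neqE_nat separated_def)
  qed
  then show ?thesis using pair_ddiff_separated[OF v up] by blast
qed

lemma exists_pairs:
  assumes "w permutes {..<2 * M}"
  shows "\<exists>ls. pairs_valid (2 * M) ls \<and> perm_list (pair_word ls) = w"
proof -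
  define ls where "ls = map (\<lambda>i. (w i, w (2 * M - 1 - i))) [0..<M]"
  have "pair_word ls = map w [0..<2 * M]"
  proof (rule nth_equalityI)
    fix x assume "x < length (pair_word ls)"
    then have "x < 2 * M" by (simp add: ls_def pair_word_def)
    then show "pair_word ls ! x = map w [0..<2 * M] ! x"
      by (auto simp: ls_def pair_word_def nth_append rev_nth)
  qed (simp add: ls_def pair_word_def)
  moreover have "perm_list (map w [0..<2 * M]) = w"
    using permutes_not_in[OF assms] by (auto simp: perm_list_def fun_eq_iff)
  moreover have "distinct (map w [0..<2 * M])" "set (map w [0..<2 * M]) = {..<2 * M}"
    using permutes_inj_on[OF assms] permutes_image[OF assms] by (auto simp: distinct_map atLeast0LessThan)
  ultimately show ?thesis unfolding pairs_valid_def by (intro exI[of _ ls]) (simp only:)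
qed

text \<open>All nonzero values equal the value at one canonical list of pairs; the permutation
  \<open>v\<close> shows this value to be 1.\<close>

theorem mirror_symmetric_ddiff:
  assumes "w permutes {..<2 * M}" "perm_length w = 2 * (\<Sum>j<M. j)"
    and "v permutes {..<2 * M}" "perm_length v = 2 * (\<Sum>j<M. j)" "op_perm ddiff v f = 1"
  shows "op_perm ddiff w f \<in> {0, 1}"
proof -
  have can: "\<exists>S. op_perm ddiff w f = pair_ddiff f S \<and> flat S = [0..<2 * M]"
    if w: "w permutes {..<2 * M}" "perm_length w = 2 * (\<Sum>j<M. j)" "op_perm ddiff w f \<noteq> 0" for w
  proof -
    obtain ls where ls: "pairs_valid (2 * M) ls" "perm_list (pair_word ls) = w" using exists_pairs[OF w(1)] by blast
    then have "op_perm ddiff w f = pair_ddiff f ls" by (simp add: pair_ddiff_def)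
    then show ?thesis
      using pair_ddiff_canonical[OF ls(1)] w ls(2) perm_length_inversions[OF permutes_S_inf[OF w(1)]] by simp
  qed
  obtain S where S: "op_perm ddiff v f = pair_ddiff f S" "flat S = [0..<2 * M]" using can assms by force
  show ?thesis
  proof (cases "op_perm ddiff w f = 0")
    case False
    then obtain S' where "op_perm ddiff w f = pair_ddiff f S'" "flat S' = [0..<2 * M]" using can assms by blast
    then show ?thesis using S flat_inj[of S S'] assms(5) by simp
  qed simp
qed

end

section \<open>Products over shifted diagrams\<close>

definition pairs_poly :: "(nat \<times> nat) set \<Rightarrow> ipoly" where
  "pairs_poly D = (\<Prod>(i, j)\<in>D. var i + var j)"

text \<open>The shifted diagram, with columns numbered by the index of the second variable of a
  cell.\<close>

definition cells :: "(nat \<Rightarrow> nat) \<Rightarrow> (nat \<times> nat) set" where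
  "cells m = {(i, j). i < j \<and> j \<le> i + m i}"

lemma swap_vars_pairs_poly:
  assumes "finite D" "\<And>i j. (i, j) \<in> D \<Longrightarrow> i < j"
    "\<And>i j. (i, j) \<in> D \<Longrightarrow> (i, j) \<noteq> (k, Suc k) \<Longrightarrow> (simple_refl k i, simple_refl k j) \<in> D"
  shows "swap_vars k (pairs_poly D) = pairs_poly D"
proof -
  \<comment> \<open>The cell \<open>(k, Suc k)\<close> is set apart: the reflection reverses it into
    a non-cell, although its factor is symmetric.\<close>
  define D0 D1 where "D0 = D \<inter> {(k, Suc k)}" and "D1 = D - {(k, Suc k)}"
  let ?s = "\<lambda>(i, j). (simple_refl k i, simple_refl k j)"
  have fin: "finite D0" "finite D1" using assms(1) by (simp_all add: D0_def D1_def)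
  have split: "pairs_poly D = pairs_poly D0 * pairs_poly D1"
  proof -
    have "D = D0 \<union> D1" "D0 \<inter> D1 = {}" by (auto simp: D0_def D1_def)
    then show ?thesis unfolding pairs_poly_def using fin by (simp add: prod.union_disjoint)
  qed
  have D0: "swap_vars k (pairs_poly D0) = pairs_poly D0"
    unfolding pairs_poly_def swap_vars_prod
    by (intro prod.cong) (auto simp: D0_def swap_vars_add swap_vars_var add.commute)
  have closed: "(simple_refl k i, simple_refl k j) \<in> D1" if "(i, j) \<in> D1" for i j
  proof -
    have "(i, j) \<in> D" "(i, j) \<noteq> (k, Suc k)" using that by (auto simp: D1_def)
    moreover have "(simple_refl k i, simple_refl k j) \<noteq> (k, Suc k)"
    proof
      assume "(simple_refl k i, simple_refl k j) = (k, Suc k)"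
      then have "i = Suc k" "j = k" by (auto simp: simple_refl_eq split: if_splits)
      then show False using assms(2)[of i j] \<open>(i, j) \<in> D\<close> by simp
    qed
    ultimately show ?thesis using assms(3) by (simp add: D1_def)
  qed
  have "swap_vars k (pairs_poly D1) = (\<Prod>(i, j)\<in>D1. var (simple_refl k i) + var (simple_refl k j))"
    unfolding pairs_poly_def swap_vars_prod
    by (intro prod.cong) (auto simp: swap_vars_add swap_vars_var)
  also have "\<dots> = pairs_poly D1"
    unfolding pairs_poly_def
    by (rule prod.reindex_bij_witness[of _ ?s ?s]) (auto intro: closed)
  finally show ?thesis using D0 by (simp add: split swap_vars_mult)
qed

lemma ddiff_var_other: "i \<noteq> k \<Longrightarrow> i \<noteq> Suc k \<Longrightarrow> ddiff k (var i) = 0"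
  by (simp add: ddiff_eq_0 swap_vars_var simple_refl_other)

lemma ddiff_pairs_poly_insert:
  assumes "finite D" "(a, b) \<notin> D" "swap_vars k (pairs_poly D) = pairs_poly D"
    "a = k \<and> b \<noteq> k \<and> b \<noteq> Suc k \<or> b = k \<and> a \<noteq> k \<and> a \<noteq> Suc k"
  shows "ddiff k (pairs_poly (insert (a, b) D)) = pairs_poly D"
proof -
  have "ddiff k (var a + var b) = 1" using assms(4) by (auto simp: ddiff_add ddiff_var ddiff_var_other)
  moreover have "pairs_poly (insert (a, b) D) = pairs_poly D * (var a + var b)"
    using assms(1,2) by (simp add: pairs_poly_def mult.commute)
  ultimately show ?thesis using ddiff_sym_mult[OF assms(3)] by simp
qed

lemma wdeg_add: "wdeg (\<alpha> + \<beta>) = wdeg \<alpha> + wdeg \<beta>"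
proof -
  let ?A = "keys \<alpha> \<union> keys \<beta>"
  have "wdeg \<gamma> = (\<Sum>i\<in>?A. lookup \<gamma> i)" if "keys \<gamma> \<subseteq> ?A" for \<gamma> :: wcomp
    unfolding wdeg_def using that by (intro sum_keys_superset[where h = "\<lambda>_ k. k"]) auto
  then show ?thesis using keys_add[of \<alpha> \<beta>] by (simp add: lookup_add sum.distrib)
qed

lemma homogeneous_mult: "homogeneous d f \<Longrightarrow> homogeneous e g \<Longrightarrow> homogeneous (d + e) (f * g)"
  unfolding homogeneous_def using keys_mult[of f g] by (fastforce simp: wdeg_add)

lemma homogeneous_var: "homogeneous 1 (var i)"
  by (simp add: homogeneous_def var_def mon_def wdeg_def)

lemma homogeneous_pairs_poly: "finite D \<Longrightarrow> homogeneous (card D) (pairs_poly D)"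
proof (induction D rule: finite_induct)
  case (insert p D)
  have "homogeneous 1 (var (fst p) + var (snd p))" by (intro homogeneous_add homogeneous_var)
  then show ?case using insert homogeneous_mult[of 1 "var (fst p) + var (snd p)" "card D"]
    by (simp add: pairs_poly_def split_def)
qed (simp add: pairs_poly_def homogeneous_1_iff)

lemma keys_pairs_poly:
  assumes "finite D" "\<And>i j. (i, j) \<in> D \<Longrightarrow> i < j" "\<alpha> \<in> keys (pairs_poly D)"
  shows "lookup \<alpha> i \<le> card {p\<in>D. fst p = i \<or> snd p = i}"
  using assms
proof (induction D arbitrary: \<alpha> rule: finite_induct)
  case (insert p D)
  obtain a b where p: "p = (a, b)" by (cases p)
  have ab: "a < b" using insert.prems(1) p by simp
  have "pairs_poly (insert p D) = (var a + var b) * pairs_poly D"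
    using insert.hyps by (simp add: pairs_poly_def p)
  then obtain \<beta> \<gamma> where \<alpha>: "\<alpha> = \<beta> + \<gamma>" "\<beta> \<in> keys (var a + var b)" "\<gamma> \<in> keys (pairs_poly D)"
    using insert.prems(2) keys_mult[of "var a + var b" "pairs_poly D"] by auto
  have IH: "lookup \<gamma> i \<le> card {p\<in>D. fst p = i \<or> snd p = i}"
    using insert.IH \<alpha>(3) insert.prems(1) by simp
  have "\<beta> = single a 1 \<or> \<beta> = single b 1"
    using \<alpha>(2) keys_add[of "var a" "var b"] by (auto simp: var_def mon_def)
  then have \<beta>: "lookup \<beta> i \<le> (if a = i \<or> b = i then 1 else 0)"
    by (auto simp: lookup_single when_def)
  have "{q\<in>insert p D. fst q = i \<or> snd q = i}
      = (if a = i \<or> b = i then insert p {q\<in>D. fst q = i \<or> snd q = i} else {q\<in>D. fst q = i \<or> snd q = i})"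
    using p by auto
  then have "card {q\<in>insert p D. fst q = i \<or> snd q = i}
      = (if a = i \<or> b = i then 1 else 0) + card {q\<in>D. fst q = i \<or> snd q = i}"
    using insert.hyps by simp
  then show ?case using IH \<beta> by (simp add: \<alpha>(1) lookup_add)
qed (simp add: pairs_poly_def)

lemma pairs_poly_nonzero: "finite D \<Longrightarrow> pairs_poly D \<noteq> 0"
proof -
  have "var i + var j \<noteq> 0" for i j
  proof
    assume "var i + var j = 0"
    then have "lookup (var i + var j) (single i 1) = 0" by simp
    then show False by (auto simp: lookup_add var_def mon_def lookup_single when_def split: if_splits)
  qed
  then show "finite D \<Longrightarrow> pairs_poly D \<noteq> 0" by (auto simp: pairs_poly_def prod_zero_iff)
qed

section \<open>The shifted staircase\<close>

definition max_rows :: "nat \<Rightarrow> nat \<Rightarrow> nat" where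
  "max_rows M i = 2 * (M - Suc i)"

lemma cells_max_rows: "cells (max_rows M) = {(i, j). i < j \<and> i + j + 2 \<le> 2 * M}"
  by (auto simp: cells_def max_rows_def)

lemma finite_cells_max_rows: "finite (cells (max_rows M))"
  by (rule finite_subset[of _ "{..2 * M} \<times> {..2 * M}"]) (auto simp: cells_max_rows)

lemma card_cells_max_rows: "card (cells (max_rows M)) = 2 * (\<Sum>j<M. j)"
proof -
  have "cells (max_rows M) = (SIGMA i:{..<M}. {i<..i + max_rows M i})"
    by (auto simp: cells_def max_rows_def)
  then have "card (cells (max_rows M)) = (\<Sum>i<M. 2 * (M - Suc i))" by (simp add: card_SigmaI max_rows_def)
  also have "\<dots> = (\<Sum>j<M. 2 * j)" by (rule sum.nat_diff_reindex)
  finally show ?thesis by (simp add: sum_distrib_left)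
qed

text \<open>The exponent of \<open>var i\<close> is at most the number of cells involving
  \<open>i\<close>. Their other indices are distinct and at most
  \<open>2 * M - 2 - i\<close>.\<close>

lemma stair_bounded_max_rows: "stair_bounded (2 * M) (pairs_poly (cells (max_rows M)))"
  unfolding stair_bounded_def
proof (intro ballI allI)
  fix \<alpha> i assume "\<alpha> \<in> keys (pairs_poly (cells (max_rows M)))"
  then have "lookup \<alpha> i \<le> card {p\<in>cells (max_rows M). fst p = i \<or> snd p = i}"
    by (intro keys_pairs_poly finite_cells_max_rows) (auto simp: cells_def)
  also have "\<dots> \<le> card {..<2 * M - Suc i}"
  proof (rule card_inj_on_le[of "\<lambda>p. if fst p = i then snd p else fst p"])
    show "inj_on (\<lambda>p. if fst p = i then snd p else fst p) {p\<in>cells (max_rows M). fst p = i \<or> snd p = i}"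
      by (auto simp: inj_on_def cells_max_rows split: if_splits)
    show "(\<lambda>p. if fst p = i then snd p else fst p) ` {p\<in>cells (max_rows M). fst p = i \<or> snd p = i} \<subseteq> {..<2 * M - Suc i}"
      by (auto simp: cells_max_rows)
  qed simp
  finally show "lookup \<alpha> i \<le> 2 * M - Suc i" by simp
qed

text \<open>Only the cell \<open>(i, j)\<close> with \<open>i + j = 2 * M - 2\<close> spoils the
  symmetry, and it does so for the reflections at \<open>i\<close> and at \<open>j\<close> alike.
  Its factor has divided difference 1 in both, so both remove this same cell.\<close>

lemma mirror_symmetric_max_rows: "mirror_symmetric M (pairs_poly (cells (max_rows M)))"
  unfolding mirror_symmetric_def
proof (intro conjI allI impI)
  fix i assume i: "Suc i < M"
  define j where "j = 2 * M - 2 - i"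
  have j: "i + j + 2 = 2 * M" "Suc i < j" using i by (simp_all add: j_def)
  define D where "D = cells (max_rows M) - {(i, j)}"
  have D: "cells (max_rows M) = insert (i, j) D" "(i, j) \<notin> D" "finite D"
    using j finite_cells_max_rows by (auto simp: D_def cells_max_rows)
  have iff: "(a, b) \<in> D \<longleftrightarrow> a < b \<and> a + b \<le> i + j \<and> (a, b) \<noteq> (i, j)" for a b
    using j(1) by (auto simp: D_def cells_max_rows)
  have "swap_vars i (pairs_poly D) = pairs_poly D"
  proof (rule swap_vars_pairs_poly[OF D(3)])
    fix a b assume ab: "(a, b) \<in> D" "(a, b) \<noteq> (i, Suc i)"
    then have "a < b" "a + b \<le> i + j" "a = i \<longrightarrow> b \<noteq> j" by (auto simp: iff)
    then show "(simple_refl i a, simple_refl i b) \<in> D"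
      using ab(2) j(2) unfolding iff simple_refl_eq by auto
  qed (simp add: iff)
  then have 1: "ddiff i (pairs_poly (insert (i, j) D)) = pairs_poly D"
    using D j(2) by (intro ddiff_pairs_poly_insert) auto
  have "swap_vars j (pairs_poly D) = pairs_poly D"
  proof (rule swap_vars_pairs_poly[OF D(3)])
    fix a b assume ab: "(a, b) \<in> D" "(a, b) \<noteq> (j, Suc j)"
    then have "a < b" "a + b \<le> i + j" "b = j \<longrightarrow> a \<noteq> i" by (auto simp: iff)
    then show "(simple_refl j a, simple_refl j b) \<in> D"
      using ab(2) j(2) unfolding iff simple_refl_eq by auto
  qed (simp add: iff)
  then have 2: "ddiff j (pairs_poly (insert (i, j) D)) = pairs_poly D"
    using D j(2) by (intro ddiff_pairs_poly_insert) auto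
  show "ddiff i (pairs_poly (cells (max_rows M))) = ddiff (2 * M - 2 - i) (pairs_poly (cells (max_rows M)))"
    unfolding D(1) j_def[symmetric] 1 2 ..
next
  have "swap_vars (M - 1) (pairs_poly (cells (max_rows M))) = pairs_poly (cells (max_rows M))"
    by (rule swap_vars_pairs_poly[OF finite_cells_max_rows]) (auto simp: cells_max_rows simple_refl_eq)
  then show "ddiff (M - 1) (pairs_poly (cells (max_rows M))) = 0" by (simp add: ddiff_eq_0)
qed

section \<open>From the staircase to strict partitions\<close>

definition row_ends :: "(nat \<Rightarrow> nat) \<Rightarrow> bool" where
  "row_ends m \<longleftrightarrow> (\<forall>i j. i < j \<longrightarrow> 0 < m j \<longrightarrow> j + m j \<le> i + m i)"

text \<open>Cells are removed from the bottom row upwards. The last cell of row \<open>r\<close> lies in column \<open>k\<close>, and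
  columns \<open>k\<close> and \<open>k + 1\<close> agree otherwise, since the rows above are still full.\<close>

lemma remove_cell:
  assumes "row_ends m" "r < M" "m r \<le> v" "Suc v \<le> max_rows M r"
  defines "st \<equiv> \<lambda>v a. if a < r then max_rows M a else if a = r then v else m a"
  shows "ddiff (r + Suc v) (pairs_poly (cells (st (Suc v)))) = pairs_poly (cells (st v))"
proof -
  let ?k = "r + Suc v"
  have ends: "a + m a \<le> r + m r" if "r < a" "0 < m a" for a using assms(1) that by (simp add: row_ends_def)
  have ins: "cells (st (Suc v)) = insert (r, ?k) (cells (st v))"
    by (auto simp: cells_def st_def split: if_splits)
  have below: "b \<le> r + v" if "(a, b) \<in> cells (st v)" "r \<le> a" for a b
  proof (cases "a = r")
    case True
    then show ?thesis using that by (simp add: cells_def st_def)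
  next
    case False
    then have "r < a" "b \<le> a + m a" "a < b" using that by (simp_all add: cells_def st_def)
    then show ?thesis using ends[of a] assms(3) by simp
  qed
  have fin: "finite (cells (st v))"
  proof (rule finite_subset)
    show "cells (st v) \<subseteq> {..2 * M + r + v} \<times> {..2 * M + r + v}"
    proof
      fix x assume x: "x \<in> cells (st v)"
      obtain a b where ab: "x = (a, b)" "a < b" "b \<le> a + st v a" using x by (auto simp: cells_def)
      have "b \<le> 2 * M + r + v"
      proof (cases "r \<le> a")
        case True
        then show ?thesis using below[of a b] x ab(1) by simp
      next
        case False
        then show ?thesis using ab(3) assms(2) by (simp add: st_def max_rows_def)
      qed
      then show "x \<in> {..2 * M + r + v} \<times> {..2 * M + r + v}" using ab by simp
    qed
  qed simp
  have "swap_vars ?k (pairs_poly (cells (st v))) = pairs_poly (cells (st v))"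
  proof (rule swap_vars_pairs_poly[OF fin])
    fix a b assume ab: "(a, b) \<in> cells (st v)"
    show "a < b" using ab by (simp add: cells_def)
    show "(simple_refl ?k a, simple_refl ?k b) \<in> cells (st v)"
    proof (cases "r \<le> a")
      case True
      then have "b < ?k" "a < ?k" using below[OF ab] \<open>a < b\<close> by simp_all
      then have "simple_refl ?k a = a" "simple_refl ?k b = b" by (simp_all add: simple_refl_other)
      then show ?thesis using ab by simp
    next
      case False
      then have a: "a < r" by simp
      then have sa: "simple_refl ?k a = a" by (simp add: simple_refl_other)
      \<comment> \<open>Row ends of the staircase move strictly left going down, so a full row above
        \<open>r\<close> covers both columns \<open>?k\<close> and \<open>Suc ?k\<close>.\<close>
      have "Suc ?k \<le> a + st v a" using a assms(2,4) by (simp add: st_def max_rows_def)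
      then show ?thesis using ab a unfolding sa by (auto simp: cells_def simple_refl_eq)
    qed
  qed
  moreover have "(r, ?k) \<notin> cells (st v)" by (simp add: cells_def st_def)
  ultimately show ?thesis unfolding ins by (intro ddiff_pairs_poly_insert[OF fin]) auto
qed

lemma reach_rows:
  assumes "row_ends m" "\<And>i. m i \<le> max_rows M i"
  shows "\<exists>is. foldr ddiff is (pairs_poly (cells (max_rows M))) = pairs_poly (cells m)"
proof -
  \<comment> \<open>Rows from \<open>r\<close> on already have their final length; \<open>r\<close>
    runs down from \<open>M\<close> to 0.\<close>
  define T where "T r = (\<lambda>a. if a < r then max_rows M a else m a)" for r
  have row: "\<exists>is. foldr ddiff is (pairs_poly (cells (T (Suc r)))) = pairs_poly (cells (T r))" if r: "r < M" for r
  proof -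
    define st where "st v = (\<lambda>a. if a < r then max_rows M a else if a = r then v else m a)" for v
    have "m r + d \<le> max_rows M r \<Longrightarrow>
        \<exists>is. foldr ddiff is (pairs_poly (cells (st (m r + d)))) = pairs_poly (cells (st (m r)))" for d
    proof (induction d)
      case 0
      show ?case by (intro exI[of _ "[]"]) simp
    next
      case (Suc d)
      then obtain "is" where "is": "foldr ddiff is (pairs_poly (cells (st (m r + d)))) = pairs_poly (cells (st (m r)))"
        by auto
      have "ddiff (r + Suc (m r + d)) (pairs_poly (cells (st (Suc (m r + d))))) = pairs_poly (cells (st (m r + d)))"
        unfolding st_def using Suc.prems by (intro remove_cell[OF assms(1) r]) simp_all
      then show ?case using "is" by (intro exI[of _ "is @ [r + Suc (m r + d)]"]) simp
    qed
    from this[of "max_rows M r - m r"] obtain "is" where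
      "foldr ddiff is (pairs_poly (cells (st (max_rows M r)))) = pairs_poly (cells (st (m r)))"
      using assms(2)[of r] by auto
    moreover have "st (max_rows M r) = T (Suc r)" "st (m r) = T r"
      by (auto simp: st_def T_def fun_eq_iff less_Suc_eq)
    ultimately show ?thesis by auto
  qed
  have "r \<le> M \<Longrightarrow> \<exists>is. foldr ddiff is (pairs_poly (cells (T r))) = pairs_poly (cells (T 0))" for r
  proof (induction r)
    case 0
    show ?case by (intro exI[of _ "[]"]) simp
  next
    case (Suc r)
    then obtain "is" js where "foldr ddiff is (pairs_poly (cells (T r))) = pairs_poly (cells (T 0))"
      "foldr ddiff js (pairs_poly (cells (T (Suc r)))) = pairs_poly (cells (T r))"
      using row[of r] by auto
    then show ?case by (intro exI[of _ "is @ js"]) simp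
  qed
  moreover have "T M = max_rows M"
  proof
    fix a
    show "T M a = max_rows M a" using assms(2)[of a] by (auto simp: T_def max_rows_def)
  qed
  moreover have "T 0 = m" by (simp add: T_def)
  ultimately show ?thesis by (metis order_refl)
qed

theorem key_positive_cells:
  assumes "row_ends m" "\<And>i. m i \<le> max_rows M i"
  shows "key_positive (pairs_poly (cells m))"
proof -
  let ?f = "pairs_poly (cells (max_rows M))" and ?d = "2 * (\<Sum>j<M. j)"
  have hom: "homogeneous ?d ?f"
    using homogeneous_pairs_poly[OF finite_cells_max_rows] by (simp only: card_cells_max_rows)
  \<comment> \<open>Emptying the whole diagram supplies the permutation with value 1 on which the
    dichotomy rests.\<close>
  have "row_ends (\<lambda>_. 0)" by (simp add: row_ends_def)
  then obtain js where "foldr ddiff js ?f = pairs_poly (cells (\<lambda>_. 0))" using reach_rows[of "\<lambda>_. 0" M] by auto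
  moreover have "cells (\<lambda>_. 0) = {}" by (auto simp: cells_def)
  ultimately have js: "foldr ddiff js ?f = 1" by (simp add: pairs_poly_def)
  define v where "v = word_perm js"
  have v: "reduced_word v js" "op_perm ddiff v ?f = 1"
    using foldr_ddiff_word[of js ?f] js by (simp_all add: v_def split: if_splits)
  have "length js = ?d"
    using homogeneous_foldr_ddiff[OF hom, of js] js by (simp add: homogeneous_1_iff)
  then have lv: "perm_length v = ?d" using v(1) by (simp add: reduced_word_def)
  \<comment> \<open>A letter beyond the staircase would make the value zero instead of 1.\<close>
  have "Suc i < 2 * M" if "i \<in> set js" for i
    using stair_bounded_foldr_0[OF stair_bounded_max_rows that] js by (metis not_le zero_neq_one)
  then have pv: "v permutes {..<2 * M}" unfolding v_def by (intro word_perm_permutes) blast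
  have "op_perm ddiff w ?f \<in> {0, 1}" if "w permutes {..<2 * M}" "perm_length w = ?d" for w
    by (rule mirror_symmetric_ddiff[OF mirror_symmetric_max_rows that pv lv v(2)])
  from schubert_expansion[OF stair_bounded_max_rows hom this]
  obtain A where A: "?f = (\<Sum>w\<in>A. schubert (2 * M) w)" "\<And>w. w \<in> A \<Longrightarrow> w permutes {..<2 * M}" by blast
  \<comment> \<open>The word that cuts the staircase down to \<open>m\<close> sends each Schubert
    polynomial to zero or to a Schubert polynomial, so positivity passes to the smaller
    diagram.\<close>
  obtain "is" where "foldr ddiff is ?f = pairs_poly (cells m)" using reach_rows[OF assms] by blast
  then have "pairs_poly (cells m) = (\<Sum>w\<in>A. foldr ddiff is (schubert (2 * M) w))"
    unfolding A(1) foldr_ddiff_sum by simp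
  then show ?thesis
    using A(2) by (simp add: nonneg_combination_sum key_positive_foldr_ddiff_schubert)
qed

lemma strict_partition_row_ends:
  assumes "is_strict_partition \<mu>"
  shows "row_ends (lookup \<mu>)"
  unfolding row_ends_def
proof (intro allI impI)
  fix i j assume ij: "i < j" "0 < lookup \<mu> j"
  have dec: "lookup \<mu> b \<le> lookup \<mu> a" if "a \<le> b" for a b
    using assms that by (simp add: is_strict_partition_def is_partition_def)
  have "i + d \<le> j \<Longrightarrow> lookup \<mu> (i + d) + d \<le> lookup \<mu> i" for d
  proof (induction d)
    case (Suc d)
    have "0 < lookup \<mu> (i + d)" "0 < lookup \<mu> (i + Suc d)"
      using dec[of "i + d" j] dec[of "i + Suc d" j] Suc.prems ij(2) by simp_all
    then have "lookup \<mu> (i + d) \<noteq> lookup \<mu> (i + Suc d)"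
      using assms unfolding is_strict_partition_def by (metis add_left_cancel n_not_Suc_n not_gr_zero)
    then have "lookup \<mu> (i + Suc d) < lookup \<mu> (i + d)"
      using dec[of "i + d" "i + Suc d"] by simp
    then show ?case using Suc by simp
  qed simp
  from this[of "j - i"] show "j + lookup \<mu> j \<le> i + lookup \<mu> i" using ij(1) by simp
qed

lemma strict_partition_max_rows:
  assumes "is_strict_partition \<mu>"
  shows "\<exists>M. \<forall>i. lookup \<mu> i \<le> max_rows M i"
proof -
  obtain N where N: "keys \<mu> \<subseteq> {..<N}"
    using finite_nat_set_iff_bounded[of "keys \<mu>"] by auto
  \<comment> \<open>\<open>N\<close> bounds the number of nonempty rows; adding the largest part
    makes each of these staircase rows at least twice that part long.\<close>
  have "lookup \<mu> i \<le> max_rows (N + lookup \<mu> 0) i" for i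
  proof (cases "i < N")
    case True
    have "lookup \<mu> i \<le> lookup \<mu> 0"
      using assms by (simp add: is_strict_partition_def is_partition_def)
    then show ?thesis using True by (simp add: max_rows_def)
  next
    case False
    then have "i \<notin> keys \<mu>" using N by auto
    then show ?thesis by (simp add: in_keys_iff)
  qed
  then show ?thesis by blast
qed

lemma finite_cells: "finite (keys \<mu>) \<Longrightarrow> (\<And>i. m i \<le> lookup \<mu> i) \<Longrightarrow> finite (cells m)"
proof -
  assume le: "\<And>i. m i \<le> lookup \<mu> i"
  have "cells m \<subseteq> (SIGMA i:keys \<mu>. {..i + lookup \<mu> i})"
  proof
    fix x assume "x \<in> cells m"
    then obtain i j where x: "x = (i, j)" "i < j" "j \<le> i + m i" by (auto simp: cells_def)
    then show "x \<in> (SIGMA i:keys \<mu>. {..i + lookup \<mu> i})"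
      using le[of i] by (auto simp: in_keys_iff)
  qed
  then show "finite (cells m)" by (rule finite_subset) auto
qed

lemma prod_P:
  "(\<Prod>(i, j)\<in>young_diagram \<mu>. var i + var (i + j)) = pairs_poly (cells (lookup \<mu>))"
  unfolding pairs_poly_def
  by (rule prod.reindex_bij_witness[of _ "\<lambda>(i, c). (i, c - i)" "\<lambda>(i, j). (i, i + j)"])
    (auto simp: young_diagram_def cells_def)

text \<open>The first column contributes the factors \<open>2 * var i\<close>; the other columns
  form the product of type P for the parts lowered by one.\<close>

lemma prod_Q:
  assumes "is_partition \<mu>"
  shows "\<exists>l. (\<Prod>(i, j)\<in>young_diagram \<mu>. var i + var (i + j - 1))
    = of_nat (2 ^ l) * (vars {..<l} * pairs_poly (cells (\<lambda>i. lookup \<mu> i - 1)))"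
proof -
  \<comment> \<open>The number of nonzero parts, equally the number of cells in the first
    column.\<close>
  define l where "l = (LEAST i. lookup \<mu> i = 0)"
  have ex: "\<exists>i. lookup \<mu> i = 0"
    using ex_new_if_finite[OF infinite_UNIV_nat finite_keys[of \<mu>]] by (auto simp: in_keys_iff)
  have l: "lookup \<mu> i = 0 \<longleftrightarrow> l \<le> i" for i
  proof
    show "lookup \<mu> i = 0 \<Longrightarrow> l \<le> i" unfolding l_def by (rule Least_le)
    assume "l \<le> i"
    moreover have "lookup \<mu> l = 0" unfolding l_def by (rule LeastI_ex[OF ex])
    ultimately show "lookup \<mu> i = 0" using assms unfolding is_partition_def by (metis le_zero_eq)
  qed
  define A B where "A = {p \<in> young_diagram \<mu>. snd p = 1}" and "B = {p \<in> young_diagram \<mu>. snd p \<noteq> 1}"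
  have "(\<Prod>(i, j)\<in>young_diagram \<mu>. var i + var (i + j - 1))
      = (\<Prod>(i, j)\<in>A. var i + var (i + j - 1)) * (\<Prod>(i, j)\<in>B. var i + var (i + j - 1))"
  proof -
    have "young_diagram \<mu> = A \<union> B" "A \<inter> B = {}" by (auto simp: A_def B_def)
    moreover have "finite A" "finite B" using finite_young_diagram by (simp_all add: A_def B_def)
    ultimately show ?thesis by (simp add: prod.union_disjoint)
  qed
  also have "A = (\<lambda>i. (i, 1)) ` {..<l}"
  proof -
    have "1 \<le> lookup \<mu> i \<longleftrightarrow> i < l" for i using l[of i] by linarith
    then have "(i, j) \<in> A \<longleftrightarrow> i < l \<and> j = 1" for i j
      unfolding A_def young_diagram_def by (cases "j = 1") simp_all
    then show ?thesis by (intro set_eqI) (auto simp: image_iff split_paired_all)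
  qed
  also have "(\<Prod>(i, j)\<in>(\<lambda>i. (i, 1)) ` {..<l}. var i + var (i + j - 1)) = (\<Prod>i<l. 2 * var i)"
    by (subst prod.reindex) (auto simp: inj_on_def)
  also have "\<dots> = of_nat (2 ^ l) * vars {..<l}" by (simp add: prod.distrib vars_def)
  also have "(\<Prod>(i, j)\<in>B. var i + var (i + j - 1)) = pairs_poly (cells (\<lambda>i. lookup \<mu> i - 1))"
    unfolding pairs_poly_def
    by (rule prod.reindex_bij_witness[of _ "\<lambda>(i, c). (i, Suc c - i)" "\<lambda>(i, j). (i, i + j - 1)"])
      (auto simp: B_def young_diagram_def cells_def)
  finally show ?thesis by (auto simp: mult.assoc)
qed

theorem theorem2p9:
  fixes w :: "nat \<Rightarrow> nat" and \<mu> :: wcomp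
  assumes "w \<in> S_inf" and "is_strict_partition \<mu>"
  shows "key_P w \<mu> \<noteq> 0 \<and> nonneg_combination key_poly (key_P w \<mu>)
       \<and> key_Q w \<mu> \<noteq> 0 \<and> nonneg_combination key_poly (key_Q w \<mu>)
       \<and> nonneg_combination atom_poly (atom_P w \<mu>)
       \<and> nonneg_combination atom_poly (atom_Q w \<mu>)"
proof -
  let ?m = "lookup \<mu>"
  define P Q where "P = (\<Prod>(i, j)\<in>young_diagram \<mu>. var i + var (i + j))"
    and "Q = (\<Prod>(i, j)\<in>young_diagram \<mu>. var i + var (i + j - 1))"
  have ends: "row_ends ?m" by (rule strict_partition_row_ends[OF assms(2)])
  obtain M where M: "\<And>i. ?m i \<le> max_rows M i" using strict_partition_max_rows[OF assms(2)] by blast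
  \<comment> \<open>All ends of nonempty rows move left by one, so their order persists. Rows of
    length one become empty, and \<open>row_ends\<close> allows several empty rows, so strictness
    may be lost.\<close>
  have "row_ends (\<lambda>i. ?m i - 1)" using ends by (fastforce simp: row_ends_def)
  moreover have "?m i - 1 \<le> max_rows M i" for i using M[of i] by simp
  ultimately have Q': "key_positive (pairs_poly (cells (\<lambda>i. ?m i - 1)))"
    by (rule key_positive_cells)
  obtain l where l: "Q = of_nat (2 ^ l) * (vars {..<l} * pairs_poly (cells (\<lambda>i. ?m i - 1)))"
    using prod_Q[of \<mu>] assms(2) by (auto simp: Q_def is_strict_partition_def)
  have P: "P = pairs_poly (cells ?m)" unfolding P_def by (rule prod_P)
  have posP: "key_positive P" unfolding P using ends M by (rule key_positive_cells)
  have posQ: "key_positive Q"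
    unfolding l by (intro nonneg_combination_of_nat_mult key_positive_vars_mult Q')
  have nzP: "P \<noteq> 0" unfolding P by (intro pairs_poly_nonzero finite_cells[of \<mu>]) simp_all
  have "vars {..<l} \<noteq> 0"
  proof -
    have "var i \<noteq> 0" for i
    proof
      assume "var i = 0"
      then have "lookup (var i) (single i 1) = 0" by simp
      then show False by (simp add: var_def mon_def)
    qed
    then show ?thesis by (simp add: vars_def prod_zero_iff)
  qed
  moreover have "pairs_poly (cells (\<lambda>i. ?m i - 1)) \<noteq> 0"
    by (intro pairs_poly_nonzero finite_cells[of \<mu>]) simp_all
  ultimately have nzQ: "Q \<noteq> 0" unfolding l by simp
  show ?thesis
    unfolding key_P_def key_Q_def atom_P_def atom_Q_def demazure_perm_op_perm demazure_bar_perm_op_perm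
      P_def[symmetric] Q_def[symmetric]
    using posP posQ nzP nzQ assms(1)
    by (simp add: key_positive_op_perm key_positive_op_perm_nonzero atom_positive_op_perm)
qed

end
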